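(* There are $0<\eta<\tfrac12$ and an absolute constant $c>0$ such that for every $N\ge 1$ and every collection $\mathcal A_N\subset[0,1]^3$ of $N$ points, the discrepancy function $D_N$ of $\mathcal A_N$ satisfies $$\|D_N\|_\infty\;\ge\; c\,(\log N)^{1+\eta}.$$
   Context: For a set $\mathcal A_N$ of $N$ points in $[0,1]^d$, the discrepancy function is $D_N(x)=\sharp\bigl(\mathcal A_N\cap[\vec 0,x)\bigr)-N\,\bigl|[\vec 0,x)\bigr|$ for $x\in[0,1]^d$, where $[\vec 0,x)=\prod_{j=1}^d[0,x_j)$ and $|\cdot|$ is Lebesgue measure. $\|\cdot\|_\infty$ is the $L^\infty([0,1]^d)$ norm; here $d=3$. *)

theory Defs
  imports "HOL-Probability.Essential_Supremum"
begin

abbreviation unit_cube :: "(real ^ 'd) set"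
  where "unit_cube \<equiv> cbox 0 1"

definition anchored_box :: "real ^ 'd \<Rightarrow> (real ^ 'd) set"
  where "anchored_box x = {y. \<forall>j. 0 \<le> y $ j \<and> y $ j < x $ j}"

text \<open>The number of points is not a separate parameter: it is the cardinality of the
  (finite) point set.\<close>

definition discrepancy :: "(real ^ 'd) set \<Rightarrow> real ^ 'd \<Rightarrow> real"
  where "discrepancy A x =
    real (card (A \<inter> anchored_box x)) - real (card A) * measure lebesgue (anchored_box x)"

text \<open>The essential supremum of the library is \<open>\<infinity>\<close> by convention on non-measurable functions;
  the lemma \<open>discrepancy_measurable\<close> below shows that this convention plays no role
  for discrepancy functions.\<close>

definition Linf_norm :: "'a measure \<Rightarrow> ('a \<Rightarrow> real) \<Rightarrow> ereal"
  where "Linf_norm M f = esssup M (\<lambda>x. ereal \<bar>f x\<bar>)"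

lemma anchored_box_measure:
  fixes x :: "real ^ 'd"
  assumes "x \<in> unit_cube"
  shows "measure lebesgue (anchored_box x) = (\<Prod>j\<in>UNIV. x $ j)"
proof -
  have x0: "0 \<le> x $ j" for j
    using assms by (auto simp: mem_box_cart)
  have sub: "box 0 x \<subseteq> anchored_box x" "anchored_box x \<subseteq> cbox 0 x"
    by (auto simp: anchored_box_def mem_box_cart less_imp_le)
  have null: "cbox 0 x - box 0 x \<in> null_sets lebesgue"
    using negligible_frontier_interval[of 0 x] negligible_iff_null_sets by blast
  have "anchored_box x - box 0 x \<in> null_sets lebesgue"
    by (rule null_sets_completion_subset[OF _ null]) (use sub in auto)
  then have "measure lebesgue (box 0 x \<union> (anchored_box x - box 0 x)) = measure lebesgue (box 0 x)"
    by (intro measure_Un_null_set) auto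
  moreover have "box 0 x \<union> (anchored_box x - box 0 x) = anchored_box x"
    using sub by auto
  moreover have "measure lebesgue (box 0 x) = measure lebesgue (cbox 0 x)"
    by (simp add: measure_lborel_box_eq measure_lborel_cbox_eq)
  moreover have "measure lebesgue (cbox 0 x) = (\<Prod>j\<in>UNIV. x $ j)"
  proof -
    have "0 \<in> cbox 0 x"
      using x0 by (simp add: mem_box_cart)
    then have "cbox 0 x \<noteq> {}"
      by blast
    from content_cbox_cart[OF this] show ?thesis by simp
  qed
  ultimately show ?thesis by simp
qed

lemma discrepancy_measurable:
  fixes A :: "(real ^ 'd) set"
  assumes "finite A"
  shows "discrepancy A \<in> borel_measurable (lebesgue_on unit_cube)"
proof -
  define g :: "real ^ 'd \<Rightarrow> real" where
    "g = (\<lambda>x. (\<Sum>a\<in>A. indicator {x. a \<in> anchored_box x} x) - real (card A) * (\<Prod>j\<in>UNIV. x $ j))"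
  have "open {x. \<forall>j. a $ j < x $ j}" for a :: "real ^ 'd"
  proof -
    have "open (\<Inter>j. {x. a $ j < x $ j})"
      by (intro open_INT ballI finite open_Collect_less continuous_intros)
    then show ?thesis by (simp add: Collect_all_eq)
  qed
  moreover have "{x. a \<in> anchored_box x} =
      (if \<forall>j. 0 \<le> a $ j then {x. \<forall>j. a $ j < x $ j} else {})" for a :: "real ^ 'd"
    by (auto simp: anchored_box_def)
  ultimately have [measurable]: "{x. a \<in> anchored_box x} \<in> sets borel" for a :: "real ^ 'd"
    by simp
  have "continuous_on UNIV (\<lambda>x :: real ^ 'd. \<Prod>j\<in>UNIV. x $ j)"
    by (intro continuous_intros)
  then have [measurable]: "(\<lambda>x :: real ^ 'd. \<Prod>j\<in>UNIV. x $ j) \<in> borel_measurable borel"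
    by (rule borel_measurable_continuous_onI)
  have "g \<in> borel_measurable borel"
    unfolding g_def by measurable
  then have "g \<in> borel_measurable lebesgue"
    by (simp add: measurable_completion)
  then have "g \<in> borel_measurable (lebesgue_on unit_cube)"
    by (rule measurable_restrict_space1)
  moreover have "discrepancy A x = g x" if "x \<in> unit_cube" for x
    using that assms
    by (simp add: discrepancy_def g_def anchored_box_measure indicator_def Int_def sum.If_cases)
  ultimately show ?thesis
    by (subst measurable_cong[of _ _ g]) auto
qed

end

theory Submission
  imports Defs "HOL-Real_Asymp.Real_Asymp"
begin

text \<open>The proof tests the discrepancy function \<open>D\<close> against a short Riesz product, following Bilyk and
  Lacey. Choose \<open>n\<close> with \<open>2 N \<le> 2\<^sup>n \<le> 4 N\<close>. For \<open>m + a + b = n\<close> a sum of Haar functions over the dyadic boxes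
  of side lengths \<open>2\<^sup>-\<^sup>m, 2\<^sup>-\<^sup>a, 2\<^sup>-\<^sup>b\<close> that contain no point of the set has an inner product with \<open>D\<close>
  bounded below. Group these functions into blocks \<open>F 0, \<dots>, F (q - 1)\<close> according to \<open>m\<close>, with \<open>q\<close> a small
  power of \<open>n\<close>. In the product of the \<open>1 + \<rho> F t\<close> keep only the terms whose frequencies are distinct
  in every coordinate: these integrate to 0, and all but the linear ones are nearly orthogonal to \<open>D\<close>.
  The truncated product equals the full product up to sums over coincident frequencies, and
  outside a set of tiny measure each such sum has a power saving in \<open>n\<close> for every factor involved, so
  that it is positive there; hence its \<open>L\<^sup>1\<close> norm is bounded. All tail estimates are
  exponential supermartingale bounds that use nothing but the sign changes of Haar functions under
  flipping a binary digit. Only \<open>\<eta> = 1/496\<close> is aimed at, which permits very crude bounds.\<close>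

section \<open>Averages and sign martingales\<close>

text \<open>Two demands conflict. The linear part of the Riesz product contributes about
  \<open>\<rho> * n\<^sup>2\<close>, so an exponent above 1 needs \<open>\<rho>\<close> to exceed
  \<open>1 / n\<close> by a power of \<open>n\<close>; a single factor carrying all the functions
  would then have typical size \<open>\<rho> * n\<close>, far above 1. Cutting into \<open>q\<close>
  blocks lowers the variance of a factor to about \<open>(\<rho> * n)\<^sup>2 / q\<close>, which
  keeps \<open>1 + \<rho> F t\<close> positive outside a small set. The price is the number of
  coincidence patterns, which grows with \<open>q\<close>. Sizes are measured in powers of
  \<open>\<kappa>\<close>, where \<open>\<kappa> ^ 16 = n + 1\<close>. A sum over coincident
  frequencies saves one power of \<open>\<kappa>\<close> per factor: it is at most
  \<open>\<kappa> ^ 15 * z\<close> for each. With \<open>\<rho> = y / (n + 1)\<close>, a factor in a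
  coincidence thus weighs about \<open>y * z / \<kappa>\<close>. For \<open>z = y ^ 4\<close> and
  \<open>q\<close> about \<open>y ^ 6\<close>, summability over all patterns asks that
  \<open>q ^ 4 * y ^ 5 / \<kappa>\<close> be small. The choice \<open>\<kappa> = y ^ 31\<close>
  achieves this, and 496 is 16 times 31.\<close>

lemma cosh_le_exp_square: "exp x + exp (- x) \<le> 2 * exp (x\<^sup>2 / 2)" for x :: real
proof -
  have fact: "2 ^ n * fact n \<le> (fact (2 * n) :: real)" for n
  proof (induction n)
    case (Suc n)
    have "2 ^ Suc n * fact (Suc n) = (2 * real n + 2) * (2 ^ n * fact n :: real)"
      by (simp add: algebra_simps)
    also have "\<dots> \<le> (2 * real n + 2) * fact (2 * n)"
      using Suc by (intro mult_left_mono) auto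
    also have "\<dots> \<le> (2 * real n + 2) * ((2 * real n + 1) * fact (2 * n))"
      by (intro mult_left_mono) (auto simp: algebra_simps)
    also have "\<dots> = fact (2 * Suc n)"
      by (simp add: algebra_simps)
    finally show ?case .
  qed simp
  have "(\<lambda>n. if even n then x ^ n /\<^sub>R fact n else 0) sums cosh x"
    by (rule cosh_converges)
  moreover have "strict_mono (\<lambda>n :: nat. 2 * n)"
    by (simp add: strict_mono_def)
  ultimately have "(\<lambda>n. if even (2 * n) then x ^ (2 * n) /\<^sub>R fact (2 * n) else 0) sums cosh x"
    by (subst sums_mono_reindex) auto
  then have "(\<lambda>n. x ^ (2 * n) / fact (2 * n)) sums cosh x"
    by (simp add: divide_inverse mult.commute)
  moreover have "(\<lambda>n. (x\<^sup>2 / 2) ^ n /\<^sub>R fact n) sums exp (x\<^sup>2 / 2)"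
    by (rule exp_converges)
  moreover have "x ^ (2 * n) / fact (2 * n) \<le> (x\<^sup>2 / 2) ^ n /\<^sub>R fact n" for n
  proof -
    have "x ^ (2 * n) / fact (2 * n) \<le> x ^ (2 * n) / (2 ^ n * fact n)"
      by (rule divide_left_mono[OF fact]) simp_all
    also have "\<dots> = (x\<^sup>2 / 2) ^ n /\<^sub>R fact n"
      unfolding power_divide power_mult by (simp add: divide_inverse)
    finally show ?thesis .
  qed
  ultimately have "cosh x \<le> exp (x\<^sup>2 / 2)"
    by (rule sums_le[rotated])
  then show ?thesis
    by (simp add: cosh_field_def)
qed

locale finite_space =
  fixes \<Omega> :: "'x set"
  assumes finite_space: "finite \<Omega>" and nonempty_space: "\<Omega> \<noteq> {}"
begin

definition avg :: "('x \<Rightarrow> real) \<Rightarrow> real"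
  where "avg X = (\<Sum>x\<in>\<Omega>. X x) / card \<Omega>"

definition whp :: "real \<Rightarrow> ('x \<Rightarrow> bool) \<Rightarrow> bool"
  where "whp e P \<longleftrightarrow> real (card {x \<in> \<Omega>. \<not> P x}) \<le> e * real (card \<Omega>)"

definition involution :: "('x \<Rightarrow> 'x) \<Rightarrow> bool"
  where "involution \<tau> \<longleftrightarrow> (\<forall>x\<in>\<Omega>. \<tau> x \<in> \<Omega> \<and> \<tau> (\<tau> x) = x)"

lemma card_pos: "0 < card \<Omega>"
  using finite_space nonempty_space by (simp add: card_gt_0_iff)

lemma whp_mono: "whp e P \<Longrightarrow> (\<And>x. x \<in> \<Omega> \<Longrightarrow> P x \<Longrightarrow> Q x) \<Longrightarrow> e \<le> e' \<Longrightarrow> whp e' Q"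
proof -
  assume "whp e P" and PQ: "\<And>x. x \<in> \<Omega> \<Longrightarrow> P x \<Longrightarrow> Q x" and "e \<le> e'"
  have "card {x \<in> \<Omega>. \<not> Q x} \<le> card {x \<in> \<Omega>. \<not> P x}"
    using PQ finite_space by (intro card_mono) auto
  also have "\<dots> \<le> e * card \<Omega>"
    using \<open>whp e P\<close> by (simp add: whp_def)
  also have "\<dots> \<le> e' * card \<Omega>"
    using \<open>e \<le> e'\<close> by (intro mult_right_mono) auto
  finally show "whp e' Q"
    by (simp add: whp_def)
qed

lemma whp_conj:
  assumes "whp e P" "whp e' Q"
  shows "whp (e + e') (\<lambda>x. P x \<and> Q x)"
proof -
  have "{x \<in> \<Omega>. \<not> (P x \<and> Q x)} = {x \<in> \<Omega>. \<not> P x} \<union> {x \<in> \<Omega>. \<not> Q x}"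
    by auto
  then have "card {x \<in> \<Omega>. \<not> (P x \<and> Q x)} \<le> card {x \<in> \<Omega>. \<not> P x} + card {x \<in> \<Omega>. \<not> Q x}"
    by (simp only: card_Un_le)
  then have "real (card {x \<in> \<Omega>. \<not> (P x \<and> Q x)}) \<le>
      real (card {x \<in> \<Omega>. \<not> P x}) + real (card {x \<in> \<Omega>. \<not> Q x})"
    by linarith
  then show ?thesis
    using assms unfolding whp_def distrib_right by linarith
qed

lemma whp_ball:
  fixes e :: real
  assumes "finite I" "\<And>i. i \<in> I \<Longrightarrow> whp e (P i)"
  shows "whp (card I * e) (\<lambda>x. \<forall>i\<in>I. P i x)"
  using assms
proof (induction I rule: finite_induct)
  case empty
  then show ?case by (simp add: whp_def)
next
  case (insert i I)
  have "whp (e + card I * e) (\<lambda>x. P i x \<and> (\<forall>i\<in>I. P i x))"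
    using insert by (intro whp_conj) auto
  then show ?case
    by (rule whp_mono) (use insert in \<open>auto simp: algebra_simps\<close>)
qed

lemma sum_involution:
  assumes "involution \<tau>"
  shows "(\<Sum>x\<in>\<Omega>. X (\<tau> x)) = (\<Sum>x\<in>\<Omega>. X x)"
  by (rule sum.reindex_bij_witness[where i = \<tau> and j = \<tau>])
    (use assms in \<open>auto simp: involution_def\<close>)

lemma avg_involution: "involution \<tau> \<Longrightarrow> avg (\<lambda>x. X (\<tau> x)) = avg X"
  by (simp add: avg_def sum_involution)

lemma avg_odd:
  assumes "involution \<tau>" "\<And>x. x \<in> \<Omega> \<Longrightarrow> X (\<tau> x) = - X x"
  shows "avg X = 0"
proof -
  have "(\<Sum>x\<in>\<Omega>. X x) = (\<Sum>x\<in>\<Omega>. - X x)"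
    using assms(2) sum_involution[OF assms(1), of X] by simp
  then show ?thesis by (simp add: avg_def sum_negf)
qed

lemma avg_mono: "(\<And>x. x \<in> \<Omega> \<Longrightarrow> X x \<le> Y x) \<Longrightarrow> avg X \<le> avg Y"
  by (simp add: avg_def sum_mono divide_right_mono)

lemma avg_add: "avg (\<lambda>x. X x + Y x) = avg X + avg Y"
  by (simp add: avg_def sum.distrib add_divide_distrib)

lemma avg_diff: "avg (\<lambda>x. X x - Y x) = avg X - avg Y"
  by (simp add: avg_def sum_subtractf diff_divide_distrib)

lemma avg_cmult: "avg (\<lambda>x. c * X x) = c * avg X"
  by (simp add: avg_def sum_distrib_left)

lemma avg_const [simp]: "avg (\<lambda>x. c) = c"
  using card_pos by (simp add: avg_def)

lemma avg_sum: "avg (\<lambda>x. \<Sum>i\<in>I. X i x) = (\<Sum>i\<in>I. avg (X i))"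
  unfolding avg_def by (subst sum.swap) (simp add: sum_divide_distrib)

lemma avg_abs_le: "\<bar>avg X\<bar> \<le> avg (\<lambda>x. \<bar>X x\<bar>)"
  by (simp add: avg_def divide_right_mono sum_abs)

lemma avg_of_bool_le: "whp e P \<Longrightarrow> avg (\<lambda>x. of_bool (\<not> P x)) \<le> e"
proof -
  assume "whp e P"
  moreover have "(\<Sum>x\<in>\<Omega>. of_bool (\<not> P x)) = real (card {x \<in> \<Omega>. \<not> P x})"
    using finite_space by (simp add: of_bool_def sum.If_cases Int_def)
  ultimately show ?thesis
    using card_pos by (simp add: avg_def whp_def pos_divide_le_eq)
qed

text \<open>Ordered by \<open>key\<close>, the \<open>Z i\<close> behave like martingale differences of the form
  (fair sign) times (predictable weight).\<close>

definition sign_martingale :: "(nat \<Rightarrow> 'x \<Rightarrow> 'x) \<Rightarrow> 'i set \<Rightarrow> ('i \<Rightarrow> nat) \<Rightarrow> ('i \<Rightarrow> 'x \<Rightarrow> real) \<Rightarrow> bool"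
  where "sign_martingale \<tau> I key Z \<longleftrightarrow> finite I \<and> inj_on key I \<and>
    (\<forall>i\<in>I. involution (\<tau> (key i)) \<and> (\<forall>x\<in>\<Omega>. Z i (\<tau> (key i) x) = - Z i x) \<and>
      (\<forall>j\<in>I. key j < key i \<longrightarrow> (\<forall>x\<in>\<Omega>. Z j (\<tau> (key i) x) = Z j x)))"

lemma sign_martingale_scale:
  "sign_martingale \<tau> I key Z \<Longrightarrow> sign_martingale \<tau> I key (\<lambda>i x. c i * Z i x)"
  by (simp add: sign_martingale_def)

text \<open>The index with the largest key is split off. Its flip fixes all other terms, and
  averaging over the flip turns the last factor into
  \<open>cosh (Z i x) * exp (- (Z i x)\<^sup>2 / 2)\<close>, which is at most 1. Because the square
  sits inside the exponent, the \<open>Z i\<close> may be random weights without any a priori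
  bound.\<close>

lemma sign_martingale_exp:
  assumes "sign_martingale \<tau> I key Z"
  shows "avg (\<lambda>x. exp (\<Sum>i\<in>I. Z i x - (Z i x)\<^sup>2 / 2)) \<le> 1"
proof -
  have "finite I"
    using assms by (simp add: sign_martingale_def)
  then show ?thesis
    using assms
  proof (induction I rule: finite_ranking_induct[where f = key])
    case empty
    then show ?case by simp
  next
    case (insert i I)
    show ?case
    proof (cases "i \<in> I")
      case True
      then show ?thesis using insert by (simp add: insert_absorb)
    next
      case False
      define A where "A x = exp (\<Sum>j\<in>I. Z j x - (Z j x)\<^sup>2 / 2)" for x
      define U where "U x = exp (Z i x - (Z i x)\<^sup>2 / 2)" for x
      define \<tau>' where "\<tau>' = \<tau> (key i)"
      have \<tau>': "involution \<tau>'"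
        using insert.prems by (simp add: sign_martingale_def \<tau>'_def)
      have less: "key j < key i" if "j \<in> I" for j
        using insert.hyps(2)[OF that] insert.prems that False
        unfolding sign_martingale_def inj_on_def by (metis insertCI le_neq_implies_less)
      have A: "A (\<tau>' x) = A x" if "x \<in> \<Omega>" for x
        unfolding A_def using insert.prems less that
        by (intro arg_cong[where f = exp] sum.cong) (auto simp: sign_martingale_def \<tau>'_def)
      have "avg (\<lambda>x. A x * U x) = (avg (\<lambda>x. A x * U x) + avg (\<lambda>x. A (\<tau>' x) * U (\<tau>' x))) / 2"
        by (subst avg_involution[OF \<tau>']) simp
      also have "\<dots> = avg (\<lambda>x. A x * U x + A (\<tau>' x) * U (\<tau>' x)) / 2"
        by (simp add: avg_add)
      also have "avg (\<lambda>x. A x * U x + A (\<tau>' x) * U (\<tau>' x)) \<le> avg (\<lambda>x. 2 * A x)"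
      proof (rule avg_mono)
        fix x assume x: "x \<in> \<Omega>"
        have "Z i (\<tau>' x) = - Z i x"
          using insert.prems x by (simp add: sign_martingale_def \<tau>'_def)
        then have "U x + U (\<tau>' x) = (exp (Z i x) + exp (- Z i x)) * exp (- ((Z i x)\<^sup>2 / 2))"
          by (simp add: U_def distrib_right exp_add[symmetric])
        also have "\<dots> \<le> 2 * exp ((Z i x)\<^sup>2 / 2) * exp (- ((Z i x)\<^sup>2 / 2))"
          by (intro mult_right_mono cosh_le_exp_square) simp
        also have "\<dots> = 2"
          by (simp add: mult.assoc exp_add[symmetric])
        finally have "A x * (U x + U (\<tau>' x)) \<le> A x * 2"
          by (intro mult_left_mono) (auto simp: A_def)
        then show "A x * U x + A (\<tau>' x) * U (\<tau>' x) \<le> 2 * A x"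
          by (simp add: A[OF x] algebra_simps)
      qed
      finally have "avg (\<lambda>x. A x * U x) \<le> avg A"
        by (simp add: avg_cmult)
      also have "\<dots> \<le> 1"
        unfolding A_def using insert by (auto simp: sign_martingale_def)
      finally show ?thesis
        using False insert.hyps(1) by (simp add: A_def U_def exp_add[symmetric] add.commute)
    qed
  qed
qed

text \<open>A Chernoff bound for both signs of the sum. The quadratic variation has to be controlled
  only at the points where the conclusion is claimed, since the supermartingale already contains it;
  this lets bounds that hold merely with high probability be fed in later.\<close>

lemma sign_martingale_tail:
  assumes Z: "sign_martingale \<tau> I key Z" and K: "0 < K" and z: "0 \<le> z"
  shows "whp (2 * exp (- z\<^sup>2)) (\<lambda>x. (\<Sum>i\<in>I. (Z i x)\<^sup>2) \<le> K \<longrightarrow> \<bar>\<Sum>i\<in>I. Z i x\<bar> \<le> z * sqrt (2 * K))"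
proof -
  define s where "s = z * sqrt (2 * K)"
  \<comment> \<open>This value maximises \<open>l * s - l\<^sup>2 * K / 2\<close>; the maximum is
    \<open>z\<^sup>2\<close>.\<close>
  define l where "l = s / K"
  have s: "s\<^sup>2 = 2 * z\<^sup>2 * K" "0 \<le> s"
    using K z by (auto simp: s_def power_mult_distrib)
  have l: "0 \<le> l" "l * s - l\<^sup>2 * K / 2 = z\<^sup>2"
    using K s by (auto simp: l_def field_simps power2_eq_square)
  define E where "E c x = exp (\<Sum>i\<in>I. c * Z i x - (c * Z i x)\<^sup>2 / 2)" for c x
  have E: "avg (E c) \<le> 1" for c
    unfolding E_def by (rule sign_martingale_exp) (rule sign_martingale_scale[OF Z, of "\<lambda>_. c"])
  define B where "B = {x \<in> \<Omega>. \<not> ((\<Sum>i\<in>I. (Z i x)\<^sup>2) \<le> K \<longrightarrow> \<bar>\<Sum>i\<in>I. Z i x\<bar> \<le> s)}"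
  have B: "exp (z\<^sup>2) \<le> E l x + E (- l) x" if "x \<in> B" for x
  proof -
    let ?Z = "\<Sum>i\<in>I. Z i x" and ?Q = "\<Sum>i\<in>I. (Z i x)\<^sup>2"
    have ex: "E c x = exp (c * ?Z - c\<^sup>2 / 2 * ?Q)" for c
      by (simp add: E_def sum_subtractf sum_distrib_left power_mult_distrib sum_divide_distrib)
    have Q: "?Q \<le> K" and Zs: "s \<le> \<bar>?Z\<bar>"
      using that by (auto simp: B_def)
    have "l\<^sup>2 / 2 * ?Q \<le> l\<^sup>2 / 2 * K"
      using Q by (intro mult_left_mono) auto
    moreover have "l * s \<le> l * \<bar>?Z\<bar>"
      using Zs l by (intro mult_left_mono)
    ultimately have "z\<^sup>2 \<le> l * \<bar>?Z\<bar> - l\<^sup>2 / 2 * ?Q"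
      using l by linarith
    then have "exp (z\<^sup>2) \<le> exp (l * \<bar>?Z\<bar> - l\<^sup>2 / 2 * ?Q)"
      by simp
    also have "\<dots> \<le> E l x + E (- l) x"
    proof (cases "?Z \<ge> 0")
      case True
      then have "exp (l * \<bar>?Z\<bar> - l\<^sup>2 / 2 * ?Q) = E l x"
        by (simp add: ex)
      then show ?thesis
        by (simp add: E_def)
    next
      case False
      then have "exp (l * \<bar>?Z\<bar> - l\<^sup>2 / 2 * ?Q) = E (- l) x"
        by (simp add: ex)
      then show ?thesis
        by (simp add: E_def)
    qed
    finally show ?thesis .
  qed
  have "card B * exp (z\<^sup>2) = (\<Sum>x\<in>B. exp (z\<^sup>2))"
    by simp
  also have "\<dots> \<le> (\<Sum>x\<in>B. E l x + E (- l) x)"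
    by (intro sum_mono B)
  also have "\<dots> \<le> (\<Sum>x\<in>\<Omega>. E l x + E (- l) x)"
    using finite_space by (intro sum_mono2) (auto simp: B_def E_def add_nonneg_nonneg)
  also have "\<dots> \<le> 2 * card \<Omega>"
    using E[of l] E[of "- l"] card_pos by (simp add: avg_def sum.distrib)
  finally have "card B * exp (z\<^sup>2) * exp (- z\<^sup>2) \<le> 2 * card \<Omega> * exp (- z\<^sup>2)"
    by (rule mult_right_mono) simp
  then have "card B \<le> 2 * exp (- z\<^sup>2) * card \<Omega>"
    unfolding mult.assoc exp_add[symmetric] by (simp add: mult_ac)
  then show ?thesis
    by (simp only: whp_def B_def s_def)
qed

lemma whp_sign_martingale:
  assumes "sign_martingale \<tau> I key Z" "0 < K" "0 \<le> z" "whp e (\<lambda>x. (\<Sum>i\<in>I. (Z i x)\<^sup>2) \<le> K)"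
  shows "whp (e + 2 * exp (- z\<^sup>2)) (\<lambda>x. \<bar>\<Sum>i\<in>I. Z i x\<bar> \<le> z * sqrt (2 * K))"
  by (rule whp_mono[OF whp_conj[OF assms(4) sign_martingale_tail[OF assms(1-3)]]]) blast+

end

section \<open>Sums of products with one common frequency\<close>

context finite_space
begin

text \<open>\<open>G c w\<close> stands for a function with frequencies \<open>c\<close>, \<open>n - c - w\<close>, \<open>w\<close> in three coordinates;
  \<open>\<sigma> k\<close> and \<open>\<tau> k\<close> flip the \<open>k\<close>-th binary digit of the second and of the third coordinate.\<close>

definition adapted :: "(nat \<Rightarrow> 'x \<Rightarrow> 'x) \<Rightarrow> (nat \<Rightarrow> 'x \<Rightarrow> 'x) \<Rightarrow> nat \<Rightarrow> (nat \<Rightarrow> nat \<Rightarrow> 'x \<Rightarrow> real) \<Rightarrow> bool"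
  where "adapted \<sigma> \<tau> n G \<longleftrightarrow>
    (\<forall>k\<le>n. involution (\<sigma> k) \<and> involution (\<tau> k)) \<and>
    (\<forall>c w. \<forall>x\<in>\<Omega>. n < c + w \<longrightarrow> G c w x = 0) \<and>
    (\<forall>c w. \<forall>x\<in>\<Omega>. \<bar>G c w x\<bar> \<le> 1) \<and>
    (\<forall>c w. \<forall>x\<in>\<Omega>. c + w \<le> n \<longrightarrow>
      G c w (\<tau> w x) = - G c w x \<and> G c w (\<sigma> (n - c - w) x) = - G c w x \<and>
      (\<forall>k\<le>n. w < k \<longrightarrow> G c w (\<tau> k x) = G c w x) \<and>
      (\<forall>k\<le>n. n - c - w < k \<longrightarrow> G c w (\<sigma> k x) = G c w x))"

lemma adaptedD:
  assumes "adapted \<sigma> \<tau> n G"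
  shows "k \<le> n \<Longrightarrow> involution (\<sigma> k)" "k \<le> n \<Longrightarrow> involution (\<tau> k)"
    and "x \<in> \<Omega> \<Longrightarrow> n < c + w \<Longrightarrow> G c w x = 0"
    and "x \<in> \<Omega> \<Longrightarrow> \<bar>G c w x\<bar> \<le> 1"
    and "x \<in> \<Omega> \<Longrightarrow> c + w \<le> n \<Longrightarrow> G c w (\<tau> w x) = - G c w x"
    and "x \<in> \<Omega> \<Longrightarrow> c + w \<le> n \<Longrightarrow> G c w (\<sigma> (n - c - w) x) = - G c w x"
    and "x \<in> \<Omega> \<Longrightarrow> c + w \<le> n \<Longrightarrow> w < k \<Longrightarrow> k \<le> n \<Longrightarrow> G c w (\<tau> k x) = G c w x"
    and "x \<in> \<Omega> \<Longrightarrow> c + w \<le> n \<Longrightarrow> n - c - w < k \<Longrightarrow> k \<le> n \<Longrightarrow> G c w (\<sigma> k x) = G c w x"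
  using assms by (simp_all add: adapted_def)

lemma whp_sum_unit_martingale:
  assumes Z: "sign_martingale \<tau> I key Z" and z: "0 \<le> z"
    and I: "card I \<le> N" and N: "0 < N" and Z1: "\<And>i x. i \<in> I \<Longrightarrow> x \<in> \<Omega> \<Longrightarrow> \<bar>Z i x\<bar> \<le> r" and r: "0 < r"
  shows "whp (2 * exp (- z\<^sup>2)) (\<lambda>x. \<bar>\<Sum>i\<in>I. Z i x\<bar> \<le> r * (z * sqrt (2 * real N)))"
proof (rule whp_mono[OF sign_martingale_tail[OF Z, of "r\<^sup>2 * N"]])
  show "0 < r\<^sup>2 * N" "0 \<le> z"
    using N r z by auto
  fix x assume x: "x \<in> \<Omega>" and *: "(\<Sum>i\<in>I. (Z i x)\<^sup>2) \<le> r\<^sup>2 * N \<longrightarrow> \<bar>\<Sum>i\<in>I. Z i x\<bar> \<le> z * sqrt (2 * (r\<^sup>2 * N))"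
  have "(\<Sum>i\<in>I. (Z i x)\<^sup>2) \<le> (\<Sum>i\<in>I. r\<^sup>2)"
    using Z1[OF _ x] r by (intro sum_mono) (metis abs_le_square_iff abs_of_pos)
  also have "\<dots> = card I * r\<^sup>2"
    by simp
  also have "\<dots> \<le> N * r\<^sup>2"
    using I by (intro mult_right_mono) auto
  finally have "\<bar>\<Sum>i\<in>I. Z i x\<bar> \<le> z * sqrt (2 * (r\<^sup>2 * N))"
    using * by (simp add: mult.commute)
  also have "2 * (r\<^sup>2 * N) = r\<^sup>2 * (2 * N)"
    by simp
  finally show "\<bar>\<Sum>i\<in>I. Z i x\<bar> \<le> r * (z * sqrt (2 * real N))"
    using r by (simp add: real_sqrt_mult mult_ac)
qed simp

text \<open>Both factors share the second frequency \<open>u\<close>. As \<open>c < c'\<close>, the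
  third frequency \<open>n - c - u\<close> of the first factor exceeds that of the second, so
  flipping this digit of the third coordinate reverses the first factor only. Ordered by this key
  the terms form a sign martingale.\<close>

lemma cross_sum:
  assumes G: "adapted \<sigma> \<tau> n G" and cc: "c < c'" and I: "I \<subseteq> {u. c' + u \<le> n}" and z: "0 \<le> z"
  shows "whp (2 * exp (- z\<^sup>2))
    (\<lambda>x. \<bar>\<Sum>u\<in>I. G c (n - c - u) x * G c' (n - c' - u) x\<bar> \<le> z * sqrt (2 * real (n + 1)))"
proof -
  have sub: "{u. c' + u \<le> n} \<subseteq> {..n}"
    by auto
  then have fin: "finite I"
    using finite_subset[OF subset_trans[OF I sub]] by simp
  note A = adaptedD[OF G]
  have "sign_martingale \<tau> I (\<lambda>u. n - c - u) (\<lambda>u x. G c (n - c - u) x * G c' (n - c' - u) x)"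
    unfolding sign_martingale_def
  proof (intro conjI ballI impI fin)
    show "inj_on (\<lambda>u. n - c - u) I"
      using I cc by (auto simp: inj_on_def subset_eq)
  next
    fix u assume u: "u \<in> I"
    then have u': "c' + u \<le> n" "c + u \<le> n"
      using I cc by auto
    show "involution (\<tau> (n - c - u))"
      by (rule A) auto
    fix x assume x: "x \<in> \<Omega>"
    have "n - c' - u < n - c - u"
      using u' cc by linarith
    then have "G c' (n - c' - u) (\<tau> (n - c - u) x) = G c' (n - c' - u) x"
      using u' by (intro A x) auto
    moreover have "G c (n - c - u) (\<tau> (n - c - u) x) = - G c (n - c - u) x"
      using u' by (intro A x) auto
    ultimately show "G c (n - c - u) (\<tau> (n - c - u) x) * G c' (n - c' - u) (\<tau> (n - c - u) x) =
      - (G c (n - c - u) x * G c' (n - c' - u) x)"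
      by simp
  next
    fix u v x assume u: "u \<in> I" and v: "v \<in> I" and less: "n - c - v < n - c - u" and x: "x \<in> \<Omega>"
    then have u': "c' + u \<le> n" "c + u \<le> n" "c' + v \<le> n"
      using I cc by auto
    have "G c' (n - c' - v) (\<tau> (n - c - u) x) = G c' (n - c' - v) x"
      using u' cc less by (intro A x) auto
    moreover have "G c (n - c - v) (\<tau> (n - c - u) x) = G c (n - c - v) x"
      using u' less cc by (intro A x) auto
    ultimately show "G c (n - c - v) (\<tau> (n - c - u) x) * G c' (n - c' - v) (\<tau> (n - c - u) x) =
      G c (n - c - v) x * G c' (n - c' - v) x"
      by simp
  qed
  moreover have "card I \<le> n + 1"
    using I sub card_mono[of "{..n}" I] by auto
  moreover have "\<bar>G c (n - c - u) x * G c' (n - c' - u) x\<bar> \<le> 1" if "x \<in> \<Omega>" for u x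
    using A(4)[OF that] by (simp add: abs_mult mult_le_one)
  ultimately have "whp (2 * exp (- z\<^sup>2))
    (\<lambda>x. \<bar>\<Sum>u\<in>I. G c (n - c - u) x * G c' (n - c' - u) x\<bar> \<le> 1 * (z * sqrt (2 * real (n + 1))))"
    by (intro whp_sum_unit_martingale z) auto
  then show ?thesis by simp
qed

text \<open>Expanding the square and moving the sum over \<open>u\<close> inside leaves correlations
  of the columns \<open>g _ c\<close>. The factors \<open>h c\<close> do not depend on
  \<open>u\<close> and come out; the diagonal is counted trivially, and \<open>S\<close> controls
  the rest.\<close>

lemma sum_square_le:
  fixes g :: "'u \<Rightarrow> 'c \<Rightarrow> real" and h :: "'c \<Rightarrow> real" and S :: real
  assumes C: "finite C" and U: "finite U" and h: "\<And>c. c \<in> C \<Longrightarrow> \<bar>h c\<bar> \<le> 1"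
    and g: "\<And>u c. u \<in> U \<Longrightarrow> c \<in> C \<Longrightarrow> \<bar>g u c\<bar> \<le> 1"
    and S: "\<And>c c'. c \<in> C \<Longrightarrow> c' \<in> C \<Longrightarrow> c \<noteq> c' \<Longrightarrow> \<bar>\<Sum>u\<in>U. g u c * g u c'\<bar> \<le> S" and "0 \<le> S"
  shows "(\<Sum>u\<in>U. (\<Sum>c\<in>C. g u c * h c)\<^sup>2) \<le> card C * card U + (card C)\<^sup>2 * S"
proof -
  have "(\<Sum>u\<in>U. (\<Sum>c\<in>C. g u c * h c)\<^sup>2) =
      (\<Sum>u\<in>U. \<Sum>c\<in>C. \<Sum>c'\<in>C. h c * h c' * (g u c * g u c'))"
    by (simp add: power2_eq_square sum_product mult_ac)
  also have "\<dots> = (\<Sum>c\<in>C. \<Sum>c'\<in>C. \<Sum>u\<in>U. h c * h c' * (g u c * g u c'))"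
    by (subst sum.swap, rule sum.cong[OF refl], subst sum.swap) simp
  also have "\<dots> = (\<Sum>c\<in>C. \<Sum>c'\<in>C. h c * h c' * (\<Sum>u\<in>U. g u c * g u c'))"
    by (simp add: sum_distrib_left)
  also have "\<dots> \<le> (\<Sum>c\<in>C. \<Sum>c'\<in>C. (if c = c' then real (card U) else 0) + S)"
  proof (intro sum_mono)
    fix c c' assume c: "c \<in> C" "c' \<in> C"
    have "\<bar>\<Sum>u\<in>U. g u c * g u c'\<bar> \<le> (if c = c' then real (card U) else 0) + S"
    proof (cases "c = c'")
      case True
      have "\<bar>\<Sum>u\<in>U. g u c * g u c'\<bar> \<le> (\<Sum>u\<in>U. \<bar>g u c * g u c'\<bar>)"
        by (rule sum_abs)
      also have "\<dots> \<le> (\<Sum>u\<in>U. 1)"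
        using g c by (intro sum_mono) (simp add: abs_mult mult_le_one)
      finally show ?thesis using True \<open>0 \<le> S\<close> by simp
    next
      case False
      then show ?thesis using S[OF c False] by simp
    qed
    moreover have "h c * h c' * (\<Sum>u\<in>U. g u c * g u c') \<le> \<bar>h c * h c'\<bar> * \<bar>\<Sum>u\<in>U. g u c * g u c'\<bar>"
      by (simp only: abs_mult[symmetric] abs_ge_self)
    moreover have "\<dots> \<le> 1 * \<bar>\<Sum>u\<in>U. g u c * g u c'\<bar>"
      using h c by (intro mult_right_mono) (simp_all add: abs_mult mult_le_one)
    ultimately show "h c * h c' * (\<Sum>u\<in>U. g u c * g u c') \<le> (if c = c' then real (card U) else 0) + S"
      by linarith
  qed
  also have "\<dots> = card C * card U + (card C)\<^sup>2 * S"
    using C by (simp add: sum.distrib power2_eq_square algebra_simps)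
  finally show ?thesis .
qed

text \<open>With \<open>c\<close> in common, \<open>w < v\<close> says that the second frequency
  \<open>u = n - c - w\<close> of \<open>G\<close> exceeds that of \<open>H\<close>, so flipping
  digit \<open>u\<close> of the second coordinate reverses \<open>G\<close> alone. Grouped by
  \<open>u\<close>, the sum is a sign martingale. Its quadratic variation is a sum of squares of
  sums over \<open>c\<close>, whose off-diagonal part is given by \<open>cross_sum\<close>. About
  \<open>n ^ 2\<close> terms thus have a sum of order \<open>n\<close> to the power 5/4, up to
  powers of \<open>z\<close>.\<close>

lemma inner_sum:
  assumes G: "adapted \<sigma> \<tau> n G" and H: "adapted \<sigma> \<tau> n H" and z: "0 \<le> z"
    and S: "S = z * sqrt (2 * real (n + 1))" "1 \<le> S"
  shows "whp (real ((n + 1)\<^sup>2 + 1) * (2 * exp (- z\<^sup>2)))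
    (\<lambda>x. \<bar>\<Sum>c\<le>n. \<Sum>w<v. G c w x * H c v x\<bar> \<le> z * sqrt (4 * (real (n + 1))\<^sup>2 * S))"
proof -
  note A = adaptedD[OF G] and B = adaptedD[OF H]
  \<comment> \<open>The range of \<open>w < v\<close> after the substitution
    \<open>w = n - c - u\<close>; \<open>c + u \<le> n\<close> makes the subtraction honest, and
    \<open>c + v \<le> n\<close> leaves out the terms where \<open>H\<close> vanishes.\<close>
  define P where "P u c \<longleftrightarrow> c + u \<le> n \<and> n - c - u < v \<and> c + v \<le> n" for u c
  define g where "g u c x = of_bool (P u c) * G c (n - c - u) x" for u c x
  define Z where "Z u x = (\<Sum>c\<le>n. g u c x * H c v x)" for u x
  have eq: "(\<Sum>c\<le>n. \<Sum>w<v. G c w x * H c v x) = (\<Sum>u\<le>n. Z u x)" if x: "x \<in> \<Omega>" for x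
  proof -
    have "(\<Sum>w<v. G c w x * H c v x) = (\<Sum>u\<le>n. g u c x * H c v x)" if c: "c \<le> n" for c
    proof (cases "c + v \<le> n")
      case True
      have "(\<Sum>w<v. G c w x * H c v x) = (\<Sum>w\<in>{w. c + w \<le> n \<and> w < v}. G c w x * H c v x)"
        using A(3)[OF x] by (intro sum.mono_neutral_right) (auto intro: leI)
      also have "\<dots> = (\<Sum>u\<in>{u. P u c}. G c (n - c - u) x * H c v x)"
        by (rule sum.reindex_bij_witness[where i = "\<lambda>u. n - c - u" and j = "\<lambda>u. n - c - u"])
          (use True in \<open>auto simp: P_def\<close>)
      also have "\<dots> = (\<Sum>u\<le>n. g u c x * H c v x)"
        by (intro sum.mono_neutral_cong_left) (auto simp: P_def g_def)
      finally show ?thesis .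
    next
      case False
      then show ?thesis using B(3)[OF x] by (simp add: not_le)
    qed
    then show ?thesis
      unfolding Z_def by (subst sum.swap[of "\<lambda>u c. g u c x * H c v x"]) simp
  qed
  have mart: "sign_martingale \<sigma> {..n} (\<lambda>u. u) Z"
    unfolding sign_martingale_def
  proof (intro conjI ballI impI)
    fix u x assume u: "u \<in> {..n}" and x: "x \<in> \<Omega>"
    show "Z u (\<sigma> u x) = - Z u x"
      unfolding Z_def sum_negf[symmetric]
    proof (rule sum.cong[OF refl])
      fix c
      show "g u c (\<sigma> u x) * H c v (\<sigma> u x) = - (g u c x * H c v x)"
      proof (cases "P u c")
        case True
        then have "G c (n - c - u) (\<sigma> (n - c - (n - c - u)) x) = - G c (n - c - u) x"
          by (intro A x) (auto simp: P_def)
        moreover have "H c v (\<sigma> u x) = H c v x"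
          using True u by (intro B x) (auto simp: P_def)
        ultimately show ?thesis
          using True by (simp add: g_def P_def)
      qed (simp add: g_def)
    qed
  next
    fix u j x assume u: "u \<in> {..n}" and j: "j \<in> {..n}" "j < u" and x: "x \<in> \<Omega>"
    show "Z j (\<sigma> u x) = Z j x"
      unfolding Z_def
    proof (rule sum.cong[OF refl])
      fix c
      show "g j c (\<sigma> u x) * H c v (\<sigma> u x) = g j c x * H c v x"
      proof (cases "P j c")
        case True
        then have "G c (n - c - j) (\<sigma> u x) = G c (n - c - j) x"
          using j u by (intro A x) (auto simp: P_def)
        moreover have "H c v (\<sigma> u x) = H c v x"
          using True u j by (intro B x) (auto simp: P_def)
        ultimately show ?thesis
          using True by (simp add: g_def P_def)
      qed (simp add: g_def)
    qed
  qed (auto simp: A inj_on_def)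
  have S0: "0 \<le> S" using S(2) by simp
  have K: "0 < 2 * (real (n + 1))\<^sup>2 * S"
    using S(2) by (intro mult_pos_pos) auto
  have cross: "whp (2 * exp (- z\<^sup>2)) (\<lambda>x. c \<noteq> c' \<longrightarrow> \<bar>\<Sum>u\<le>n. g u c x * g u c' x\<bar> \<le> S)" for c c'
  proof -
    have *: "whp (2 * exp (- z\<^sup>2)) (\<lambda>x. \<bar>\<Sum>u\<le>n. g u c x * g u c' x\<bar> \<le> S)" if cc: "c < c'" for c c'
    proof -
      have "whp (2 * exp (- z\<^sup>2)) (\<lambda>x.
        \<bar>\<Sum>u\<in>{u. P u c \<and> P u c'}. G c (n - c - u) x * G c' (n - c' - u) x\<bar> \<le> z * sqrt (2 * real (n + 1)))"
        by (rule cross_sum[OF G cc _ z]) (auto simp: P_def)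
      moreover have "(\<Sum>u\<in>{u. P u c \<and> P u c'}. G c (n - c - u) x * G c' (n - c' - u) x) =
          (\<Sum>u\<le>n. g u c x * g u c' x)" for x
        by (intro sum.mono_neutral_cong_left) (auto simp: P_def g_def)
      ultimately show ?thesis by (simp add: S)
    qed
    show ?thesis
    proof (cases c c' rule: linorder_cases)
      case less
      show ?thesis by (rule whp_mono[OF *[OF less]]) auto
    next
      case equal
      then show ?thesis by (simp add: whp_def)
    next
      case greater
      have "(\<Sum>u\<le>n. g u c x * g u c' x) = (\<Sum>u\<le>n. g u c' x * g u c x)" for x
        by (intro sum.cong refl mult.commute)
      then show ?thesis by (intro whp_mono[OF *[OF greater]]) simp_all
    qed
  qed
  have "whp (card ({..n} \<times> {..n}) * (2 * exp (- z\<^sup>2)))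
      (\<lambda>x. \<forall>p\<in>{..n}\<times>{..n}. fst p \<noteq> snd p \<longrightarrow> \<bar>\<Sum>u\<le>n. g u (fst p) x * g u (snd p) x\<bar> \<le> S)"
    by (rule whp_ball) (auto intro: cross)
  then have "whp (card ({..n} \<times> {..n}) * (2 * exp (- z\<^sup>2))) (\<lambda>x. (\<Sum>u\<le>n. (Z u x)\<^sup>2) \<le> 2 * (real (n + 1))\<^sup>2 * S)"
  proof (rule whp_mono)
    fix x assume x: "x \<in> \<Omega>"
      and *: "\<forall>p\<in>{..n}\<times>{..n}. fst p \<noteq> snd p \<longrightarrow> \<bar>\<Sum>u\<le>n. g u (fst p) x * g u (snd p) x\<bar> \<le> S"
    have "(\<Sum>u\<le>n. (Z u x)\<^sup>2) \<le> card {..n} * card {..n} + (card {..n})\<^sup>2 * S"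
      unfolding Z_def
    proof (rule sum_square_le)
      fix c c' assume "c \<in> {..n}" "c' \<in> {..n}" "c \<noteq> c'"
      then show "\<bar>\<Sum>u\<le>n. g u c x * g u c' x\<bar> \<le> S"
        using *[rule_format, of "(c, c')"] by simp
    qed (use A(4)[OF x] B(4)[OF x] S0 in \<open>simp_all add: g_def\<close>)
    also have "\<dots> \<le> real ((n + 1)\<^sup>2) * S + real ((n + 1)\<^sup>2) * S"
      using mult_left_mono[OF S(2), of "real ((n + 1)\<^sup>2)"] by (simp add: power2_eq_square mult.commute)
    finally show "(\<Sum>u\<le>n. (Z u x)\<^sup>2) \<le> 2 * (real (n + 1))\<^sup>2 * S"
      by (simp add: mult_ac)
  qed simp
  then have "whp (card ({..n} \<times> {..n}) * (2 * exp (- z\<^sup>2)) + 2 * exp (- z\<^sup>2))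
      (\<lambda>x. \<bar>\<Sum>u\<le>n. Z u x\<bar> \<le> z * sqrt (2 * (2 * (real (n + 1))\<^sup>2 * S)))"
    by (rule whp_sign_martingale[OF mart K z])
  moreover have "2 * (2 * (real (n + 1))\<^sup>2 * S) = 4 * (real (n + 1))\<^sup>2 * S"
    by simp
  moreover have "card ({..n} \<times> {..n}) * (2 * exp (- z\<^sup>2)) + 2 * exp (- z\<^sup>2) = real ((n + 1)\<^sup>2 + 1) * (2 * exp (- z\<^sup>2))"
    by (simp add: power2_eq_square distrib_right)
  ultimately have "whp (real ((n + 1)\<^sup>2 + 1) * (2 * exp (- z\<^sup>2)))
      (\<lambda>x. \<bar>\<Sum>u\<le>n. Z u x\<bar> \<le> z * sqrt (4 * (real (n + 1))\<^sup>2 * S))"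
    by (simp only:)
  then show ?thesis
  proof (rule whp_mono)
    fix x assume "x \<in> \<Omega>" "\<bar>\<Sum>u\<le>n. Z u x\<bar> \<le> z * sqrt (4 * (real (n + 1))\<^sup>2 * S)"
    then show "\<bar>\<Sum>c\<le>n. \<Sum>w<v. G c w x * H c v x\<bar> \<le> z * sqrt (4 * (real (n + 1))\<^sup>2 * S)"
      by (simp only: eq)
  qed (rule order_refl)
qed

text \<open>Now the larger third frequency \<open>v\<close> is the martingale parameter: flipping
  digit \<open>v\<close> of the third coordinate reverses \<open>H c v\<close> and fixes every
  \<open>G c w\<close> with \<open>w < v\<close>. The increments are bounded by
  \<open>inner_sum\<close>, so the summation over \<open>v\<close> costs only a square root of
  \<open>n\<close>, up to \<open>z\<close>.\<close>

lemma beck_sum: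
  assumes G: "adapted \<sigma> \<tau> n G" and H: "adapted \<sigma> \<tau> n H" and z: "0 \<le> z"
    and S: "S = z * sqrt (2 * real (n + 1))" "1 \<le> S"
    and T: "T = z * sqrt (4 * (real (n + 1))\<^sup>2 * S)" "0 < T"
  shows "whp (real ((n + 2) ^ 3) * (2 * exp (- z\<^sup>2)))
    (\<lambda>x. \<bar>\<Sum>v\<le>n. \<Sum>c\<le>n. \<Sum>w<v. G c w x * H c v x\<bar> \<le> S * T)"
proof -
  note A = adaptedD[OF G] and B = adaptedD[OF H]
  define D where "D v x = (\<Sum>c\<le>n. \<Sum>w<v. G c w x * H c v x)" for v x
  have mart: "sign_martingale \<tau> {..n} (\<lambda>v. v) D"
    unfolding sign_martingale_def
  proof (intro conjI ballI impI)
    have *: "G c w (\<tau> k x) * H c j (\<tau> k x) = (if j = k then -1 else 1) * (G c w x * H c j x)"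
      if "x \<in> \<Omega>" "k \<le> n" "w < j" "j \<le> k" "c \<le> n" for x k w j c
    proof (cases "c + j \<le> n")
      case True
      then show ?thesis
        using that A(7)[of x c w k] B(5)[of x c j] B(7)[of x c j k] by (cases "j = k") simp_all
    next
      case False
      have "\<tau> k x \<in> \<Omega>"
        using A(2) that by (auto simp: involution_def)
      then show ?thesis
        using False that B(3) by (simp add: not_le)
    qed
    fix v x assume "v \<in> {..n}" "x \<in> \<Omega>"
    then show "D v (\<tau> v x) = - D v x"
      unfolding D_def sum_negf[symmetric] by (intro sum.cong refl) (subst *, auto)
    fix j assume "j \<in> {..n}" "j < v"
    then show "D j (\<tau> v x) = D j x"
      using \<open>v \<in> {..n}\<close> \<open>x \<in> \<Omega>\<close>
      unfolding D_def by (intro sum.cong refl) (subst *, auto)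
  qed (auto simp: A inj_on_def)
  have "whp (card {..n} * (real ((n + 1)\<^sup>2 + 1) * (2 * exp (- z\<^sup>2)))) (\<lambda>x. \<forall>v\<in>{..n}. \<bar>D v x\<bar> \<le> T)"
    unfolding D_def T by (intro whp_ball inner_sum[OF G H z S]) auto
  then have "whp (card {..n} * (real ((n + 1)\<^sup>2 + 1) * (2 * exp (- z\<^sup>2)))) (\<lambda>x. (\<Sum>v\<le>n. (D v x)\<^sup>2) \<le> real (n + 1) * T\<^sup>2)"
  proof (rule whp_mono)
    fix x assume "\<forall>v\<in>{..n}. \<bar>D v x\<bar> \<le> T"
    then have "(\<Sum>v\<le>n. (D v x)\<^sup>2) \<le> (\<Sum>v\<le>n. T\<^sup>2)"
      using T(2) by (intro sum_mono) (metis abs_le_square_iff abs_of_pos)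
    then show "(\<Sum>v\<le>n. (D v x)\<^sup>2) \<le> real (n + 1) * T\<^sup>2"
      by simp
  qed simp
  moreover have "0 < real (n + 1) * T\<^sup>2"
    using T(2) by (intro mult_pos_pos) auto
  ultimately have "whp (card {..n} * (real ((n + 1)\<^sup>2 + 1) * (2 * exp (- z\<^sup>2))) + 2 * exp (- z\<^sup>2))
      (\<lambda>x. \<bar>\<Sum>v\<le>n. D v x\<bar> \<le> z * sqrt (2 * (real (n + 1) * T\<^sup>2)))"
    by (intro whp_sign_martingale[OF mart _ z])
  then show ?thesis
  proof (rule whp_mono)
    fix x assume "\<bar>\<Sum>v\<le>n. D v x\<bar> \<le> z * sqrt (2 * (real (n + 1) * T\<^sup>2))"
    also have "\<dots> = S * T"
    proof -
      have "sqrt (2 * (real (n + 1) * T\<^sup>2)) = sqrt (2 * real (n + 1)) * sqrt (T\<^sup>2)"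
        by (simp only: real_sqrt_mult mult.assoc)
      then show ?thesis using T(2) by (simp only: S(1) real_sqrt_abs abs_of_pos mult.assoc)
    qed
    finally show "\<bar>\<Sum>v\<le>n. \<Sum>c\<le>n. \<Sum>w<v. G c w x * H c v x\<bar> \<le> S * T"
      by (simp add: D_def)
  next
    have "real (card {..n}) * real ((n + 1)\<^sup>2 + 1) + 1 \<le> real ((n + 2) ^ 3)"
      by (simp add: power2_eq_square power3_eq_cube algebra_simps)
    then have "(real (card {..n}) * real ((n + 1)\<^sup>2 + 1) + 1) * (2 * exp (- z\<^sup>2)) \<le> real ((n + 2) ^ 3) * (2 * exp (- z\<^sup>2))"
      by (intro mult_right_mono) auto
    then show "real (card {..n}) * (real ((n + 1)\<^sup>2 + 1) * (2 * exp (- z\<^sup>2))) + 2 * exp (- z\<^sup>2)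
        \<le> real ((n + 2) ^ 3) * (2 * exp (- z\<^sup>2))"
      by (simp add: algebra_simps)
  qed
qed

end

section \<open>Sums over coincident frequencies\<close>

lemma sum_PiE_Un:
  fixes f g :: "('i \<Rightarrow> 'a) \<Rightarrow> 'b :: comm_semiring_0"
  assumes disj: "A \<inter> B = {}"
    and f: "\<And>\<alpha> \<beta>. (\<And>x. x \<in> A \<Longrightarrow> \<alpha> x = \<beta> x) \<Longrightarrow> f \<alpha> = f \<beta>"
    and g: "\<And>\<alpha> \<beta>. (\<And>x. x \<in> B \<Longrightarrow> \<alpha> x = \<beta> x) \<Longrightarrow> g \<alpha> = g \<beta>"
  shows "(\<Sum>\<alpha>\<in>PiE (A \<union> B) S. f \<alpha> * g \<alpha>) = (\<Sum>\<alpha>\<in>PiE A S. f \<alpha>) * (\<Sum>\<alpha>\<in>PiE B S. g \<alpha>)"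
proof -
  define j :: "('i \<Rightarrow> 'a) \<times> ('i \<Rightarrow> 'a) \<Rightarrow> 'i \<Rightarrow> 'a"
    where "j p = (\<lambda>x. if x \<in> A then fst p x else if x \<in> B then snd p x else undefined)" for p
  have *: "x \<in> A \<Longrightarrow> x \<notin> B" for x
    using disj by auto
  have "(\<Sum>\<alpha>\<in>PiE (A \<union> B) S. f \<alpha> * g \<alpha>) = (\<Sum>p\<in>PiE A S \<times> PiE B S. f (fst p) * g (snd p))"
  proof (rule sum.reindex_bij_witness[where i = j and j = "\<lambda>\<alpha>. (restrict \<alpha> A, restrict \<alpha> B)"])
    fix \<alpha> assume \<alpha>: "\<alpha> \<in> PiE (A \<union> B) S"
    show "j (restrict \<alpha> A, restrict \<alpha> B) = \<alpha>"
      using \<alpha> by (auto simp: j_def fun_eq_iff PiE_def extensional_def)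
    show "(restrict \<alpha> A, restrict \<alpha> B) \<in> PiE A S \<times> PiE B S"
      using \<alpha> by auto
    have "f (restrict \<alpha> A) = f \<alpha>" "g (restrict \<alpha> B) = g \<alpha>"
      by (rule f, simp) (rule g, simp)
    then show "f (fst (restrict \<alpha> A, restrict \<alpha> B)) * g (snd (restrict \<alpha> A, restrict \<alpha> B)) = f \<alpha> * g \<alpha>"
      by simp
  next
    fix p assume p: "p \<in> PiE A S \<times> PiE B S"
    then have e: "x \<notin> A \<Longrightarrow> fst p x = undefined" "x \<notin> B \<Longrightarrow> snd p x = undefined" for x
      by (auto simp: PiE_def extensional_def)
    show "(restrict (j p) A, restrict (j p) B) = p"
      using e * by (cases p) (auto simp: j_def fun_eq_iff)
    show "j p \<in> PiE (A \<union> B) S"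
      using p by (auto simp: j_def PiE_def extensional_def)
  qed
  then show ?thesis
    by (simp add: sum_product sum.cartesian_product case_prod_beta)
qed

lemma sum_PiE_singleton: "(\<Sum>\<alpha>\<in>PiE {l} (\<lambda>_. R). f (\<alpha> l)) = (\<Sum>a\<in>R. f a)"
  by (rule sum.reindex_bij_witness[where i = "\<lambda>a. (\<lambda>_. undefined)(l := a)" and j = "\<lambda>\<alpha>. \<alpha> l"])
    (auto simp: fun_eq_iff PiE_def extensional_def)

lemma sum_PiE_doubleton:
  assumes "l \<noteq> m"
  shows "(\<Sum>\<alpha>\<in>PiE {l, m} (\<lambda>_. R). f (\<alpha> l) (\<alpha> m)) = (\<Sum>a\<in>R. \<Sum>b\<in>R. f a b)"
proof -
  have "(\<Sum>\<alpha>\<in>PiE {l, m} (\<lambda>_. R). f (\<alpha> l) (\<alpha> m)) = (\<Sum>p\<in>R \<times> R. f (fst p) (snd p))"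
    by (rule sum.reindex_bij_witness[where i = "\<lambda>p. (\<lambda>_. undefined)(l := fst p, m := snd p)"
          and j = "\<lambda>\<alpha>. (\<alpha> l, \<alpha> m)"])
      (use assms in \<open>auto simp: fun_eq_iff PiE_def extensional_def\<close>)
  then show ?thesis
    by (simp add: sum.cartesian_product case_prod_beta)
qed

text \<open>The sum of \<open>\<Prod>t\<in>V. F t (a t) (b t)\<close> over all \<open>a\<close> that are constant on the fibres of \<open>c\<close>
  and all \<open>b\<close> that are constant on the fibres of \<open>d\<close>.\<close>

definition coincidence_sum ::
  "nat \<Rightarrow> (nat \<Rightarrow> nat \<Rightarrow> nat \<Rightarrow> real) \<Rightarrow> nat set \<Rightarrow> (nat \<Rightarrow> nat) \<Rightarrow> (nat \<Rightarrow> nat) \<Rightarrow> real"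
  where "coincidence_sum n F V c d =
    (\<Sum>\<alpha>\<in>PiE (c ` V) (\<lambda>_. {..n}). \<Sum>\<beta>\<in>PiE (d ` V) (\<lambda>_. {..n}). \<Prod>t\<in>V. F t (\<alpha> (c t)) (\<beta> (d t)))"

lemma coincidence_sum_swap:
  "coincidence_sum n F V c d = coincidence_sum n (\<lambda>t a b. F t b a) V d c"
  unfolding coincidence_sum_def by (rule sum.swap)

lemma coincidence_sum_Un:
  assumes fin: "finite V" "finite W" and disj: "V \<inter> W = {}"
    and c: "c ` V \<inter> c ` W = {}" and d: "d ` V \<inter> d ` W = {}"
  shows "coincidence_sum n F (V \<union> W) c d = coincidence_sum n F V c d * coincidence_sum n F W c d"
proof -
  define f where "f U \<alpha> \<beta> = (\<Prod>t\<in>U. F t (\<alpha> (c t)) (\<beta> (d t)))" for U \<alpha> \<beta>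
  have "coincidence_sum n F (V \<union> W) c d =
    (\<Sum>\<alpha>\<in>PiE (c ` V \<union> c ` W) (\<lambda>_. {..n}). \<Sum>\<beta>\<in>PiE (d ` V \<union> d ` W) (\<lambda>_. {..n}). f V \<alpha> \<beta> * f W \<alpha> \<beta>)"
    unfolding coincidence_sum_def f_def image_Un by (simp add: prod.union_disjoint fin disj)
  also have "\<dots> = (\<Sum>\<alpha>\<in>PiE (c ` V \<union> c ` W) (\<lambda>_. {..n}).
      (\<Sum>\<beta>\<in>PiE (d ` V) (\<lambda>_. {..n}). f V \<alpha> \<beta>) * (\<Sum>\<beta>\<in>PiE (d ` W) (\<lambda>_. {..n}). f W \<alpha> \<beta>))"
    by (intro sum.cong refl sum_PiE_Un d) (auto simp: f_def)
  also have "\<dots> = (\<Sum>\<alpha>\<in>PiE (c ` V) (\<lambda>_. {..n}). \<Sum>\<beta>\<in>PiE (d ` V) (\<lambda>_. {..n}). f V \<alpha> \<beta>) *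
      (\<Sum>\<alpha>\<in>PiE (c ` W) (\<lambda>_. {..n}). \<Sum>\<beta>\<in>PiE (d ` W) (\<lambda>_. {..n}). f W \<alpha> \<beta>)"
    by (intro sum_PiE_Un c) (auto simp: f_def)
  finally show ?thesis
    by (simp add: coincidence_sum_def f_def)
qed

text \<open>For fixed \<open>\<beta>\<close> the sum over \<open>\<alpha>\<close> factorises into
  one line sum for each fibre of \<open>c\<close>. Cancellation is used only there; the choices of
  \<open>\<beta>\<close> are counted trivially.\<close>

lemma coincidence_sum_le:
  assumes V: "finite V"
    and S: "\<And>U b. U \<subseteq> V \<Longrightarrow> U \<noteq> {} \<Longrightarrow> (\<And>t. t \<in> U \<Longrightarrow> b t \<le> n) \<Longrightarrow> \<bar>\<Sum>a\<le>n. \<Prod>t\<in>U. F t a (b t)\<bar> \<le> S"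
  shows "\<bar>coincidence_sum n F V c d\<bar> \<le> real (n + 1) ^ card (d ` V) * S ^ card (c ` V)"
proof -
  have *: "\<bar>\<Sum>\<alpha>\<in>PiE (c ` V) (\<lambda>_. {..n}). \<Prod>t\<in>V. F t (\<alpha> (c t)) (\<beta> (d t))\<bar> \<le> S ^ card (c ` V)"
    if \<beta>: "\<beta> \<in> PiE (d ` V) (\<lambda>_. {..n})" for \<beta>
  proof -
    have "(\<Sum>\<alpha>\<in>PiE (c ` V) (\<lambda>_. {..n}). \<Prod>t\<in>V. F t (\<alpha> (c t)) (\<beta> (d t))) =
        (\<Sum>\<alpha>\<in>PiE (c ` V) (\<lambda>_. {..n}). \<Prod>l\<in>c ` V. \<Prod>t\<in>{t \<in> V. c t = l}. F t (\<alpha> l) (\<beta> (d t)))"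
      by (intro sum.cong refl trans[OF prod.image_gen[OF V, of _ c]] prod.cong) auto
    also have "\<dots> = (\<Prod>l\<in>c ` V. \<Sum>a\<le>n. \<Prod>t\<in>{t \<in> V. c t = l}. F t a (\<beta> (d t)))"
      by (rule prod_sum_PiE[symmetric]) (use V in auto)
    finally have "\<bar>\<Sum>\<alpha>\<in>PiE (c ` V) (\<lambda>_. {..n}). \<Prod>t\<in>V. F t (\<alpha> (c t)) (\<beta> (d t))\<bar> =
        (\<Prod>l\<in>c ` V. \<bar>\<Sum>a\<le>n. \<Prod>t\<in>{t \<in> V. c t = l}. F t a (\<beta> (d t))\<bar>)"
      by (simp add: abs_prod)
    also have "\<dots> \<le> (\<Prod>l\<in>c ` V. S)"
    proof (rule prod_mono)
      fix l assume l: "l \<in> c ` V"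
      have "\<bar>\<Sum>a\<le>n. \<Prod>t\<in>{t \<in> V. c t = l}. F t a (\<beta> (d t))\<bar> \<le> S"
        by (rule S[where b = "\<lambda>t. \<beta> (d t)"]) (use l \<beta> in \<open>auto simp: PiE_iff\<close>)
      then show "0 \<le> \<bar>\<Sum>a\<le>n. \<Prod>t\<in>{t \<in> V. c t = l}. F t a (\<beta> (d t))\<bar> \<and>
          \<bar>\<Sum>a\<le>n. \<Prod>t\<in>{t \<in> V. c t = l}. F t a (\<beta> (d t))\<bar> \<le> S"
        by simp
    qed
    finally show ?thesis by simp
  qed
  have "coincidence_sum n F V c d =
    (\<Sum>\<beta>\<in>PiE (d ` V) (\<lambda>_. {..n}). \<Sum>\<alpha>\<in>PiE (c ` V) (\<lambda>_. {..n}). \<Prod>t\<in>V. F t (\<alpha> (c t)) (\<beta> (d t)))"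
    unfolding coincidence_sum_def by (rule sum.swap)
  also have "\<bar>\<dots>\<bar> \<le> (\<Sum>\<beta>\<in>PiE (d ` V) (\<lambda>_. {..n}). S ^ card (c ` V))"
    by (intro order_trans[OF sum_abs] sum_mono *)
  also have "\<dots> = real (n + 1) ^ card (d ` V) * S ^ card (c ` V)"
    using V by (simp add: card_PiE)
  finally show ?thesis .
qed

section \<open>Connected coincidence patterns\<close>

definition separated :: "('t \<Rightarrow> 'c) \<Rightarrow> ('t \<Rightarrow> 'd) \<Rightarrow> 't set \<Rightarrow> 't set \<Rightarrow> bool"
  where "separated c d V W \<longleftrightarrow> c ` V \<inter> c ` W = {} \<and> d ` V \<inter> d ` W = {}"

text \<open>Each \<open>t\<close> is an edge between the vertices \<open>c t\<close> and
  \<open>d t\<close> of a bipartite graph. The hypothesis \<open>conn\<close> says that the graph is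
  connected, and a connected graph has at most one vertex more than edges. The proof grows an edge
  set in which every new edge shares a vertex with the previous ones and so adds at most one new
  vertex.\<close>

lemma card_fibres_le:
  assumes V: "finite V" "V \<noteq> {}"
    and conn: "\<And>W. W \<subset> V \<Longrightarrow> W \<noteq> {} \<Longrightarrow> \<not> separated c d W (V - W)"
  shows "card (c ` V) + card (d ` V) \<le> card V + 1"
proof -
  have "\<exists>W\<subseteq>V. card W = Suc k \<and> card (c ` W) + card (d ` W) \<le> Suc k + 1" if "Suc k \<le> card V" for k
    using that
  proof (induction k)
    case 0
    obtain v where "v \<in> V" using V by auto
    then show ?case by (intro exI[of _ "{v}"]) auto
  next
    case (Suc k)
    then obtain W where W: "W \<subseteq> V" "card W = Suc k" "card (c ` W) + card (d ` W) \<le> Suc k + 1"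
      by auto
    then have fin: "finite W" using V finite_subset by metis
    have "W \<subset> V" "W \<noteq> {}"
      using W Suc.prems by auto
    then have "\<not> separated c d W (V - W)"
      by (rule conn)
    have "\<exists>t. t \<in> V - W \<and> (c t \<in> c ` W \<or> d t \<in> d ` W)"
    proof (rule ccontr)
      assume no: "\<nexists>t. t \<in> V - W \<and> (c t \<in> c ` W \<or> d t \<in> d ` W)"
      have "c ` W \<inter> c ` (V - W) = {}"
        using no by (force simp: disjoint_iff image_iff)
      moreover have "d ` W \<inter> d ` (V - W) = {}"
        using no by (force simp: disjoint_iff image_iff)
      moreover note \<open>\<not> separated c d W (V - W)\<close>
      ultimately show False
        by (simp add: separated_def)
    qed
    then obtain t where t: "t \<in> V - W" "c t \<in> c ` W \<or> d t \<in> d ` W"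
      by blast
    show ?case
    proof (intro exI[of _ "insert t W"] conjI)
      show "insert t W \<subseteq> V" "card (insert t W) = Suc (Suc k)"
        using t W fin by auto
      show "card (c ` insert t W) + card (d ` insert t W) \<le> Suc (Suc k) + 1"
        using t(2)
      proof
        assume "c t \<in> c ` W"
        then have "card (c ` insert t W) = card (c ` W)"
          by (simp add: insert_absorb)
        moreover have "card (d ` insert t W) \<le> Suc (card (d ` W))"
          using fin by (simp add: card_insert_if)
        ultimately show ?thesis using W by simp
      next
        assume "d t \<in> d ` W"
        then have "card (d ` insert t W) = card (d ` W)"
          by (simp add: insert_absorb)
        moreover have "card (c ` insert t W) \<le> Suc (card (c ` W))"
          using fin by (simp add: card_insert_if)
        ultimately show ?thesis using W by simp
      qed
    qed
  qed
  from this[of "card V - 1"] obtain W where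
    W: "W \<subseteq> V" "card W = card V" "card (c ` W) + card (d ` W) \<le> card V + 1"
    using V by (force simp: card_gt_0_iff Suc_le_eq)
  then have "W = V"
    by (intro card_subset_eq[OF V(1)])
  then show ?thesis using W by simp
qed

text \<open>The deterministic information about a single point that the power count consumes. The
  exponent 8 is square-root cancellation on a line, half of 16. The target is 15 per factor: a pair
  of factors may cost 30, and a path of three costs 16 + 8 + 21 = 45, which leaves 21 for
  \<open>T\<close>.\<close>

locale coincidence_bounds =
  fixes F :: "nat \<Rightarrow> nat \<Rightarrow> nat \<Rightarrow> real" and q n :: nat and \<kappa> z T :: real
  assumes \<kappa>: "1 \<le> \<kappa>" and z: "1 \<le> z" and n: "real (n + 1) = \<kappa> ^ 16" and T: "T \<le> \<kappa> ^ 21 * z"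
    and line1: "\<And>U b. U \<subseteq> {..<q} \<Longrightarrow> U \<noteq> {} \<Longrightarrow> (\<And>t. t \<in> U \<Longrightarrow> b t \<le> n) \<Longrightarrow>
      \<bar>\<Sum>a\<le>n. \<Prod>t\<in>U. F t a (b t)\<bar> \<le> \<kappa> ^ 8 * z"
    and line2: "\<And>U a. U \<subseteq> {..<q} \<Longrightarrow> U \<noteq> {} \<Longrightarrow> (\<And>t. t \<in> U \<Longrightarrow> a t \<le> n) \<Longrightarrow>
      \<bar>\<Sum>b\<le>n. \<Prod>t\<in>U. F t (a t) b\<bar> \<le> \<kappa> ^ 8 * z"
    and plane: "\<And>s t a. s < q \<Longrightarrow> t < q \<Longrightarrow> s \<noteq> t \<Longrightarrow> a \<le> n \<Longrightarrow>
      \<bar>\<Sum>b\<le>n. \<Sum>a'\<le>n. F t a' b * F s a b\<bar> \<le> T"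
    and beck1: "\<And>s t. s < q \<Longrightarrow> t < q \<Longrightarrow> s \<noteq> t \<Longrightarrow>
      \<bar>\<Sum>a\<le>n. \<Sum>b\<le>n. \<Sum>b'\<le>n. F s a b * F t a b'\<bar> \<le> \<kappa> ^ 30 * z\<^sup>2"
    and beck2: "\<And>s t. s < q \<Longrightarrow> t < q \<Longrightarrow> s \<noteq> t \<Longrightarrow>
      \<bar>\<Sum>b\<le>n. \<Sum>a\<le>n. \<Sum>a'\<le>n. F s a b * F t a' b\<bar> \<le> \<kappa> ^ 30 * z\<^sup>2"
begin

lemma coincidence_sum_pair:
  assumes "s < q" "t < q" "s \<noteq> t" "c s = c t" "d s \<noteq> d t"
  shows "\<bar>coincidence_sum n F {s, t} c d\<bar> \<le> \<kappa> ^ 30 * z\<^sup>2"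
    and "\<bar>coincidence_sum n F {s, t} d c\<bar> \<le> \<kappa> ^ 30 * z\<^sup>2"
proof -
  have "coincidence_sum n F {s, t} c d =
      (\<Sum>\<alpha>\<in>PiE {c t} (\<lambda>_. {..n}). \<Sum>\<beta>\<in>PiE {d s, d t} (\<lambda>_. {..n}). F s (\<alpha> (c t)) (\<beta> (d s)) * F t (\<alpha> (c t)) (\<beta> (d t)))"
    using assms by (simp add: coincidence_sum_def)
  also have "\<dots> = (\<Sum>\<alpha>\<in>PiE {c t} (\<lambda>_. {..n}). \<Sum>b\<le>n. \<Sum>b'\<le>n. F s (\<alpha> (c t)) b * F t (\<alpha> (c t)) b')"
    by (subst sum_PiE_doubleton[OF assms(5)]) simp
  also have "\<dots> = (\<Sum>a\<le>n. \<Sum>b\<le>n. \<Sum>b'\<le>n. F s a b * F t a b')"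
    by (rule sum_PiE_singleton)
  finally show "\<bar>coincidence_sum n F {s, t} c d\<bar> \<le> \<kappa> ^ 30 * z\<^sup>2"
    using beck1[OF assms(1-3)] by simp
  have "coincidence_sum n F {s, t} d c = coincidence_sum n (\<lambda>t a b. F t b a) {s, t} c d"
    by (rule coincidence_sum_swap)
  also have "\<dots> =
      (\<Sum>\<alpha>\<in>PiE {c t} (\<lambda>_. {..n}). \<Sum>\<beta>\<in>PiE {d s, d t} (\<lambda>_. {..n}). F s (\<beta> (d s)) (\<alpha> (c t)) * F t (\<beta> (d t)) (\<alpha> (c t)))"
    using assms by (simp add: coincidence_sum_def)
  also have "\<dots> = (\<Sum>\<alpha>\<in>PiE {c t} (\<lambda>_. {..n}). \<Sum>b\<le>n. \<Sum>b'\<le>n. F s b (\<alpha> (c t)) * F t b' (\<alpha> (c t)))"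
    by (subst sum_PiE_doubleton[OF assms(5)]) simp
  also have "\<dots> = (\<Sum>a\<le>n. \<Sum>b\<le>n. \<Sum>b'\<le>n. F s b a * F t b' a)"
    by (rule sum_PiE_singleton)
  finally show "\<bar>coincidence_sum n F {s, t} d c\<bar> \<le> \<kappa> ^ 30 * z\<^sup>2"
    using beck2[OF assms(1-3)] by simp
qed

text \<open>Once the value \<open>a\<close> shared by \<open>x\<close> and \<open>y\<close> is
  fixed, the free frequency of \<open>x\<close> gives a line sum, and the frequency shared by
  \<open>y\<close> and \<open>w\<close> together with the free one of \<open>w\<close> gives a plane
  sum. The trivial sum over \<open>a\<close> brings the exponent to 16 + 8 + 21 = 3 * 15.\<close>

lemma coincidence_sum_path:
  assumes q: "x < q" "y < q" "w < q" and dist: "x \<noteq> y" "y \<noteq> w" "x \<noteq> w"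
    and c: "c x = c y" "c x \<noteq> c w" and d: "d y = d w" "d x \<noteq> d w"
  shows "\<bar>coincidence_sum n F {x, y, w} c d\<bar> \<le> (\<kappa> ^ 15 * z) ^ 3"
proof -
  have "coincidence_sum n F {x, y, w} c d = (\<Sum>\<alpha>\<in>PiE {c x, c w} (\<lambda>_. {..n}). \<Sum>\<beta>\<in>PiE {d x, d w} (\<lambda>_. {..n}).
      F x (\<alpha> (c x)) (\<beta> (d x)) * (F y (\<alpha> (c x)) (\<beta> (d w)) * F w (\<alpha> (c w)) (\<beta> (d w))))"
    using c d dist by (simp add: coincidence_sum_def insert_commute mult_ac)
  also have "\<dots> = (\<Sum>\<alpha>\<in>PiE {c x, c w} (\<lambda>_. {..n}). \<Sum>b\<le>n. \<Sum>b'\<le>n.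
      F x (\<alpha> (c x)) b * (F y (\<alpha> (c x)) b' * F w (\<alpha> (c w)) b'))"
    by (subst sum_PiE_doubleton[OF d(2)]) simp
  also have "\<dots> = (\<Sum>a\<le>n. \<Sum>a'\<le>n. \<Sum>b\<le>n. \<Sum>b'\<le>n. F x a b * (F y a b' * F w a' b'))"
    by (rule sum_PiE_doubleton[OF c(2)])
  also have "\<dots> = (\<Sum>a\<le>n. (\<Sum>b\<le>n. F x a b) * (\<Sum>b'\<le>n. \<Sum>a'\<le>n. F w a' b' * F y a b'))"
  proof (rule sum.cong[OF refl])
    fix a
    have "(\<Sum>a'\<le>n. \<Sum>b\<le>n. \<Sum>b'\<le>n. F x a b * (F y a b' * F w a' b')) =
        (\<Sum>a'\<le>n. (\<Sum>b\<le>n. F x a b) * (\<Sum>b'\<le>n. F w a' b' * F y a b'))"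
      by (simp add: sum_product mult_ac)
    also have "\<dots> = (\<Sum>b\<le>n. F x a b) * (\<Sum>a'\<le>n. \<Sum>b'\<le>n. F w a' b' * F y a b')"
      by (simp add: sum_distrib_left)
    also have "(\<Sum>a'\<le>n. \<Sum>b'\<le>n. F w a' b' * F y a b') = (\<Sum>b'\<le>n. \<Sum>a'\<le>n. F w a' b' * F y a b')"
      by (rule sum.swap)
    finally show "(\<Sum>a'\<le>n. \<Sum>b\<le>n. \<Sum>b'\<le>n. F x a b * (F y a b' * F w a' b')) =
        (\<Sum>b\<le>n. F x a b) * (\<Sum>b'\<le>n. \<Sum>a'\<le>n. F w a' b' * F y a b')" .
  qed
  also have "\<bar>\<dots>\<bar> \<le> (\<Sum>a\<le>n. (\<kappa> ^ 8 * z) * (\<kappa> ^ 21 * z))"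
  proof (intro order_trans[OF sum_abs] sum_mono)
    fix a assume a: "a \<in> {..n}"
    have "\<bar>\<Sum>b\<le>n. F x a b\<bar> \<le> \<kappa> ^ 8 * z"
      using line2[of "{x}" "\<lambda>_. a"] q a by simp
    moreover have "\<bar>\<Sum>b'\<le>n. \<Sum>a'\<le>n. F w a' b' * F y a b'\<bar> \<le> \<kappa> ^ 21 * z"
      using plane[of y w a] T q dist a by force
    ultimately show "\<bar>(\<Sum>b\<le>n. F x a b) * (\<Sum>b'\<le>n. \<Sum>a'\<le>n. F w a' b' * F y a b')\<bar> \<le> (\<kappa> ^ 8 * z) * (\<kappa> ^ 21 * z)"
      unfolding abs_mult using \<kappa> z by (intro mult_mono) auto
  qed
  also have "\<dots> = \<kappa> ^ 45 * z ^ 2"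
    using n by (simp add: power2_eq_square algebra_simps flip: power_add)
  also have "\<dots> \<le> \<kappa> ^ 45 * z ^ 3"
    using \<kappa> z by (intro mult_left_mono power_increasing) auto
  also have "\<dots> = (\<kappa> ^ 15 * z) ^ 3"
    by (simp add: power_mult_distrib flip: power_mult)
  finally show ?thesis .
qed

text \<open>The hypothesis compares exponents of \<open>\<kappa>\<close>: 16 for each freely counted
  frequency, 8 for each line sum, against 15 for each factor. The second conclusion exchanges the
  two coordinates.\<close>

lemma coincidence_sum_small_fibres:
  assumes V: "V \<subseteq> {..<q}" and *: "16 * card (d ` V) + 8 * card (c ` V) \<le> 15 * card V"
  shows "\<bar>coincidence_sum n F V c d\<bar> \<le> (\<kappa> ^ 15 * z) ^ card V"
    and "\<bar>coincidence_sum n F V d c\<bar> \<le> (\<kappa> ^ 15 * z) ^ card V"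
proof -
  have fin: "finite V" using V finite_subset by blast
  have "real (n + 1) ^ card (d ` V) * (\<kappa> ^ 8 * z) ^ card (c ` V) =
      \<kappa> ^ (16 * card (d ` V) + 8 * card (c ` V)) * z ^ card (c ` V)"
    unfolding n power_mult_distrib power_mult power_add by (simp only: mult_ac)
  also have "\<dots> \<le> \<kappa> ^ (15 * card V) * z ^ card V"
    using \<kappa> z * card_image_le[OF fin, of c] by (intro mult_mono power_increasing) auto
  also have "\<dots> = (\<kappa> ^ 15 * z) ^ card V"
    by (simp only: power_mult_distrib power_mult)
  finally have le: "real (n + 1) ^ card (d ` V) * (\<kappa> ^ 8 * z) ^ card (c ` V) \<le> (\<kappa> ^ 15 * z) ^ card V" .
  show "\<bar>coincidence_sum n F V c d\<bar> \<le> (\<kappa> ^ 15 * z) ^ card V"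
    by (rule order_trans[OF coincidence_sum_le[OF fin, where S = "\<kappa> ^ 8 * z"] le])
      (rule line1, use V in auto)
  show "\<bar>coincidence_sum n F V d c\<bar> \<le> (\<kappa> ^ 15 * z) ^ card V"
    unfolding coincidence_sum_swap[of _ F]
    by (rule order_trans[OF coincidence_sum_le[OF fin, where S = "\<kappa> ^ 8 * z"] le])
      (rule line2, use V in auto)
qed

text \<open>Let \<open>v\<close>, \<open>l\<close>, \<open>k\<close> be the numbers of edges and of
  vertices on the two sides. Counting the smaller side trivially costs an exponent of at most
  \<open>12 * (l + k)\<close>, which is within \<open>15 * v\<close> as soon as
  \<open>4 * (l + k) \<le> 5 * v\<close>. Since \<open>l + k \<le> v + 1\<close>, this can fail only
  for \<open>v \<le> 3\<close>. The cases that then remain open are two edges with one common vertex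
  and three edges with two vertices on each side; these need the estimates for pairs and
  planes.\<close>

lemma coincidence_sum_connected:
  assumes V: "V \<subseteq> {..<q}" "2 \<le> card V"
    and fibres: "card (c ` V) + card (d ` V) \<le> card V + 1"
    and iso: "\<And>t. t \<in> V \<Longrightarrow> \<exists>s\<in>V. s \<noteq> t \<and> (c s = c t \<or> d s = d t)"
  shows "\<bar>coincidence_sum n F V c d\<bar> \<le> (\<kappa> ^ 15 * z) ^ card V"
proof -
  have fin: "finite V" using V finite_subset by blast
  consider "16 * card (d ` V) + 8 * card (c ` V) \<le> 15 * card V"
    | "16 * card (c ` V) + 8 * card (d ` V) \<le> 15 * card V"
    | "card V = 2" "card (c ` V) + card (d ` V) = 3" | "card V = 3" "card (c ` V) = 2" "card (d ` V) = 2"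
  proof -
    have "V \<noteq> {}"
      using V by auto
    then have "0 < card (c ` V)" "0 < card (d ` V)"
      using fin by (auto simp: card_gt_0_iff)
    moreover have "16 * k + 8 * l \<le> 15 * v \<or> 16 * l + 8 * k \<le> 15 * v \<or> (v = 2 \<and> l + k = 3) \<or> (v = 3 \<and> l = 2 \<and> k = 2)"
      if "0 < l" "0 < k" "l + k \<le> v + 1" "2 \<le> v" for l k v :: nat
    proof -
      show ?thesis
      proof (cases "4 * (l + k) \<le> 5 * v")
        case True
        then have le: "4 * l + 4 * k \<le> 5 * v" by simp
        show ?thesis
        proof (cases "k \<le> l")
          case True
          with le have "16 * k + 8 * l \<le> 15 * v" by linarith
          then show ?thesis by blast
        next
          case False
          with le have "16 * l + 8 * k \<le> 15 * v" by linarith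
          then show ?thesis by blast
        qed
      next
        case False
        then have "5 * v < 4 * l + 4 * k" by simp
        with that have v: "v \<le> 3" "l + k = v + 1" by linarith+
        consider "v = 2" | "v = 3" using v(1) \<open>2 \<le> v\<close> by force
        then show ?thesis
        proof cases
          case 2
          then have "l + k = 4" using v by simp
          then consider "l = 1" "k = 3" | "l = 2" "k = 2" | "l = 3" "k = 1"
            using \<open>0 < l\<close> \<open>0 < k\<close> by force
          then show ?thesis using 2 by cases auto
        qed (use v in simp)
      qed
    qed
    ultimately show thesis
      using that fibres V(2) by meson
  qed
  then show ?thesis
  proof cases
    case 1
    then show ?thesis by (rule coincidence_sum_small_fibres[OF V(1)])
  next
    case 2
    then show ?thesis by (rule coincidence_sum_small_fibres[OF V(1)])
  next
    case 3
    obtain s t where st: "V = {s, t}" "s \<noteq> t"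
      using 3(1) by (auto simp: card_2_iff)
    have sq: "s < q" "t < q" using V st by auto
    have "(\<kappa> ^ 15 * z) ^ card V = \<kappa> ^ 30 * z\<^sup>2"
      using 3(1) by (simp add: power_mult_distrib flip: power_mult)
    moreover have "(c s = c t \<and> d s \<noteq> d t) \<or> (d s = d t \<and> c s \<noteq> c t)"
      using 3(2) st by (auto simp: card_insert_if split: if_splits)
    ultimately show ?thesis
      using coincidence_sum_pair[OF sq st(2), of c d] coincidence_sum_pair[OF sq st(2), of d c] st by auto
  next
    case 4
    obtain x y w where xyw: "V = {x, y, w}" "x \<noteq> y" "x \<noteq> w" "y \<noteq> w"
      using 4(1) by (auto simp: card_3_iff)
    have xq: "x < q" "y < q" "w < q" using V xyw by auto
    have path: ?thesis if "V = {x, y, w}" "x \<noteq> y" "y \<noteq> w" "x \<noteq> w" "c x = c y" "c x \<noteq> c w" "d y = d w" "d x \<noteq> d w" for x y w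
    proof -
      have "x < q" "y < q" "w < q" using V that(1) by auto
      from coincidence_sum_path[OF this that(2-8)] show ?thesis
        using 4(1) that(1) by simp
    qed
    have c: "(c x = c y \<and> c x \<noteq> c w) \<or> (c x = c w \<and> c x \<noteq> c y) \<or> (c y = c w \<and> c y \<noteq> c x)"
      using 4(2) xyw(1) by (cases "c x = c y"; cases "c x = c w"; cases "c y = c w") simp_all
    have d: "(d x = d y \<and> d x \<noteq> d w) \<or> (d x = d w \<and> d x \<noteq> d y) \<or> (d y = d w \<and> d y \<noteq> d x)"
      using 4(3) xyw(1) by (cases "d x = d y"; cases "d x = d w"; cases "d y = d w") simp_all
    \<comment> \<open>If \<open>c\<close> and \<open>d\<close> both joined the same two indices, the
      third would be isolated. Hence the two joined pairs share exactly one index, which is the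
      middle of a path.\<close>
    have iso_x: "c y = c x \<or> c w = c x \<or> d y = d x \<or> d w = d x"
      and iso_y: "c x = c y \<or> c w = c y \<or> d x = d y \<or> d w = d y"
      and iso_w: "c x = c w \<or> c y = c w \<or> d x = d w \<or> d y = d w"
      using iso[of x] iso[of y] iso[of w] unfolding xyw(1) by blast+
    have perm: "V = {y, x, w}" "V = {x, w, y}" "V = {w, x, y}" "V = {y, w, x}" "V = {w, y, x}"
      using xyw(1) by blast+
    from c show ?thesis
    proof (elim disjE conjE)
      assume "c x = c y" "c x \<noteq> c w"
      with d iso_w have "d x = d w \<and> d x \<noteq> d y \<or> d y = d w \<and> d y \<noteq> d x"
        by metis
      then show ?thesis
      proof (elim disjE conjE)
        assume "d x = d w" "d x \<noteq> d y"
        with \<open>c x = c y\<close> \<open>c x \<noteq> c w\<close> xyw(2-4) show ?thesis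
          by (intro path[OF perm(1)]) simp_all
      next
        assume "d y = d w" "d y \<noteq> d x"
        with \<open>c x = c y\<close> \<open>c x \<noteq> c w\<close> xyw(2-4) show ?thesis
          by (intro path[OF xyw(1)]) simp_all
      qed
    next
      assume "c x = c w" "c x \<noteq> c y"
      with d iso_y have "d x = d y \<and> d x \<noteq> d w \<or> d y = d w \<and> d y \<noteq> d x"
        by metis
      then show ?thesis
      proof (elim disjE conjE)
        assume "d x = d y" "d x \<noteq> d w"
        with \<open>c x = c w\<close> \<open>c x \<noteq> c y\<close> xyw(2-4) show ?thesis
          by (intro path[OF perm(3)]) simp_all
      next
        assume "d y = d w" "d y \<noteq> d x"
        with \<open>c x = c w\<close> \<open>c x \<noteq> c y\<close> xyw(2-4) show ?thesis
          by (intro path[OF perm(2)]) simp_all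
      qed
    next
      assume "c y = c w" "c y \<noteq> c x"
      with d iso_x have "d x = d y \<and> d x \<noteq> d w \<or> d x = d w \<and> d x \<noteq> d y"
        by metis
      then show ?thesis
      proof (elim disjE conjE)
        assume "d x = d y" "d x \<noteq> d w"
        with \<open>c y = c w\<close> \<open>c y \<noteq> c x\<close> xyw(2-4) show ?thesis
          by (intro path[OF perm(5)]) simp_all
      next
        assume "d x = d w" "d x \<noteq> d y"
        with \<open>c y = c w\<close> \<open>c y \<noteq> c x\<close> xyw(2-4) show ?thesis
          by (intro path[OF perm(4)]) simp_all
      qed
    qed
  qed
qed

text \<open>Both sides are multiplicative over separated parts, and no index becomes isolated by
  splitting, because its partner lies in the same part. The induction thus ends with connected
  patterns of at least two edges; a lone index would enjoy no comparable saving.\<close>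

theorem coincidence_sum_bound:
  assumes "V \<subseteq> {..<q}" "\<And>t. t \<in> V \<Longrightarrow> \<exists>s\<in>V. s \<noteq> t \<and> (c s = c t \<or> d s = d t)"
  shows "\<bar>coincidence_sum n F V c d\<bar> \<le> (\<kappa> ^ 15 * z) ^ card V"
  using assms
proof (induction "card V" arbitrary: V rule: less_induct)
  case (less V)
  have fin: "finite V" using less.prems(1) finite_subset by blast
  show ?case
  proof (cases "V = {}")
    case True
    then show ?thesis by (simp add: coincidence_sum_def)
  next
    case False
    then obtain t where "t \<in> V" by auto
    then obtain s where "s \<in> V" "s \<noteq> t" using less.prems(2) by blast
    then have "card {s, t} \<le> card V"
      using \<open>t \<in> V\<close> fin by (intro card_mono) auto
    then have two: "2 \<le> card V" using \<open>s \<noteq> t\<close> by simp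
    show ?thesis
    proof (cases "\<exists>W. W \<subset> V \<and> W \<noteq> {} \<and> separated c d W (V - W)")
      case True
      then obtain W where W: "W \<subset> V" "W \<noteq> {}" "separated c d W (V - W)" by blast
      have finW: "finite W" using W fin finite_subset by blast
      have iso: "\<exists>s\<in>U. s \<noteq> t \<and> (c s = c t \<or> d s = d t)"
        if "t \<in> U" and U: "U = W \<or> U = V - W" for t U
      proof -
        have "t \<in> V" using that W by auto
        then obtain s where s: "s \<in> V" "s \<noteq> t" "c s = c t \<or> d s = d t"
          using less.prems(2) by blast
        have "s \<in> U"
        proof (rule ccontr)
        assume "s \<notin> U"
        then have "{s, t} \<inter> W \<noteq> {}" "{s, t} \<inter> (V - W) \<noteq> {}" "s \<in> W \<longleftrightarrow> t \<notin> W"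
          using s(1) that W(1) by auto
        then have "c s \<noteq> c t" "d s \<noteq> d t"
          using W(3) s(1) \<open>t \<in> V\<close> unfolding separated_def by (metis DiffI disjoint_iff imageI)+
        with s(3) show False by blast
      qed
        then show ?thesis using s by blast
      qed
      have "card W < card V" "card (V - W) < card V"
        using W fin by (auto intro!: psubset_card_mono)
      then have IH: "\<bar>coincidence_sum n F W c d\<bar> \<le> (\<kappa> ^ 15 * z) ^ card W"
        "\<bar>coincidence_sum n F (V - W) c d\<bar> \<le> (\<kappa> ^ 15 * z) ^ card (V - W)"
        using iso[of _ W] iso[of _ "V - W"] W(1) less.prems(1)
        by (intro less.hyps; blast)+
      have VW: "W \<union> (V - W) = V" using W by auto
      have "coincidence_sum n F V c d = coincidence_sum n F W c d * coincidence_sum n F (V - W) c d"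
        using coincidence_sum_Un[OF finW, of "V - W" c d n F] fin W(3) VW by (auto simp: separated_def)
      then have "\<bar>coincidence_sum n F V c d\<bar> \<le> (\<kappa> ^ 15 * z) ^ card W * (\<kappa> ^ 15 * z) ^ card (V - W)"
        using IH \<kappa> z by (simp only: abs_mult) (intro mult_mono, auto)
      also have "card W + card (V - W) = card V"
        using W fin finW by (metis VW card_Un_disjoint Diff_disjoint finite_Diff)
      then have "(\<kappa> ^ 15 * z) ^ card W * (\<kappa> ^ 15 * z) ^ card (V - W) = (\<kappa> ^ 15 * z) ^ card V"
        by (metis power_add)
      finally show ?thesis .
    next
      case False
      then have conn: "\<not> separated c d W (V - W)" if "W \<subset> V" "W \<noteq> {}" for W
        using that by blast
      have "card (c ` V) + card (d ` V) \<le> card V + 1"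
        by (rule card_fibres_le[OF fin \<open>V \<noteq> {}\<close> conn])
      with less.prems(1) two show ?thesis
        by (rule coincidence_sum_connected) (rule less.prems(2))
    qed
  qed
qed

end

section \<open>Riesz products restricted to distinct frequencies\<close>

text \<open>Reading the factors from left to right, the first \<open>t\<close> that is related to a smaller index is
  related to exactly one of them.\<close>

lemma prod_no_earlier_match:
  fixes q :: nat
  assumes "\<And>s s' t. s < q \<Longrightarrow> s' < q \<Longrightarrow> t < q \<Longrightarrow> co s t \<Longrightarrow> co s' t \<Longrightarrow> co s s'"
  shows "(of_bool (\<forall>t<q. \<forall>s<t. \<not> co s t) :: real) = (\<Prod>t<q. 1 - (\<Sum>s<t. of_bool (co s t)))"
  using assms
proof (induction q)
  case 0
  then show ?case by simp
next
  case (Suc q)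
  have IH: "(of_bool (\<forall>t<q. \<forall>s<t. \<not> co s t) :: real) = (\<Prod>t<q. 1 - (\<Sum>s<t. of_bool (co s t)))"
    by (rule Suc.IH) (use Suc.prems in \<open>meson less_SucI\<close>)
  show ?case
  proof (cases "\<forall>t<q. \<forall>s<t. \<not> co s t")
    case True
    have "(\<Sum>s<q. of_bool (co s q)) = (of_bool (\<exists>s<q. co s q) :: real)"
    proof (cases "\<exists>s<q. co s q")
      case True
      then obtain s where s: "s < q" "co s q" by blast
      have "co s' q \<longleftrightarrow> s' = s" if "s' < q" for s'
      proof
        assume "co s' q"
        then have "co s' s" "co s s'"
          using Suc.prems[of s' s q] Suc.prems[of s s' q] s that by auto
        then show "s' = s"
          using \<open>\<forall>t<q. \<forall>s<t. \<not> co s t\<close> s(1) that by (metis nat_neq_iff)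
      qed (use s in simp)
      then have "(\<Sum>s'<q. of_bool (co s' q)) = (\<Sum>s'<q. if s' = s then 1 else 0 :: real)"
        by (intro sum.cong) auto
      then show ?thesis using s by auto
    qed auto
    moreover have "(\<forall>t<Suc q. \<forall>s<t. \<not> co s t) \<longleftrightarrow> \<not> (\<exists>s<q. co s q)"
      using True by (auto simp: less_Suc_eq)
    moreover have "(\<Prod>t<q. 1 - (\<Sum>s<t. of_bool (co s t))) = (1 :: real)"
      by (subst IH[symmetric]) (use True in simp)
    ultimately show ?thesis
      by (simp only: prod.lessThan_Suc) (simp add: of_bool_def)
  next
    case False
    then have "\<not> (\<forall>t<Suc q. \<forall>s<t. \<not> co s t)"
      by (meson less_SucI)
    moreover have "(\<Prod>t<q. 1 - (\<Sum>s<t. of_bool (co s t))) = (0 :: real)"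
      by (subst IH[symmetric]) (use False in simp)
    ultimately show ?thesis
      by (simp only: prod.lessThan_Suc) simp
  qed
qed

text \<open>These index the expansion of the product of the \<open>1 - (\<Sum>s<t. ...)\<close>:
  \<open>\<phi> t = t\<close> picks the summand 1, and \<open>\<phi> t = s < t\<close> picks the
  coincidence of \<open>t\<close> with \<open>s\<close>. Such a map is a forest whose trees are the
  enforced classes. Compared with a sum over set partitions, all coefficients are signs and weighted
  sums over the maps factorise over \<open>t\<close>.\<close>

definition parent_maps :: "nat \<Rightarrow> (nat \<Rightarrow> nat) set"
  where "parent_maps q = PiE {..<q} (\<lambda>t. {..t})"

lemma finite_parent_maps: "finite (parent_maps q)"
  by (simp add: parent_maps_def finite_PiE)

lemma parent_le: "\<phi> \<in> parent_maps q \<Longrightarrow> t < q \<Longrightarrow> \<phi> t \<le> t"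
  by (auto simp: parent_maps_def)

definition parent_sign :: "(nat \<Rightarrow> nat) \<Rightarrow> (nat \<Rightarrow> nat \<Rightarrow> bool) \<Rightarrow> nat \<Rightarrow> real"
  where "parent_sign \<phi> co t = (if \<phi> t = t then 1 else - of_bool (co (\<phi> t) t))"

lemma of_bool_no_match:
  fixes q :: nat
  assumes "\<And>s s' t. s < q \<Longrightarrow> s' < q \<Longrightarrow> t < q \<Longrightarrow> co s t \<Longrightarrow> co s' t \<Longrightarrow> co s s'"
  shows "of_bool (\<forall>t<q. \<forall>s<t. \<not> co s t) = (\<Sum>\<phi>\<in>parent_maps q. \<Prod>t<q. parent_sign \<phi> co t)"
proof -
  have "1 - (\<Sum>s<t. of_bool (co s t)) = (\<Sum>s\<le>t. if s = t then 1 else - of_bool (co s t) :: real)" for t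
    by (simp add: lessThan_Suc_atMost[symmetric] sum_negf)
  then have "of_bool (\<forall>t<q. \<forall>s<t. \<not> co s t) = (\<Prod>t<q. \<Sum>s\<le>t. if s = t then 1 else - of_bool (co s t) :: real)"
    by (simp add: prod_no_earlier_match[OF assms])
  also have "\<dots> = (\<Sum>\<phi>\<in>parent_maps q. \<Prod>t<q. if \<phi> t = t then 1 else - of_bool (co (\<phi> t) t))"
    unfolding parent_maps_def by (rule prod_sum_PiE) auto
  finally show ?thesis by (simp add: parent_sign_def)
qed

text \<open>The root of the tree of \<open>t\<close>. It labels the coincidence classes by a
  function, the form that \<open>coincidence_sum\<close> expects.\<close>

function ancestor :: "(nat \<Rightarrow> nat) \<Rightarrow> nat \<Rightarrow> nat"
  where "ancestor \<phi> t = (if \<phi> t < t then ancestor \<phi> (\<phi> t) else t)"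
  by pat_completeness auto
termination by (relation "Wellfounded.measure snd") auto

declare ancestor.simps [simp del]

lemma ancestor_ancestor: "ancestor \<phi> (ancestor \<phi> t) = ancestor \<phi> t"
proof (induction t rule: less_induct)
  case (less t)
  show ?case
  proof (cases "\<phi> t < t")
    case True
    then show ?thesis using less ancestor.simps[of \<phi> t] by simp
  next
    case False
    then show ?thesis using ancestor.simps[of \<phi> t] by simp
  qed
qed

lemma ancestor_in:
  assumes "\<And>t. t \<in> V \<Longrightarrow> \<phi> t < t \<Longrightarrow> \<phi> t \<in> V" "t \<in> V"
  shows "ancestor \<phi> t \<in> V"
  using assms(2)
proof (induction t rule: less_induct)
  case (less t)
  then show ?case using assms(1) ancestor.simps[of \<phi> t] by (cases "\<phi> t < t") auto
qed

lemma ancestor_constant: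
  assumes "\<And>t. t \<in> V \<Longrightarrow> \<phi> t < t \<Longrightarrow> \<phi> t \<in> V \<and> f (\<phi> t) = f t" "t \<in> V"
  shows "f (ancestor \<phi> t) = f t"
  using assms(2)
proof (induction t rule: less_induct)
  case (less t)
  then show ?case using assms(1)[OF less.prems] ancestor.simps[of \<phi> t] by (cases "\<phi> t < t") auto
qed

lemma sum_parent_maps_le:
  fixes u :: real
  assumes "0 \<le> u"
  shows "(\<Sum>\<phi>\<in>parent_maps q. \<Prod>t<q. if \<phi> t = t then 1 else u) \<le> exp ((real q)\<^sup>2 * u)"
proof -
  have "(\<Sum>\<phi>\<in>parent_maps q. \<Prod>t<q. if \<phi> t = t then 1 else u) = (\<Prod>t<q. \<Sum>s\<le>t. if s = t then 1 else u)"
    unfolding parent_maps_def by (rule prod_sum_PiE[symmetric]) auto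
  also have "\<dots> = (\<Prod>t<q. 1 + t * u)"
    by (intro prod.cong) (simp_all add: lessThan_Suc_atMost[symmetric])
  also have "\<dots> \<le> (\<Prod>t<q. exp (real q * u))"
  proof (rule prod_mono)
    fix t assume "t \<in> {..<q}"
    then have "t * u \<le> q * u"
      using assms by (intro mult_right_mono) auto
    then show "0 \<le> 1 + t * u \<and> 1 + t * u \<le> exp (real q * u)"
      using assms by (auto intro!: order_trans[OF _ exp_ge_add_one_self])
  qed
  also have "\<dots> = exp ((real q)\<^sup>2 * u)"
    by (simp add: exp_of_nat_mult[symmetric] power2_eq_square mult_ac)
  finally show ?thesis .
qed

text \<open>\<open>None\<close> stands for the constant term of \<open>1 + \<rho> F t\<close>, and
  \<open>Some (a, b)\<close> for the function with second frequency \<open>a\<close> and third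
  frequency \<open>b\<close>; its first frequency is \<open>n - a - b\<close>.\<close>

type_synonym slot = "(nat \<times> nat) option"

definition slots :: "nat \<Rightarrow> slot set"
  where "slots n = insert None (Some ` ({..n} \<times> {..n}))"

lemma finite_slots [simp]: "finite (slots n)"
  by (simp add: slots_def)

definition weight :: "real \<Rightarrow> (nat \<Rightarrow> nat \<Rightarrow> nat \<Rightarrow> real) \<Rightarrow> nat \<Rightarrow> slot \<Rightarrow> real"
  where "weight \<rho> F t v = (case v of None \<Rightarrow> 1 | Some (a, b) \<Rightarrow> \<rho> * F t a b)"

lemma sum_weight: "(\<Sum>v\<in>slots n. weight \<rho> F t v) = 1 + \<rho> * (\<Sum>a\<le>n. \<Sum>b\<le>n. F t a b)"
proof -
  have "(\<Sum>v\<in>slots n. weight \<rho> F t v) = 1 + (\<Sum>v\<in>Some ` ({..n} \<times> {..n}). weight \<rho> F t v)"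
    unfolding slots_def by (subst sum.insert) (auto simp: weight_def)
  also have "(\<Sum>v\<in>Some ` ({..n} \<times> {..n}). weight \<rho> F t v) = (\<Sum>p\<in>{..n} \<times> {..n}. \<rho> * F t (fst p) (snd p))"
    by (subst sum.reindex) (auto simp: weight_def intro!: sum.cong)
  also have "\<dots> = \<rho> * (\<Sum>a\<le>n. \<Sum>b\<le>n. F t a b)"
    by (simp add: sum_distrib_left sum.cartesian_product case_prod_beta)
  finally show ?thesis .
qed

definition same :: "(nat \<times> nat \<Rightarrow> nat) \<Rightarrow> (nat \<Rightarrow> slot) \<Rightarrow> nat \<Rightarrow> nat \<Rightarrow> bool"
  where "same pr r s t \<longleftrightarrow> (\<exists>p p'. r s = Some p \<and> r t = Some p' \<and> pr p = pr p')"

text \<open>Only the second and third frequencies are compared, since different indices belong to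
  disjoint blocks of first frequencies.\<close>

definition strongly_distinct :: "nat \<Rightarrow> (nat \<Rightarrow> slot) \<Rightarrow> bool"
  where "strongly_distinct q r \<longleftrightarrow> (\<forall>t<q. \<forall>s<t. \<not> same fst r s t \<and> \<not> same snd r s t)"

definition riesz :: "real \<Rightarrow> (nat \<Rightarrow> nat \<Rightarrow> nat \<Rightarrow> real) \<Rightarrow> nat \<Rightarrow> nat \<Rightarrow> real"
  where "riesz \<rho> F q n =
    (\<Sum>r\<in>PiE {..<q} (\<lambda>_. slots n). of_bool (strongly_distinct q r) * (\<Prod>t<q. weight \<rho> F t (r t)))"

definition pattern_sum ::
  "real \<Rightarrow> (nat \<Rightarrow> nat \<Rightarrow> nat \<Rightarrow> real) \<Rightarrow> nat \<Rightarrow> nat \<Rightarrow> (nat \<Rightarrow> nat) \<Rightarrow> (nat \<Rightarrow> nat) \<Rightarrow> real"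
  where "pattern_sum \<rho> F q n \<phi> \<psi> = (\<Sum>r\<in>PiE {..<q} (\<lambda>_. slots n).
    \<Prod>t<q. parent_sign \<phi> (same fst r) t * parent_sign \<psi> (same snd r) t * weight \<rho> F t (r t))"

lemma riesz_eq_pattern_sums:
  "riesz \<rho> F q n = (\<Sum>\<phi>\<in>parent_maps q. \<Sum>\<psi>\<in>parent_maps q. pattern_sum \<rho> F q n \<phi> \<psi>)"
proof -
  have eq: "of_bool (strongly_distinct q r) =
    (\<Sum>\<phi>\<in>parent_maps q. \<Sum>\<psi>\<in>parent_maps q. \<Prod>t<q. parent_sign \<phi> (same fst r) t * parent_sign \<psi> (same snd r) t)"
    for r
  proof -
    have "of_bool (strongly_distinct q r) =
        (of_bool (\<forall>t<q. \<forall>s<t. \<not> same fst r s t) * of_bool (\<forall>t<q. \<forall>s<t. \<not> same snd r s t) :: real)"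
      by (auto simp: strongly_distinct_def)
    also have "\<dots> = (\<Sum>\<phi>\<in>parent_maps q. \<Prod>t<q. parent_sign \<phi> (same fst r) t) *
        (\<Sum>\<psi>\<in>parent_maps q. \<Prod>t<q. parent_sign \<psi> (same snd r) t)"
      by (intro arg_cong2[where f = "(*)"] of_bool_no_match) (auto simp: same_def)
    finally show ?thesis
      by (simp add: sum_product prod.distrib)
  qed
  have "riesz \<rho> F q n = (\<Sum>r\<in>PiE {..<q} (\<lambda>_. slots n). \<Sum>\<phi>\<in>parent_maps q. \<Sum>\<psi>\<in>parent_maps q.
    \<Prod>t<q. parent_sign \<phi> (same fst r) t * parent_sign \<psi> (same snd r) t * weight \<rho> F t (r t))"
    unfolding riesz_def eq sum_distrib_right by (simp add: prod.distrib)
  also have "\<dots> = (\<Sum>\<phi>\<in>parent_maps q. \<Sum>r\<in>PiE {..<q} (\<lambda>_. slots n). \<Sum>\<psi>\<in>parent_maps q.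
    \<Prod>t<q. parent_sign \<phi> (same fst r) t * parent_sign \<psi> (same snd r) t * weight \<rho> F t (r t))"
    by (rule sum.swap)
  also have "\<dots> = (\<Sum>\<phi>\<in>parent_maps q. \<Sum>\<psi>\<in>parent_maps q. \<Sum>r\<in>PiE {..<q} (\<lambda>_. slots n).
    \<Prod>t<q. parent_sign \<phi> (same fst r) t * parent_sign \<psi> (same snd r) t * weight \<rho> F t (r t))"
    by (intro sum.cong refl sum.swap)
  finally show ?thesis
    by (simp add: pattern_sum_def)
qed

section \<open>Factorisation of a coincidence pattern\<close>

definition linked :: "nat \<Rightarrow> (nat \<Rightarrow> nat) \<Rightarrow> (nat \<Rightarrow> nat) \<Rightarrow> nat set"
  where "linked q \<phi> \<psi> = {t. t < q \<and> (\<exists>s<q. s \<noteq> t \<and> (\<phi> s = t \<or> \<phi> t = s \<or> \<psi> s = t \<or> \<psi> t = s))}"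

lemma linked_subset: "linked q \<phi> \<psi> \<subseteq> {..<q}"
  by (auto simp: linked_def)

lemma finite_linked [simp]: "finite (linked q \<phi> \<psi>)"
  using finite_subset[OF linked_subset] by simp

lemma linked_parent:
  assumes "\<phi> \<in> parent_maps q" "\<psi> \<in> parent_maps q" "t < q"
  shows "\<phi> t \<noteq> t \<Longrightarrow> t \<in> linked q \<phi> \<psi> \<and> \<phi> t \<in> linked q \<phi> \<psi> \<and> \<phi> t < t"
    and "\<psi> t \<noteq> t \<Longrightarrow> t \<in> linked q \<phi> \<psi> \<and> \<psi> t \<in> linked q \<phi> \<psi> \<and> \<psi> t < t"
proof -
  note le = parent_le[OF assms(1,3)] parent_le[OF assms(2,3)]
  show "t \<in> linked q \<phi> \<psi> \<and> \<phi> t \<in> linked q \<phi> \<psi> \<and> \<phi> t < t" if "\<phi> t \<noteq> t"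
    using that le assms(3) by (auto simp: linked_def intro: exI[of _ "\<phi> t"] exI[of _ t])
  show "t \<in> linked q \<phi> \<psi> \<and> \<psi> t \<in> linked q \<phi> \<psi> \<and> \<psi> t < t" if "\<psi> t \<noteq> t"
    using that le assms(3) by (auto simp: linked_def intro: exI[of _ "\<psi> t"] exI[of _ t])
qed

lemma linked_ancestor:
  assumes "\<phi> \<in> parent_maps q" "\<psi> \<in> parent_maps q" "t \<in> linked q \<phi> \<psi>"
  shows "\<exists>s\<in>linked q \<phi> \<psi>. s \<noteq> t \<and> (ancestor \<phi> s = ancestor \<phi> t \<or> ancestor \<psi> s = ancestor \<psi> t)"
proof -
  have r: "ancestor \<phi> (\<phi> t) = ancestor \<phi> t" if "\<phi> t < t" for \<phi> :: "nat \<Rightarrow> nat" and t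
    using that ancestor.simps[of \<phi> t] by simp
  obtain s where s: "t < q" "s < q" "s \<noteq> t" "\<phi> s = t \<or> \<phi> t = s \<or> \<psi> s = t \<or> \<psi> t = s"
    using assms(3) by (auto simp: linked_def)
  have "s \<in> linked q \<phi> \<psi>"
    using s by (auto simp: linked_def)
  moreover have "ancestor \<phi> s = ancestor \<phi> t \<or> ancestor \<psi> s = ancestor \<psi> t"
    using s(4)
  proof (elim disjE)
    assume "\<phi> s = t" then show ?thesis using r[of \<phi> s] linked_parent(1)[OF assms(1,2) s(2)] s(3) by auto
  next
    assume "\<phi> t = s" then show ?thesis using r[of \<phi> t] linked_parent(1)[OF assms(1,2) s(1)] s(3) by auto
  next
    assume "\<psi> s = t" then show ?thesis using r[of \<psi> s] linked_parent(2)[OF assms(1,2) s(2)] s(3) by auto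
  next
    assume "\<psi> t = s" then show ?thesis using r[of \<psi> t] linked_parent(2)[OF assms(1,2) s(1)] s(3) by auto
  qed
  ultimately show ?thesis using s(3) by blast
qed

definition pattern_sign :: "(nat \<Rightarrow> nat) \<Rightarrow> (nat \<Rightarrow> nat) \<Rightarrow> nat set \<Rightarrow> real"
  where "pattern_sign \<phi> \<psi> V = (\<Prod>t\<in>V. (if \<phi> t = t then 1 else - 1) * (if \<psi> t = t then 1 else - 1))"

lemma abs_pattern_sign: "\<bar>pattern_sign \<phi> \<psi> V\<bar> = 1"
  unfolding pattern_sign_def abs_prod by (rule prod.neutral) (auto simp: abs_mult)

text \<open>Every index in \<open>V\<close> takes part in an enforced coincidence and hence carries
  a frequency pair. The second frequency is constant on the trees of \<open>\<phi>\<close>, the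
  third on those of \<open>\<psi>\<close>, so the surviving choices correspond to arbitrary values
  at the roots of both forests.\<close>

lemma linked_sum:
  assumes \<phi>: "\<phi> \<in> parent_maps q" and \<psi>: "\<psi> \<in> parent_maps q"
  defines "V \<equiv> linked q \<phi> \<psi>"
  shows "(\<Sum>r\<in>PiE V (\<lambda>_. slots n). \<Prod>t\<in>V. parent_sign \<phi> (same fst r) t * parent_sign \<psi> (same snd r) t * weight \<rho> F t (r t)) =
    pattern_sign \<phi> \<psi> V * \<rho> ^ card V * coincidence_sum n F V (ancestor \<phi>) (ancestor \<psi>)"
proof -
  have V: "finite V" "V \<subseteq> {..<q}"
    using linked_subset by (auto simp: V_def)
  define C where "C r \<longleftrightarrow> (\<forall>t\<in>V. (\<phi> t \<noteq> t \<longrightarrow> same fst r (\<phi> t) t) \<and> (\<psi> t \<noteq> t \<longrightarrow> same snd r (\<psi> t) t))" for r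
  have closed: "\<phi> t < t \<Longrightarrow> \<phi> t \<in> V" "\<psi> t < t \<Longrightarrow> \<psi> t \<in> V" if "t \<in> V" for t
    using linked_parent[OF \<phi> \<psi>, of t] V that by (auto simp: V_def)
  have ancestorV: "ancestor \<phi> t \<in> V" "ancestor \<psi> t \<in> V" if "t \<in> V" for t
    using ancestor_in[of V \<phi> t] ancestor_in[of V \<psi> t] closed that by blast+
  have sign: "(\<Prod>t\<in>V. parent_sign \<phi> (same fst r) t * parent_sign \<psi> (same snd r) t * weight \<rho> F t (r t)) =
      pattern_sign \<phi> \<psi> V * (of_bool (C r) * (\<Prod>t\<in>V. weight \<rho> F t (r t)))" for r
  proof -
    have "of_bool (C r) = (\<Prod>t\<in>V. of_bool ((\<phi> t \<noteq> t \<longrightarrow> same fst r (\<phi> t) t) \<and> (\<psi> t \<noteq> t \<longrightarrow> same snd r (\<psi> t) t)) :: real)"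
      using V(1) by (auto simp: C_def prod_zero_iff intro!: prod.neutral[symmetric])
    then show ?thesis
      unfolding pattern_sign_def
      by (simp only: prod.distrib[symmetric]) (intro prod.cong, auto simp: parent_sign_def)
  qed
  have present: "\<exists>p. r t = Some p" if Cr: "C r" and tV: "t \<in> V" for r t
  proof -
    obtain s where s: "t < q" "s < q" "s \<noteq> t" "\<phi> s = t \<or> \<phi> t = s \<or> \<psi> s = t \<or> \<psi> t = s"
      using tV by (auto simp: V_def linked_def)
    then have "s \<in> V"
      by (auto simp: V_def linked_def)
    then have "same fst r t s \<or> same fst r s t \<or> same snd r t s \<or> same snd r s t"
      using Cr tV s by (auto simp: C_def)
    then show ?thesis by (auto simp: same_def)
  qed
  have const: "fst (the (r (ancestor \<phi> t))) = fst (the (r t))" "snd (the (r (ancestor \<psi> t))) = snd (the (r t))"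
    if Cr: "C r" and tV: "t \<in> V" for r t
  proof -
    have 1: "\<phi> t \<in> V \<and> fst (the (r (\<phi> t))) = fst (the (r t))" if "t \<in> V" "\<phi> t < t" for t
      using closed that Cr by (force simp: C_def same_def)
    have 2: "\<psi> t \<in> V \<and> snd (the (r (\<psi> t))) = snd (the (r t))" if "t \<in> V" "\<psi> t < t" for t
      using closed that Cr by (force simp: C_def same_def)
    show "fst (the (r (ancestor \<phi> t))) = fst (the (r t))"
      by (rule ancestor_constant[where f = "\<lambda>t. fst (the (r t))", OF 1 tV])
    show "snd (the (r (ancestor \<psi> t))) = snd (the (r t))"
      by (rule ancestor_constant[where f = "\<lambda>t. snd (the (r t))", OF 2 tV])
  qed
  define A where "A = PiE (ancestor \<phi> ` V) (\<lambda>_. {..n}) \<times> PiE (ancestor \<psi> ` V) (\<lambda>_. {..n})"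
  define j where "j p = (\<lambda>t\<in>V. Some (fst p (ancestor \<phi> t), snd p (ancestor \<psi> t)))" for p :: "(nat \<Rightarrow> nat) \<times> (nat \<Rightarrow> nat)"
  have "(\<Sum>r\<in>PiE V (\<lambda>_. slots n). of_bool (C r) * (\<Prod>t\<in>V. weight \<rho> F t (r t))) =
      (\<Sum>r\<in>{r \<in> PiE V (\<lambda>_. slots n). C r}. \<Prod>t\<in>V. weight \<rho> F t (r t))"
    using V(1) by (intro sum.mono_neutral_cong_right) (auto intro: finite_PiE)
  also have "\<dots> = (\<Sum>p\<in>A. \<Prod>t\<in>V. \<rho> * F t (fst p (ancestor \<phi> t)) (snd p (ancestor \<psi> t)))"
  proof (rule sum.reindex_bij_witness[where i = j
        and j = "\<lambda>r. (\<lambda>l\<in>ancestor \<phi> ` V. fst (the (r l)), \<lambda>l\<in>ancestor \<psi> ` V. snd (the (r l)))"])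
    fix r assume "r \<in> {r \<in> PiE V (\<lambda>_. slots n). C r}"
    then have r: "r \<in> PiE V (\<lambda>_. slots n)" "C r" by auto
    let ?p = "(\<lambda>l\<in>ancestor \<phi> ` V. fst (the (r l)), \<lambda>l\<in>ancestor \<psi> ` V. snd (the (r l)))"
    have p: "fst ?p (ancestor \<phi> t) = fst (the (r t))" "snd ?p (ancestor \<psi> t) = snd (the (r t))" if "t \<in> V" for t
      using const[OF r(2) that] that by auto
    have the: "Some (the (r t)) = r t" "the (r t) \<in> {..n} \<times> {..n}" if "t \<in> V" for t
      using present[OF r(2) that] r(1) that by (auto simp: slots_def PiE_iff)
    show jp: "j ?p = r"
    proof
      fix t show "j ?p t = r t"
        using p[of t] the[of t] r(1) by (cases "t \<in> V") (auto simp: j_def PiE_iff extensional_def)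
    qed
    have "the (r l) \<in> {..n} \<times> {..n}" if "l \<in> ancestor \<phi> ` V \<or> l \<in> ancestor \<psi> ` V" for l
      using the(2) ancestorV that by blast
    then show "?p \<in> A"
      unfolding A_def by (auto simp: mem_Times_iff)
    show "(\<Prod>t\<in>V. \<rho> * F t (fst ?p (ancestor \<phi> t)) (snd ?p (ancestor \<psi> t))) = (\<Prod>t\<in>V. weight \<rho> F t (r t))"
    proof (rule prod.cong[OF refl])
      fix t assume t: "t \<in> V"
      then obtain a b where "r t = Some (a, b)" using present[OF r(2)] by fastforce
      then show "\<rho> * F t (fst ?p (ancestor \<phi> t)) (snd ?p (ancestor \<psi> t)) = weight \<rho> F t (r t)"
        unfolding p[OF t] by (simp add: weight_def)
    qed
  next
    fix p assume p: "p \<in> A"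
    have jt: "j p t = Some (fst p (ancestor \<phi> t), snd p (ancestor \<psi> t))" if "t \<in> V" for t
      using that by (simp add: j_def)
    have "C (j p)"
      unfolding C_def
    proof (intro ballI conjI impI)
      fix t assume t: "t \<in> V"
      have tq: "t < q" using t V by auto
      show "same fst (j p) (\<phi> t) t" if "\<phi> t \<noteq> t"
        using linked_parent(1)[OF \<phi> \<psi> tq that] jt t ancestor.simps[of \<phi> t] by (simp add: same_def V_def)
      show "same snd (j p) (\<psi> t) t" if "\<psi> t \<noteq> t"
        using linked_parent(2)[OF \<phi> \<psi> tq that] jt t ancestor.simps[of \<psi> t] by (simp add: same_def V_def)
    qed
    moreover have "j p \<in> PiE V (\<lambda>_. slots n)"
      using p by (auto simp: A_def j_def slots_def PiE_iff)
    ultimately show "j p \<in> {r \<in> PiE V (\<lambda>_. slots n). C r}" by simp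
    have "(\<lambda>l\<in>ancestor \<phi> ` V. fst (the (j p l))) = fst p"
    proof
      fix l show "(\<lambda>l\<in>ancestor \<phi> ` V. fst (the (j p l))) l = fst p l"
        using p jt ancestorV(1) by (cases "l \<in> ancestor \<phi> ` V") (auto simp: A_def ancestor_ancestor PiE_iff extensional_def)
    qed
    moreover have "(\<lambda>l\<in>ancestor \<psi> ` V. snd (the (j p l))) = snd p"
    proof
      fix l show "(\<lambda>l\<in>ancestor \<psi> ` V. snd (the (j p l))) l = snd p l"
        using p jt ancestorV(2) by (cases "l \<in> ancestor \<psi> ` V") (auto simp: A_def ancestor_ancestor PiE_iff extensional_def)
    qed
    ultimately show "(\<lambda>l\<in>ancestor \<phi> ` V. fst (the (j p l)), \<lambda>l\<in>ancestor \<psi> ` V. snd (the (j p l))) = p"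
      by simp
  qed
  also have "\<dots> = \<rho> ^ card V * coincidence_sum n F V (ancestor \<phi>) (ancestor \<psi>)"
    by (simp add: A_def coincidence_sum_def sum.cartesian_product case_prod_beta prod.distrib sum_distrib_left)
  finally show ?thesis
    unfolding sign sum_distrib_left[symmetric] by (simp add: mult.assoc)
qed

text \<open>An index outside \<open>V\<close> is its own parent in both forests and the parent of no
  other index. Its slot can be summed freely, which restores the complete factor
  \<open>1 + \<rho> F t\<close>.\<close>

lemma pattern_sum_eq:
  assumes \<phi>: "\<phi> \<in> parent_maps q" and \<psi>: "\<psi> \<in> parent_maps q"
  defines "V \<equiv> linked q \<phi> \<psi>"
  shows "pattern_sum \<rho> F q n \<phi> \<psi> = pattern_sign \<phi> \<psi> V * \<rho> ^ card V * coincidence_sum n F V (ancestor \<phi>) (ancestor \<psi>) *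
    (\<Prod>t\<in>{..<q} - V. 1 + \<rho> * (\<Sum>a\<le>n. \<Sum>b\<le>n. F t a b))"
proof -
  have V: "finite V" "V \<subseteq> {..<q}"
    using linked_subset by (auto simp: V_def)
  have un: "{..<q} = V \<union> ({..<q} - V)"
    using V by auto
  define g where "g t r = parent_sign \<phi> (same fst r) t * parent_sign \<psi> (same snd r) t * weight \<rho> F t (r t)" for t r
  have out: "g t r = weight \<rho> F t (r t)" if "t \<in> {..<q} - V" for t r
    using linked_parent[OF \<phi> \<psi>, of t] that by (auto simp: g_def V_def parent_sign_def)
  have loc: "g t r = g t r'" if "t \<in> V" "\<And>s. s \<in> V \<Longrightarrow> r s = r' s" for t r r'
  proof -
    have "t < q" using that V by auto
    then show ?thesis
      using that linked_parent[OF \<phi> \<psi>, of t] by (auto simp: g_def V_def parent_sign_def same_def)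
  qed
  have "pattern_sum \<rho> F q n \<phi> \<psi> = (\<Sum>r\<in>PiE {..<q} (\<lambda>_. slots n). (\<Prod>t\<in>V. g t r) * (\<Prod>t\<in>{..<q} - V. g t r))"
    unfolding pattern_sum_def g_def[symmetric]
    by (intro sum.cong refl prod.subset_diff[THEN trans, OF V(2)]) (auto simp: mult.commute)
  also have "\<dots> = (\<Sum>r\<in>PiE (V \<union> ({..<q} - V)) (\<lambda>_. slots n). (\<Prod>t\<in>V. g t r) * (\<Prod>t\<in>{..<q} - V. weight \<rho> F t (r t)))"
    using un out by simp
  also have "\<dots> = (\<Sum>r\<in>PiE V (\<lambda>_. slots n). \<Prod>t\<in>V. g t r) * (\<Sum>r\<in>PiE ({..<q} - V) (\<lambda>_. slots n). \<Prod>t\<in>{..<q} - V. weight \<rho> F t (r t))"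
    by (rule sum_PiE_Un) (auto intro!: prod.cong loc)
  also have "(\<Sum>r\<in>PiE ({..<q} - V) (\<lambda>_. slots n). \<Prod>t\<in>{..<q} - V. weight \<rho> F t (r t)) =
      (\<Prod>t\<in>{..<q} - V. \<Sum>v\<in>slots n. weight \<rho> F t v)"
    by (rule prod_sum_PiE[symmetric]) auto
  also have "\<dots> = (\<Prod>t\<in>{..<q} - V. 1 + \<rho> * (\<Sum>a\<le>n. \<Sum>b\<le>n. F t a b))"
    by (simp add: sum_weight)
  finally show ?thesis
    unfolding g_def V_def linked_sum[OF \<phi> \<psi>] .
qed

text \<open>The linked set contains all indices moved by \<open>\<phi>\<close> and all those moved
  by \<open>\<psi>\<close>. The square in \<open>u\<^sup>2\<close> provides one factor
  \<open>u\<close> for each of the two maps, after which the double sum splits.\<close>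

lemma sum_linked_le:
  fixes u :: real
  assumes "0 \<le> u" "u \<le> 1"
  shows "(\<Sum>\<phi>\<in>parent_maps q. \<Sum>\<psi>\<in>parent_maps q. (u\<^sup>2) ^ card (linked q \<phi> \<psi>)) \<le> exp (2 * (real q)\<^sup>2 * u)"
proof -
  define f where "f \<phi> = (\<Prod>t<q. if \<phi> t = t then 1 else u)" for \<phi> :: "nat \<Rightarrow> nat"
  have le: "u ^ card (linked q \<phi> \<psi>) \<le> f \<xi>" if "\<phi> \<in> parent_maps q" "\<psi> \<in> parent_maps q" "\<xi> = \<phi> \<or> \<xi> = \<psi>" for \<phi> \<psi> \<xi>
  proof -
    have "f \<xi> = (\<Prod>t\<in>{t. t < q \<and> \<xi> t \<noteq> t}. u)"
      unfolding f_def by (intro prod.mono_neutral_cong_right) auto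
    also have "\<dots> = u ^ card {t. t < q \<and> \<xi> t \<noteq> t}"
      by simp
    finally have f: "f \<xi> = u ^ card {t. t < q \<and> \<xi> t \<noteq> t}" .
    have "card {t. t < q \<and> \<xi> t \<noteq> t} \<le> card (linked q \<phi> \<psi>)"
      using linked_parent[OF that(1,2)] that(3) by (intro card_mono) auto
    then show ?thesis
      unfolding f using assms by (intro power_decreasing) auto
  qed
  have f0: "0 \<le> f \<phi>" for \<phi>
    unfolding f_def using assms by (intro prod_nonneg) auto
  have "(u\<^sup>2) ^ card (linked q \<phi> \<psi>) \<le> f \<phi> * f \<psi>" if "\<phi> \<in> parent_maps q" "\<psi> \<in> parent_maps q" for \<phi> \<psi>
  proof -
    have "(u\<^sup>2) ^ card (linked q \<phi> \<psi>) = u ^ card (linked q \<phi> \<psi>) * u ^ card (linked q \<phi> \<psi>)"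
      by (simp add: power2_eq_square power_mult_distrib)
    also have "\<dots> \<le> f \<phi> * f \<psi>"
      using le[OF that, of \<phi>] le[OF that, of \<psi>] f0 assms by (intro mult_mono) auto
    finally show ?thesis .
  qed
  then have "(\<Sum>\<phi>\<in>parent_maps q. \<Sum>\<psi>\<in>parent_maps q. (u\<^sup>2) ^ card (linked q \<phi> \<psi>)) \<le>
      (\<Sum>\<phi>\<in>parent_maps q. \<Sum>\<psi>\<in>parent_maps q. f \<phi> * f \<psi>)"
    by (intro sum_mono)
  also have "\<dots> = (\<Sum>\<phi>\<in>parent_maps q. f \<phi>) * (\<Sum>\<phi>\<in>parent_maps q. f \<phi>)"
    by (simp add: sum_product)
  also have "\<dots> \<le> exp ((real q)\<^sup>2 * u) * exp ((real q)\<^sup>2 * u)"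
    using sum_parent_maps_le[OF assms(1), of q] f0 unfolding f_def
    by (intro mult_mono) (auto intro: sum_nonneg)
  also have "\<dots> = exp (2 * (real q)\<^sup>2 * u)"
    by (simp add: exp_add[symmetric])
  finally show ?thesis .
qed

text \<open>By \<open>small\<close>, each linked index weighs at most \<open>u\<^sup>2 / 2\<close>.
  The additional 1/2 is spent in \<open>riesz_nonneg\<close>, where a missing factor is only known
  to be at least 1/2. By \<open>u_q\<close>, the weights \<open>u\<^sup>2\<close> of all patterns,
  the trivial one included, add up to at most 2.\<close>

locale riesz_bounds = coincidence_bounds +
  fixes \<rho> u :: real
  assumes \<rho>: "0 \<le> \<rho>" and u: "0 \<le> u" "u \<le> 1" and small: "2 * \<rho> * (\<kappa> ^ 15 * z) \<le> u\<^sup>2"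
    and u_q: "exp (2 * (real q)\<^sup>2 * u) \<le> 2"
begin

abbreviation block :: "nat \<Rightarrow> real"
  where "block t \<equiv> \<Sum>a\<le>n. \<Sum>b\<le>n. F t a b"

lemma abs_pattern_sum_le:
  assumes "\<phi> \<in> parent_maps q" "\<psi> \<in> parent_maps q"
  shows "\<bar>pattern_sum \<rho> F q n \<phi> \<psi>\<bar> \<le>
    (u\<^sup>2 / 2) ^ card (linked q \<phi> \<psi>) * (\<Prod>t\<in>{..<q} - linked q \<phi> \<psi>. \<bar>1 + \<rho> * block t\<bar>)"
proof -
  have "\<bar>\<rho> ^ card (linked q \<phi> \<psi>) * coincidence_sum n F (linked q \<phi> \<psi>) (ancestor \<phi>) (ancestor \<psi>)\<bar> \<le>
      \<rho> ^ card (linked q \<phi> \<psi>) * (\<kappa> ^ 15 * z) ^ card (linked q \<phi> \<psi>)"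
    unfolding abs_mult using \<rho> coincidence_sum_bound[OF linked_subset linked_ancestor[OF assms]]
    by (intro mult_mono) auto
  also have "\<dots> = (\<rho> * (\<kappa> ^ 15 * z)) ^ card (linked q \<phi> \<psi>)"
    by (simp add: power_mult_distrib)
  also have "\<dots> \<le> (u\<^sup>2 / 2) ^ card (linked q \<phi> \<psi>)"
    using small \<rho> \<kappa> z by (intro power_mono mult_nonneg_nonneg) auto
  finally have "\<bar>\<rho> ^ card (linked q \<phi> \<psi>) * coincidence_sum n F (linked q \<phi> \<psi>) (ancestor \<phi>) (ancestor \<psi>)\<bar> *
      (\<Prod>t\<in>{..<q} - linked q \<phi> \<psi>. \<bar>1 + \<rho> * block t\<bar>) \<le>
    (u\<^sup>2 / 2) ^ card (linked q \<phi> \<psi>) * (\<Prod>t\<in>{..<q} - linked q \<phi> \<psi>. \<bar>1 + \<rho> * block t\<bar>)"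
    by (intro mult_right_mono prod_nonneg) auto
  then show ?thesis
    by (simp add: pattern_sum_eq[OF assms] abs_mult abs_pattern_sign abs_prod)
qed

lemma abs_riesz_le:
  "\<bar>riesz \<rho> F q n\<bar> \<le> (\<Sum>\<phi>\<in>parent_maps q. \<Sum>\<psi>\<in>parent_maps q.
    (u\<^sup>2) ^ card (linked q \<phi> \<psi>) * (\<Prod>t\<in>{..<q} - linked q \<phi> \<psi>. \<bar>1 + \<rho> * block t\<bar>))"
  unfolding riesz_eq_pattern_sums
proof (intro order_trans[OF sum_abs] sum_mono)
  fix \<phi> \<psi> assume *: "\<phi> \<in> parent_maps q" "\<psi> \<in> parent_maps q"
  have "(u\<^sup>2 / 2) ^ card (linked q \<phi> \<psi>) \<le> (u\<^sup>2) ^ card (linked q \<phi> \<psi>)"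
    by (intro power_mono) auto
  then show "\<bar>pattern_sum \<rho> F q n \<phi> \<psi>\<bar> \<le>
      (u\<^sup>2) ^ card (linked q \<phi> \<psi>) * (\<Prod>t\<in>{..<q} - linked q \<phi> \<psi>. \<bar>1 + \<rho> * block t\<bar>)"
    by (intro order_trans[OF abs_pattern_sum_le[OF *]] mult_right_mono prod_nonneg) auto
qed

text \<open>The pair of identity maps contributes the full product \<open>P\<close>. Any other
  pattern lacks the factors over its linked set; putting them back costs 2 for each index, which the
  bound \<open>u\<^sup>2 / 2\<close> pays. All nontrivial patterns together are then at most
  \<open>P\<close> in absolute value.\<close>

lemma riesz_nonneg:
  assumes half: "\<And>t. t < q \<Longrightarrow> \<bar>\<rho> * block t\<bar> \<le> 1 / 2"
  shows "0 \<le> riesz \<rho> F q n"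
proof -
  define P where "P = (\<Prod>t<q. 1 + \<rho> * block t)"
  define i where "i = (\<lambda>t\<in>{..<q}. t)"
  have factor: "1 / 2 \<le> 1 + \<rho> * block t" if "t < q" for t
    using half[OF that] by (auto simp: abs_if split: if_splits)
  have P: "0 \<le> P"
    unfolding P_def using factor by (intro prod_nonneg) (auto intro: order_trans[of 0 "1 / 2"])
  have i: "i \<in> parent_maps q"
    by (auto simp: i_def parent_maps_def)
  have "linked q i i = {}"
    by (auto simp: linked_def i_def)
  then have ii: "pattern_sum \<rho> F q n i i = P"
    using pattern_sum_eq[OF i i, of \<rho> F n] by (simp add: P_def pattern_sign_def coincidence_sum_def)
  have le: "\<bar>pattern_sum \<rho> F q n \<phi> \<psi>\<bar> \<le> (u\<^sup>2) ^ card (linked q \<phi> \<psi>) * P"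
    if "\<phi> \<in> parent_maps q" "\<psi> \<in> parent_maps q" for \<phi> \<psi>
  proof -
    let ?V = "linked q \<phi> \<psi>"
    have V: "?V \<subseteq> {..<q}" by (rule linked_subset)
    have "(1 / 2) ^ card ?V = (\<Prod>t\<in>?V. 1 / 2 :: real)"
      by simp
    also have "\<dots> \<le> (\<Prod>t\<in>?V. 1 + \<rho> * block t)"
      using factor V by (intro prod_mono) auto
    finally have half: "(1 / 2) ^ card ?V \<le> (\<Prod>t\<in>?V. 1 + \<rho> * block t)" .
    have nn: "0 \<le> (\<Prod>t\<in>{..<q} - ?V. 1 + \<rho> * block t)"
      using factor by (intro prod_nonneg) (auto intro: order_trans[of 0 "1 / 2"])
    have "(\<Prod>t\<in>{..<q} - ?V. \<bar>1 + \<rho> * block t\<bar>) = (\<Prod>t\<in>{..<q} - ?V. 1 + \<rho> * block t)"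
      using nn by (simp add: abs_prod[symmetric])
    then have "\<bar>pattern_sum \<rho> F q n \<phi> \<psi>\<bar> \<le> (u\<^sup>2 / 2) ^ card ?V * (\<Prod>t\<in>{..<q} - ?V. 1 + \<rho> * block t)"
      using abs_pattern_sum_le[OF that] by simp
    also have "\<dots> = (u\<^sup>2) ^ card ?V * ((1 / 2) ^ card ?V * (\<Prod>t\<in>{..<q} - ?V. 1 + \<rho> * block t))"
      by (simp add: power_divide)
    also have "\<dots> \<le> (u\<^sup>2) ^ card ?V * ((\<Prod>t\<in>?V. 1 + \<rho> * block t) * (\<Prod>t\<in>{..<q} - ?V. 1 + \<rho> * block t))"
      using half nn by (intro mult_left_mono mult_right_mono) auto
    also have "(\<Prod>t\<in>?V. 1 + \<rho> * block t) * (\<Prod>t\<in>{..<q} - ?V. 1 + \<rho> * block t) = P"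
      unfolding P_def by (subst prod.subset_diff[OF V]) (auto simp: mult.commute)
    finally show ?thesis .
  qed
  define G where "G = parent_maps q \<times> parent_maps q"
  have G: "finite G" "(i, i) \<in> G"
    using i by (auto simp: G_def finite_parent_maps)
  have "riesz \<rho> F q n = (\<Sum>p\<in>G. pattern_sum \<rho> F q n (fst p) (snd p))"
    by (simp add: riesz_eq_pattern_sums G_def sum.cartesian_product case_prod_beta)
  also have "\<dots> = P + (\<Sum>p\<in>G - {(i, i)}. pattern_sum \<rho> F q n (fst p) (snd p))"
    using sum.remove[OF G, of "\<lambda>p. pattern_sum \<rho> F q n (fst p) (snd p)"] ii by simp
  also have "\<dots> \<ge> P - (\<Sum>p\<in>G - {(i, i)}. (u\<^sup>2) ^ card (linked q (fst p) (snd p)) * P)"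
  proof -
    have "- (\<Sum>p\<in>G - {(i, i)}. pattern_sum \<rho> F q n (fst p) (snd p)) \<le> (\<Sum>p\<in>G - {(i, i)}. (u\<^sup>2) ^ card (linked q (fst p) (snd p)) * P)"
      unfolding sum_negf[symmetric]
    proof (rule sum_mono)
      fix p assume "p \<in> G - {(i, i)}"
      then show "- pattern_sum \<rho> F q n (fst p) (snd p) \<le> (u\<^sup>2) ^ card (linked q (fst p) (snd p)) * P"
        using le[of "fst p" "snd p"] by (auto simp: G_def)
    qed
    then show ?thesis by simp
  qed
  finally have "P - (\<Sum>p\<in>G - {(i, i)}. (u\<^sup>2) ^ card (linked q (fst p) (snd p))) * P \<le> riesz \<rho> F q n"
    by (simp add: sum_distrib_right)
  moreover have "(\<Sum>p\<in>G. (u\<^sup>2) ^ card (linked q (fst p) (snd p))) \<le> 2"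
    using order_trans[OF sum_linked_le[OF u] u_q] by (simp add: G_def sum.cartesian_product case_prod_beta)
  then have "(\<Sum>p\<in>G - {(i, i)}. (u\<^sup>2) ^ card (linked q (fst p) (snd p))) \<le> 1"
    using sum.remove[OF G, of "\<lambda>p. (u\<^sup>2) ^ card (linked q (fst p) (snd p))"] \<open>linked q i i = {}\<close> by simp
  then have "(\<Sum>p\<in>G - {(i, i)}. (u\<^sup>2) ^ card (linked q (fst p) (snd p))) * P \<le> 1 * P"
    by (intro mult_right_mono P)
  ultimately show ?thesis by simp
qed

end

text \<open>Absolute values throughout: this serves the set where the tail estimates fail, whose
  measure outweighs even this bound.\<close>

lemma abs_riesz_le_crude:
  assumes F: "\<And>t a b. t < q \<Longrightarrow> \<bar>F t a b\<bar> \<le> 1" and \<rho>: "0 \<le> \<rho>"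
  shows "\<bar>riesz \<rho> F q n\<bar> \<le> (1 + \<rho> * (real (n + 1))\<^sup>2) ^ q"
proof -
  have "\<bar>riesz \<rho> F q n\<bar> \<le> (\<Sum>r\<in>PiE {..<q} (\<lambda>_. slots n). \<Prod>t<q. weight \<rho> (\<lambda>t a b. 1) t (r t))"
    unfolding riesz_def
  proof (intro order_trans[OF sum_abs] sum_mono)
    fix r assume "r \<in> PiE {..<q} (\<lambda>_. slots n)"
    have "\<bar>of_bool (strongly_distinct q r) * (\<Prod>t<q. weight \<rho> F t (r t))\<bar> \<le> (\<Prod>t<q. \<bar>weight \<rho> F t (r t)\<bar>)"
      by (simp add: abs_mult abs_prod prod_nonneg)
    also have "\<dots> \<le> (\<Prod>t<q. weight \<rho> (\<lambda>t a b. 1) t (r t))"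
    proof (rule prod_mono)
      fix t assume "t \<in> {..<q}"
      then show "0 \<le> \<bar>weight \<rho> F t (r t)\<bar> \<and> \<bar>weight \<rho> F t (r t)\<bar> \<le> weight \<rho> (\<lambda>t a b. 1) t (r t)"
        using F[of t] \<rho> by (auto simp: weight_def abs_mult mult_left_le split: option.splits)
    qed
    finally show "\<bar>of_bool (strongly_distinct q r) * (\<Prod>t<q. weight \<rho> F t (r t))\<bar> \<le> (\<Prod>t<q. weight \<rho> (\<lambda>t a b. 1) t (r t))" .
  qed
  also have "\<dots> = (\<Prod>t<q. \<Sum>v\<in>slots n. weight \<rho> (\<lambda>t a b. 1) t v)"
    by (rule prod_sum_PiE[symmetric]) auto
  also have "\<dots> = (1 + \<rho> * (real (n + 1))\<^sup>2) ^ q"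
    by (simp add: sum_weight power2_eq_square)
  finally show ?thesis .
qed

section \<open>Families of functions on hyperbolic frequencies\<close>

text \<open>The abstract form of the Haar sums: a function is reversed by the digit at its own
  frequency and unaffected by finer digits, in each coordinate. The estimates of sums over
  coincident frequencies use no more than this, so neither boxes nor points appear in them.\<close>

locale hyperbolic = finite_space \<Omega> for \<Omega> :: "'x set" +
  fixes n q w :: nat and f :: "nat \<Rightarrow> nat \<Rightarrow> nat \<Rightarrow> 'x \<Rightarrow> real" and \<tau>1 \<tau>2 \<tau>3 :: "nat \<Rightarrow> 'x \<Rightarrow> 'x"
  assumes invol: "k \<le> n \<Longrightarrow> involution (\<tau>1 k)" "k \<le> n \<Longrightarrow> involution (\<tau>2 k)" "k \<le> n \<Longrightarrow> involution (\<tau>3 k)"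
    and f_abs: "x \<in> \<Omega> \<Longrightarrow> \<bar>f m a b x\<bar> \<le> 1"
    and f_flip: "x \<in> \<Omega> \<Longrightarrow> m + a + b = n \<Longrightarrow> f m a b (\<tau>1 m x) = - f m a b x"
      "x \<in> \<Omega> \<Longrightarrow> m + a + b = n \<Longrightarrow> f m a b (\<tau>2 a x) = - f m a b x"
      "x \<in> \<Omega> \<Longrightarrow> m + a + b = n \<Longrightarrow> f m a b (\<tau>3 b x) = - f m a b x"
    and f_inv: "x \<in> \<Omega> \<Longrightarrow> m + a + b = n \<Longrightarrow> m < k \<Longrightarrow> k \<le> n \<Longrightarrow> f m a b (\<tau>1 k x) = f m a b x"
      "x \<in> \<Omega> \<Longrightarrow> m + a + b = n \<Longrightarrow> a < k \<Longrightarrow> k \<le> n \<Longrightarrow> f m a b (\<tau>2 k x) = f m a b x"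
      "x \<in> \<Omega> \<Longrightarrow> m + a + b = n \<Longrightarrow> b < k \<Longrightarrow> k \<le> n \<Longrightarrow> f m a b (\<tau>3 k x) = f m a b x"
    and blocks: "q * w \<le> n"
begin

definition blk :: "nat \<Rightarrow> nat set"
  where "blk t = {t * w..<t * w + w}"

definition F :: "'x \<Rightarrow> nat \<Rightarrow> nat \<Rightarrow> nat \<Rightarrow> real"
  where "F x t a b = (if a + b \<le> n \<and> n - a - b \<in> blk t then f (n - a - b) a b x else 0)"

text \<open>Exchanging the second and third coordinates yields the mirror image of each estimate
  proved for one of them.\<close>

lemma swap: "hyperbolic \<Omega> n q w (\<lambda>m a b. f m b a) \<tau>1 \<tau>3 \<tau>2"
  by unfold_locales (auto simp: invol f_abs f_flip f_inv add_ac blocks)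

lemma blk_less: "m \<in> blk s \<Longrightarrow> m' \<in> blk t \<Longrightarrow> s < t \<Longrightarrow> m < m'"
proof -
  assume "m \<in> blk s" "m' \<in> blk t" "s < t"
  moreover have "(s + 1) * w \<le> t * w"
    using \<open>s < t\<close> by (intro mult_right_mono) auto
  ultimately show ?thesis
    by (auto simp: blk_def)
qed

lemma blk_disjoint: "s \<noteq> t \<Longrightarrow> blk s \<inter> blk t = {}"
  using blk_less by (metis disjoint_iff less_irrefl nat_neq_iff)

lemma blk_le: "t < q \<Longrightarrow> blk t \<subseteq> {..<n}"
proof -
  assume "t < q"
  then have "(t + 1) * w \<le> q * w"
    by (intro mult_right_mono) auto
  then show ?thesis
    using blocks by (auto simp: blk_def)
qed

lemma F_abs: "x \<in> \<Omega> \<Longrightarrow> \<bar>F x t a b\<bar> \<le> 1"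
  by (simp add: F_def f_abs)

lemma F_inv1:
  assumes "x \<in> \<Omega>" "k \<le> n" "a + b \<le> n \<Longrightarrow> n - a - b \<in> blk t \<Longrightarrow> n - a - b < k"
  shows "F (\<tau>1 k x) t a b = F x t a b"
  using assms by (auto simp: F_def intro!: f_inv)

lemma F_flip1:
  assumes "x \<in> \<Omega>" "a + b \<le> n"
  shows "F (\<tau>1 (n - a - b) x) t a b = - F x t a b"
  using assms by (auto simp: F_def intro!: f_flip)

text \<open>Here the third frequency \<open>b\<close> is the common one, and the first and second
  are free. In \<open>adapted3\<close> below the common frequency is the first, which is the
  situation inside a layer.\<close>

lemma adapted1: "adapted \<tau>1 \<tau>2 n (\<lambda>b a x. F x t a b)"
  unfolding adapted_def
  by (auto simp: invol F_abs F_def f_abs intro!: f_flip f_inv)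
     (simp_all add: diff_commute add.commute f_flip f_inv)

lemma adapted3: "adapted \<tau>3 \<tau>2 n (\<lambda>m a x. if m + a \<le> n then F x t a (n - m - a) else 0)"
  unfolding adapted_def
  by (auto simp: invol F_abs F_def f_abs intro!: f_flip f_inv)

text \<open>All functions with first frequency \<open>m\<close>. They are reversed together by one
  digit of the first coordinate, so a whole block becomes a sign martingale of layers.\<close>

definition layer :: "nat \<Rightarrow> 'x \<Rightarrow> real"
  where "layer m x = (\<Sum>a\<le>n - m. f m a (n - m - a) x)"

lemma block_eq_layers:
  assumes "t < q"
  shows "(\<Sum>a\<le>n. \<Sum>b\<le>n. F x t a b) = (\<Sum>m\<in>blk t. layer m x)"
proof -
  have "(\<Sum>m\<in>blk t. layer m x) = (\<Sum>p\<in>Sigma (blk t) (\<lambda>m. {..n - m}). f (fst p) (snd p) (n - fst p - snd p) x)"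
    unfolding layer_def by (subst sum.Sigma) (auto simp: blk_def case_prod_beta)
  also have "\<dots> = (\<Sum>p\<in>{p \<in> {..n} \<times> {..n}. fst p + snd p \<le> n \<and> n - fst p - snd p \<in> blk t}. F x t (fst p) (snd p))"
    by (rule sum.reindex_bij_witness[where j = "\<lambda>p. (snd p, n - fst p - snd p)" and i = "\<lambda>p. (n - fst p - snd p, fst p)"])
      (use blk_le[OF assms] in \<open>auto simp: F_def subset_eq\<close>)
  also have "\<dots> = (\<Sum>p\<in>{..n} \<times> {..n}. F x t (fst p) (snd p))"
    by (intro sum.mono_neutral_left) (auto simp: F_def)
  finally show ?thesis
    by (simp add: sum.cartesian_product case_prod_beta)
qed

section \<open>Tail bounds for lines, planes, pairs of blocks and layers\<close>

lemma layer_martingale: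
  assumes "I \<subseteq> {..n}"
  shows "sign_martingale \<tau>1 I (\<lambda>m. m) layer"
  unfolding sign_martingale_def
proof (intro conjI ballI impI)
  show "finite I" using assms finite_subset by blast
  fix m x assume m: "m \<in> I" and x: "x \<in> \<Omega>"
  then show "layer m (\<tau>1 m x) = - layer m x"
    using assms unfolding layer_def sum_negf[symmetric] by (intro sum.cong f_flip) auto
  fix j assume "j \<in> I" "j < m"
  then show "layer j (\<tau>1 m x) = layer j x"
    using assms m x unfolding layer_def by (intro sum.cong f_inv) auto
qed (use assms in \<open>auto simp: invol\<close>)

text \<open>Blocks are ordered by first frequency, so the factor with the largest index
  \<open>T\<close> has the largest one. Flipping the digit \<open>n - a - b T\<close> of the first
  coordinate reverses that factor and fixes those of lower index, for every second frequency; for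
  fixed \<open>b T\<close> this key is injective in \<open>a\<close>.\<close>

lemma whp_line1:
  assumes z: "0 \<le> z" and U: "U \<subseteq> {..<q}" "U \<noteq> {}"
  shows "whp (2 * exp (- z\<^sup>2)) (\<lambda>x. \<bar>\<Sum>a\<le>n. \<Prod>t\<in>U. F x t a (b t)\<bar> \<le> z * sqrt (2 * real (n + 1)))"
proof -
  have fin: "finite U" using U finite_subset by blast
  define T where "T = Max U"
  have T: "T \<in> U" "\<And>t. t \<in> U \<Longrightarrow> t \<noteq> T \<Longrightarrow> t < T"
    using fin U by (auto simp: T_def intro: le_neq_implies_less)
  define I where "I = {a. a + b T \<le> n \<and> n - a - b T \<in> blk T}"
  have I: "I \<subseteq> {..n}" by (auto simp: I_def)
  have split: "(\<Prod>t\<in>U. F x t a (b t)) = F x T a (b T) * (\<Prod>t\<in>U - {T}. F x t a (b t))" for x a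
    by (rule prod.remove[OF fin T(1)])
  have lower: "F (\<tau>1 k x) t a' (b t) = F x t a' (b t)"
    if "x \<in> \<Omega>" "t \<in> U - {T}" "a \<in> I" "k = n - a - b T" for x t a a' k
    using that T(2) by (intro F_inv1) (auto simp: I_def intro: blk_less)
  have "sign_martingale \<tau>1 I (\<lambda>a. n - a - b T) (\<lambda>a x. \<Prod>t\<in>U. F x t a (b t))"
    unfolding sign_martingale_def
  proof (intro conjI ballI impI)
    show "finite I" using I finite_subset by blast
    show "inj_on (\<lambda>a. n - a - b T) I" by (auto simp: inj_on_def I_def)
    fix a x assume a: "a \<in> I" and x: "x \<in> \<Omega>"
    then show "(\<Prod>t\<in>U. F (\<tau>1 (n - a - b T) x) t a (b t)) = - (\<Prod>t\<in>U. F x t a (b t))"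
      unfolding split by (simp add: lower F_flip1 I_def del: diff_diff_left)
    fix a' assume a': "a' \<in> I" "n - a' - b T < n - a - b T"
    then have "F (\<tau>1 (n - a - b T) x) T a' (b T) = F x T a' (b T)"
      by (intro F_inv1 x) auto
    then show "(\<Prod>t\<in>U. F (\<tau>1 (n - a - b T) x) t a' (b t)) = (\<Prod>t\<in>U. F x t a' (b t))"
      unfolding split using a x by (simp add: lower)
  qed (auto simp: invol)
  moreover have "card I \<le> n + 1"
    using card_mono[OF _ I] by simp
  moreover have "\<bar>\<Prod>t\<in>U. F x t a (b t)\<bar> \<le> 1" if "x \<in> \<Omega>" for x a
    unfolding abs_prod using F_abs[OF that] by (intro prod_le_1) auto
  ultimately have "whp (2 * exp (- z\<^sup>2)) (\<lambda>x. \<bar>\<Sum>a\<in>I. \<Prod>t\<in>U. F x t a (b t)\<bar> \<le> 1 * (z * sqrt (2 * real (n + 1))))"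
    by (intro whp_sum_unit_martingale z) auto
  moreover have "(\<Sum>a\<in>I. \<Prod>t\<in>U. F x t a (b t)) = (\<Sum>a\<le>n. \<Prod>t\<in>U. F x t a (b t))" for x
  proof (rule sum.mono_neutral_left)
    have "F x T a (b T) = 0" if "a \<notin> I" for a
      using that by (auto simp: F_def I_def)
    then show "\<forall>a\<in>{..n} - I. (\<Prod>t\<in>U. F x t a (b t)) = 0"
      by (simp add: split)
  qed (use I in auto)
  ultimately show ?thesis by simp
qed

text \<open>A union bound over at most \<open>2 ^ q\<close> index sets and
  \<open>(n + 1) ^ q\<close> frequency choices. This is one reason why \<open>z\<^sup>2\<close> has
  to dominate \<open>q\<close> times the logarithm of \<open>n\<close>.\<close>

lemma whp_lines1:
  assumes z: "0 \<le> z"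
  shows "whp ((2 * real (n + 1)) ^ q * (2 * exp (- z\<^sup>2)))
    (\<lambda>x. \<forall>U b. U \<subseteq> {..<q} \<longrightarrow> U \<noteq> {} \<longrightarrow> (\<forall>t\<in>U. b t \<le> n) \<longrightarrow>
      \<bar>\<Sum>a\<le>n. \<Prod>t\<in>U. F x t a (b t)\<bar> \<le> z * sqrt (2 * real (n + 1)))"
proof -
  define J where "J = Sigma (Pow {..<q} - {{}}) (\<lambda>U. PiE U (\<lambda>_. {..n}))"
  have finU: "finite U" if "U \<in> Pow {..<q} - {{}}" for U
    using that finite_subset[of U "{..<q}"] by auto
  have "card J = (\<Sum>U\<in>Pow {..<q} - {{}}. card (PiE U (\<lambda>_. {..n})))"
    unfolding J_def using finU by (intro card_SigmaI ballI finite_PiE) auto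
  also have "\<dots> = (\<Sum>U\<in>Pow {..<q} - {{}}. (n + 1) ^ card U)"
    using finU by (intro sum.cong) (auto simp: card_PiE)
  also have "\<dots> \<le> (\<Sum>U\<in>Pow {..<q} - {{}}. (n + 1) ^ q)"
  proof (intro sum_mono power_increasing)
    fix U assume "U \<in> Pow {..<q} - {{}}"
    then show "card U \<le> q"
      using card_mono[of "{..<q}" U] by simp
  qed simp
  also have "\<dots> \<le> 2 ^ q * (n + 1) ^ q"
    by (simp add: card_Diff_subset card_Pow)
  finally have "real (card J) \<le> real (2 ^ q * (n + 1) ^ q)"
    by (simp only: of_nat_le_iff)
  then have J: "real (card J) * (2 * exp (- z\<^sup>2)) \<le> (2 * real (n + 1)) ^ q * (2 * exp (- z\<^sup>2))"
    unfolding power_mult_distrib of_nat_mult of_nat_power of_nat_numeral by (intro mult_right_mono) auto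
  have "whp (real (card J) * (2 * exp (- z\<^sup>2)))
     (\<lambda>x. \<forall>p\<in>J. \<bar>\<Sum>a\<le>n. \<Prod>t\<in>fst p. F x t a (snd p t)\<bar> \<le> z * sqrt (2 * real (n + 1)))"
  proof (rule whp_ball)
    show "finite J" unfolding J_def using finU by (intro finite_SigmaI finite_PiE) auto
    fix p assume "p \<in> J"
    then show "whp (2 * exp (- z\<^sup>2)) (\<lambda>x. \<bar>\<Sum>a\<le>n. \<Prod>t\<in>fst p. F x t a (snd p t)\<bar> \<le> z * sqrt (2 * real (n + 1)))"
      by (intro whp_line1[OF z]) (auto simp: J_def)
  qed
  then show ?thesis
  proof (rule whp_mono[OF _ _ J], intro allI impI)
    fix x U b assume *: "\<forall>p\<in>J. \<bar>\<Sum>a\<le>n. \<Prod>t\<in>fst p. F x t a (snd p t)\<bar> \<le> z * sqrt (2 * real (n + 1))"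
      and U: "U \<subseteq> {..<q}" "U \<noteq> {}" "\<forall>t\<in>U. b t \<le> n"
    then have "(U, restrict b U) \<in> J"
      by (auto simp: J_def)
    from bspec[OF * this] show "\<bar>\<Sum>a\<le>n. \<Prod>t\<in>U. F x t a (b t)\<bar> \<le> z * sqrt (2 * real (n + 1))"
      by simp
  qed
qed

text \<open>If \<open>t\<close> is the higher block, a nonzero term with common \<open>b\<close> has
  \<open>n - a - b > n - a' - b\<close>, hence \<open>a < a'\<close>, and the sum is the one in
  \<open>inner_sum\<close>. If \<open>s\<close> is higher, the digit \<open>n - a' - b\<close> of
  the first coordinate reverses \<open>F x s a' b\<close> and fixes all of block \<open>t\<close>: a
  sign martingale in \<open>b\<close> whose weights are line sums.\<close>

lemma whp_plane:
  assumes z: "0 \<le> z" and S: "S = z * sqrt (2 * real (n + 1))" "1 \<le> S"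
    and T: "z * sqrt (4 * (real (n + 1))\<^sup>2 * S) \<le> T" "S\<^sup>2 \<le> T"
    and st: "s < q" "t < q" "s \<noteq> t" and a': "a' \<le> n"
  shows "whp (real ((n + 2) ^ 3) * (2 * exp (- z\<^sup>2))) (\<lambda>x. \<bar>\<Sum>b\<le>n. \<Sum>a\<le>n. F x t a b * F x s a' b\<bar> \<le> T)"
proof (cases "s < t")
  case True
  have eq: "(\<Sum>b\<le>n. \<Sum>a<a'. F x t a b * F x s a' b) = (\<Sum>b\<le>n. \<Sum>a\<le>n. F x t a b * F x s a' b)" for x
  proof (rule sum.cong[OF refl], rule sum.mono_neutral_left)
    fix b
    show "\<forall>a\<in>{..n} - {..<a'}. F x t a b * F x s a' b = 0"
    proof
      fix a assume a: "a \<in> {..n} - {..<a'}"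
      show "F x t a b * F x s a' b = 0"
      proof (rule ccontr)
        assume "F x t a b * F x s a' b \<noteq> 0"
        then have "n - a - b \<in> blk t" "n - a' - b \<in> blk s"
          by (auto simp: F_def split: if_splits)
        from blk_less[OF this(2,1) True] a show False by auto
      qed
    qed
  qed (use a' in auto)
  have "real ((n + 1)\<^sup>2 + 1) * (2 * exp (- z\<^sup>2)) \<le> real ((n + 2) ^ 3) * (2 * exp (- z\<^sup>2))"
    by (intro mult_right_mono) (auto simp: power2_eq_square power3_eq_cube algebra_simps)
  then show ?thesis
    by (rule whp_mono[OF inner_sum[OF adapted1[of t] adapted1[of s] z S, of a'], rotated]) (use T eq in auto)
next
  case False
  then have ts: "t < s" using st by auto
  define I where "I = {b. a' + b \<le> n \<and> n - a' - b \<in> blk s}"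
  have I: "I \<subseteq> {..n}" by (auto simp: I_def)
  then have finI: "finite I" using finite_subset by blast
  define Z where "Z b x = F x s a' b * (\<Sum>a\<le>n. F x t a b)" for b x
  have lower: "F (\<tau>1 (n - a' - b) x) t a b' = F x t a b'" if "x \<in> \<Omega>" "b \<in> I" for x a b b'
    using that ts by (intro F_inv1) (auto simp: I_def intro: blk_less)
  have mart: "sign_martingale \<tau>1 I (\<lambda>b. n - a' - b) Z"
    unfolding sign_martingale_def
  proof (intro conjI ballI impI finI)
    show "inj_on (\<lambda>b. n - a' - b) I" by (auto simp: inj_on_def I_def)
    fix b x assume b: "b \<in> I" and x: "x \<in> \<Omega>"
    then show "Z b (\<tau>1 (n - a' - b) x) = - Z b x"
      by (simp add: Z_def lower F_flip1 I_def del: diff_diff_left)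
    fix b' assume "b' \<in> I" "n - a' - b' < n - a' - b"
    then have "F (\<tau>1 (n - a' - b) x) s a' b' = F x s a' b'"
      by (intro F_inv1 x) auto
    then show "Z b' (\<tau>1 (n - a' - b) x) = Z b' x"
      using b x by (simp add: Z_def lower del: diff_diff_left)
  qed (auto simp: invol)
  have "whp (2 * exp (- z\<^sup>2)) (\<lambda>x. \<bar>\<Sum>a\<le>n. F x t a b\<bar> \<le> S)" for b
    using whp_line1[OF z, of "{t}" "\<lambda>_. b"] st S(1) by simp
  then have "whp (real (card {..n}) * (2 * exp (- z\<^sup>2))) (\<lambda>x. \<forall>b\<in>{..n}. \<bar>\<Sum>a\<le>n. F x t a b\<bar> \<le> S)"
    by (intro whp_ball) auto
  then have "whp (real (card {..n}) * (2 * exp (- z\<^sup>2))) (\<lambda>x. (\<Sum>b\<in>I. (Z b x)\<^sup>2) \<le> real (n + 1) * S\<^sup>2)"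
  proof (rule whp_mono)
    fix x assume x: "x \<in> \<Omega>" and *: "\<forall>b\<in>{..n}. \<bar>\<Sum>a\<le>n. F x t a b\<bar> \<le> S"
    have "(\<Sum>b\<in>I. (Z b x)\<^sup>2) \<le> (\<Sum>b\<in>I. S\<^sup>2)"
    proof (rule sum_mono)
      fix b assume "b \<in> I"
      then have "\<bar>F x s a' b\<bar> * \<bar>\<Sum>a\<le>n. F x t a b\<bar> \<le> 1 * S"
        using I * F_abs[OF x] by (intro mult_mono) auto
      then have "\<bar>Z b x\<bar> \<le> S"
        by (simp add: Z_def abs_mult)
      then show "(Z b x)\<^sup>2 \<le> S\<^sup>2"
        using S(2) by (simp add: abs_le_square_iff[symmetric])
    qed
    also have "\<dots> \<le> real (n + 1) * S\<^sup>2"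
      using card_mono[OF _ I] by (simp add: mult_right_mono)
    finally show "(\<Sum>b\<in>I. (Z b x)\<^sup>2) \<le> real (n + 1) * S\<^sup>2" .
  qed simp
  moreover have "0 < real (n + 1) * S\<^sup>2"
    using S(2) by (intro mult_pos_pos) auto
  ultimately have w: "whp (real (card {..n}) * (2 * exp (- z\<^sup>2)) + 2 * exp (- z\<^sup>2))
      (\<lambda>x. \<bar>\<Sum>b\<in>I. Z b x\<bar> \<le> z * sqrt (2 * (real (n + 1) * S\<^sup>2)))"
    by (intro whp_sign_martingale[OF mart _ z])
  have "z * sqrt (2 * (real (n + 1) * S\<^sup>2)) = S\<^sup>2"
  proof -
    have "sqrt (2 * (real (n + 1) * S\<^sup>2)) = sqrt (2 * real (n + 1)) * sqrt (S\<^sup>2)"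
      by (simp only: real_sqrt_mult mult.assoc)
    moreover have "sqrt (S\<^sup>2) = S" using S(2) by simp
    ultimately have "z * sqrt (2 * (real (n + 1) * S\<^sup>2)) = (z * sqrt (2 * real (n + 1))) * S"
      by simp
    then show ?thesis by (simp only: S(1)[symmetric] power2_eq_square)
  qed
  moreover have "(\<Sum>b\<in>I. Z b x) = (\<Sum>b\<le>n. \<Sum>a\<le>n. F x t a b * F x s a' b)" for x
  proof -
    have "(\<Sum>b\<in>I. Z b x) = (\<Sum>b\<le>n. Z b x)"
      by (intro sum.mono_neutral_left) (use I in \<open>auto simp: Z_def F_def I_def\<close>)
    then show ?thesis by (simp add: Z_def sum_distrib_left mult.commute)
  qed
  moreover have "real (card {..n}) * (2 * exp (- z\<^sup>2)) + 2 * exp (- z\<^sup>2) \<le> real ((n + 2) ^ 3) * (2 * exp (- z\<^sup>2))"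
  proof -
    have "real (card {..n}) * (2 * exp (- z\<^sup>2)) + 2 * exp (- z\<^sup>2) = real (n + 2) * (2 * exp (- z\<^sup>2))"
      by (simp add: algebra_simps)
    also have "\<dots> \<le> real ((n + 2) ^ 3) * (2 * exp (- z\<^sup>2))"
      by (intro mult_right_mono) (auto simp: power3_eq_cube algebra_simps)
    finally show ?thesis .
  qed
  ultimately show ?thesis
    using T(2) by (intro whp_mono[OF w]) auto
qed

text \<open>For \<open>t < s\<close> and a common \<open>b\<close>, the order of the blocks forces
  \<open>a < a'\<close> on nonzero terms. This is precisely the restriction \<open>w < v\<close> in
  \<open>beck_sum\<close>; the other order follows by symmetry.\<close>

lemma whp_beck2:
  assumes z: "0 \<le> z" and S: "S = z * sqrt (2 * real (n + 1))" "1 \<le> S"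
    and T: "T = z * sqrt (4 * (real (n + 1))\<^sup>2 * S)" "0 < T"
    and st: "s \<noteq> t"
  shows "whp (real ((n + 2) ^ 3) * (2 * exp (- z\<^sup>2)))
    (\<lambda>x. \<bar>\<Sum>b\<le>n. \<Sum>a\<le>n. \<Sum>a'\<le>n. F x s a b * F x t a' b\<bar> \<le> S * T)"
proof -
  have *: "whp (real ((n + 2) ^ 3) * (2 * exp (- z\<^sup>2)))
    (\<lambda>x. \<bar>\<Sum>b\<le>n. \<Sum>a\<le>n. \<Sum>a'\<le>n. F x s a b * F x t a' b\<bar> \<le> S * T)" if ts: "t < s" for s t
  proof -
    have "(\<Sum>v\<le>n. \<Sum>b\<le>n. \<Sum>a<v. F x s a b * F x t v b) = (\<Sum>b\<le>n. \<Sum>a\<le>n. \<Sum>a'\<le>n. F x s a b * F x t a' b)" for x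
    proof -
      have "(\<Sum>v\<le>n. \<Sum>b\<le>n. \<Sum>a<v. F x s a b * F x t v b) = (\<Sum>v\<le>n. \<Sum>b\<le>n. \<Sum>a\<le>n. F x s a b * F x t v b)"
      proof (rule sum.cong[OF refl], rule sum.cong[OF refl], rule sum.mono_neutral_left)
        fix v b assume "v \<in> {..n}"
        show "\<forall>a\<in>{..n} - {..<v}. F x s a b * F x t v b = 0"
        proof
          fix a assume a: "a \<in> {..n} - {..<v}"
          show "F x s a b * F x t v b = 0"
          proof (rule ccontr)
            assume "F x s a b * F x t v b \<noteq> 0"
            then have "n - a - b \<in> blk s" "n - v - b \<in> blk t"
              by (auto simp: F_def split: if_splits)
            from blk_less[OF this(2,1) ts] a show False by auto
          qed
        qed
      qed auto
      also have "\<dots> = (\<Sum>b\<le>n. \<Sum>v\<le>n. \<Sum>a\<le>n. F x s a b * F x t v b)"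
        by (rule sum.swap)
      also have "\<dots> = (\<Sum>b\<le>n. \<Sum>a\<le>n. \<Sum>v\<le>n. F x s a b * F x t v b)"
        by (intro sum.cong refl sum.swap)
      finally show ?thesis .
    qed
    then show ?thesis
      using beck_sum[OF adapted1[of s] adapted1[of t] z S T] by simp
  qed
  show ?thesis
  proof (cases "t < s")
    case True
    then show ?thesis by (rule *)
  next
    case False
    then have "s < t" using st by simp
    have "(\<Sum>b\<le>n. \<Sum>a\<le>n. \<Sum>a'\<le>n. F x t a b * F x s a' b) = (\<Sum>b\<le>n. \<Sum>a\<le>n. \<Sum>a'\<le>n. F x s a b * F x t a' b)" for x
      by (rule sum.cong[OF refl], subst sum.swap) (simp add: mult.commute)
    then show ?thesis using *[OF \<open>s < t\<close>] by simp
  qed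
qed

text \<open>The diagonal of the squares is bounded by the number of terms. The off-diagonal part is
  twice a sum as in \<open>beck_sum\<close> with the first frequency in common, hence of smaller
  order.\<close>

lemma whp_layer_squares:
  assumes z: "0 \<le> z" and S: "S = z * sqrt (2 * real (n + 1))" "1 \<le> S"
    and T: "T = z * sqrt (4 * (real (n + 1))\<^sup>2 * S)" "0 < T"
    and K: "real (w * (n + 1)) + 2 * S * T \<le> K" and t: "t < q"
  shows "whp (real ((n + 2) ^ 3) * (2 * exp (- z\<^sup>2))) (\<lambda>x. (\<Sum>m\<in>blk t. (layer m x)\<^sup>2) \<le> K)"
proof (rule whp_mono[OF beck_sum[OF adapted3[of t] adapted3[of t] z S T]])
  fix x
  define G where "G m a = (if m + a \<le> n then F x t a (n - m - a) else 0)" for m a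
  assume x: "x \<in> \<Omega>" and *: "\<bar>\<Sum>v\<le>n. \<Sum>c\<le>n. \<Sum>w<v. (if c + w \<le> n then F x t w (n - c - w) else 0) *
      (if c + v \<le> n then F x t v (n - c - v) else 0)\<bar> \<le> S * T"
  then have *: "\<bar>\<Sum>v\<le>n. \<Sum>c\<le>n. \<Sum>w<v. G c w * G c v\<bar> \<le> S * T"
    by (simp add: G_def)
  have layer: "layer m x = (\<Sum>a\<le>n. G m a)" if m: "m \<in> blk t" for m
  proof -
    have "m < n" using blk_le[OF t] m by auto
    then show ?thesis
      unfolding layer_def using m by (intro sum.mono_neutral_cong_left) (auto simp: G_def F_def)
  qed
  have square: "(\<Sum>a\<le>k. g a)\<^sup>2 = (\<Sum>a\<le>k. (g a)\<^sup>2) + 2 * (\<Sum>v\<le>k. \<Sum>w<v. g w * g v)" for g :: "nat \<Rightarrow> real" and k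
    by (induction k) (simp_all add: power2_sum lessThan_Suc_atMost[symmetric] sum_distrib_left sum_distrib_right algebra_simps)
  have zero: "G m a = 0" if "m \<notin> blk t" for m a
    using that by (auto simp: G_def F_def)
  have "(\<Sum>m\<in>blk t. (layer m x)\<^sup>2) = (\<Sum>m\<in>blk t. \<Sum>a\<le>n. (G m a)\<^sup>2) + 2 * (\<Sum>m\<in>blk t. \<Sum>v\<le>n. \<Sum>w<v. G m w * G m v)"
    by (simp add: layer square sum.distrib sum_distrib_left)
  also have "(\<Sum>m\<in>blk t. \<Sum>a\<le>n. (G m a)\<^sup>2) \<le> (\<Sum>m\<in>blk t. \<Sum>a\<le>n. 1)"
    by (intro sum_mono) (simp add: G_def F_abs[OF x] abs_square_le_1)
  also have "\<dots> = real (w * (n + 1))"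
    by (simp add: blk_def algebra_simps)
  also have "(\<Sum>m\<in>blk t. \<Sum>v\<le>n. \<Sum>w<v. G m w * G m v) = (\<Sum>m\<le>n. \<Sum>v\<le>n. \<Sum>w<v. G m w * G m v)"
    by (intro sum.mono_neutral_left) (use blk_le[OF t] zero in auto)
  also have "\<dots> = (\<Sum>v\<le>n. \<Sum>m\<le>n. \<Sum>w<v. G m w * G m v)"
    by (rule sum.swap)
  also have "\<dots> \<le> S * T"
    using * by simp
  finally show "(\<Sum>m\<in>blk t. (layer m x)\<^sup>2) \<le> K"
    using K by simp
qed simp

end

section \<open>The integral of the Riesz product\<close>

text \<open>The bounds of \<open>riesz_bounds\<close> will be applied with \<open>2 * z\<close> in
  place of \<open>z\<close>, which swallows numerical constants such as the root of 2 in
  \<open>S\<close>. In \<open>rare_large\<close> a second moment of the block products competes with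
  the probability that some block is large; in \<open>rare_bad\<close> the crude bound for the Riesz
  product competes with the probability that a tail estimate fails.\<close>

locale hyperbolic_riesz = hyperbolic +
  fixes \<kappa> z \<rho> u K :: real
  assumes \<kappa>: "1 \<le> \<kappa>" "real (n + 1) = \<kappa> ^ 16" and z: "1 \<le> z" "2 * z \<le> \<kappa>\<^sup>2"
    and \<rho>: "0 < \<rho>" and u: "0 \<le> u" "u \<le> 1" "exp (2 * (real q)\<^sup>2 * u) \<le> 2" "4 * \<rho> * (\<kappa> ^ 15 * z) \<le> u\<^sup>2"
    and K: "real (w * (n + 1)) + 8 * z\<^sup>2 * \<kappa> ^ 30 \<le> K"
    and rK: "\<rho>\<^sup>2 * K \<le> 1 / 4"
    and rare_large: "(exp (2 * (\<rho>\<^sup>2 * K)) + exp (1 / 2 - 1 / sqrt (\<rho>\<^sup>2 * K))) ^ q * (2 * real q * exp (- (1 / (8 * \<rho>\<^sup>2 * K)))) \<le> 1"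
    and rare_bad: "(1 + \<rho> * (real (n + 1))\<^sup>2) ^ q *
      ((2 * (2 * real (n + 1)) ^ q + 4 * (real q)\<^sup>2 * (real (n + 2)) ^ 4) * (2 * exp (- z\<^sup>2))) \<le> 1 / 2"
begin

definition S :: real where "S = z * sqrt (2 * real (n + 1))"
definition T :: real where "T = z * sqrt (4 * (real (n + 1))\<^sup>2 * S)"

lemma S_bounds: "1 \<le> S" "S \<le> \<kappa> ^ 8 * (2 * z)" "S \<le> \<kappa> ^ 10"
proof -
  have sq: "sqrt (2 * real (n + 1)) = sqrt 2 * \<kappa> ^ 8"
    unfolding \<kappa>(2) real_sqrt_mult using \<kappa>(1) by (simp add: real_sqrt_unique)
  have "1 \<le> \<kappa> ^ 8" using \<kappa>(1) by simp
  then have "1 * 1 \<le> sqrt 2 * \<kappa> ^ 8" by (intro mult_mono) auto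
  then show "1 \<le> S"
    unfolding S_def sq using z(1) mult_mono[of 1 z 1 "sqrt 2 * \<kappa> ^ 8"] by simp
  have "sqrt 2 \<le> 2" by (rule real_le_lsqrt) auto
  then have "z * (sqrt 2 * \<kappa> ^ 8) \<le> z * (2 * \<kappa> ^ 8)"
    using z(1) \<kappa>(1) by (intro mult_left_mono mult_right_mono) auto
  then show le: "S \<le> \<kappa> ^ 8 * (2 * z)"
    unfolding S_def sq by (simp add: mult_ac)
  also have "\<dots> \<le> \<kappa> ^ 8 * \<kappa>\<^sup>2"
    using z(2) \<kappa>(1) by (intro mult_left_mono) auto
  finally show "S \<le> \<kappa> ^ 10"
    by (simp flip: power_add)
qed

lemma T_bounds: "0 < T" "T \<le> \<kappa> ^ 21 * (2 * z)" "S\<^sup>2 \<le> \<kappa> ^ 21 * (2 * z)" "S * T \<le> \<kappa> ^ 29 * (2 * z)\<^sup>2"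
proof -
  show "0 < T"
    unfolding T_def using z(1) S_bounds(1) by (intro mult_pos_pos) auto
  have "sqrt S \<le> \<kappa> ^ 5"
    using S_bounds(3) \<kappa>(1) by (intro real_le_lsqrt) (auto simp flip: power_mult)
  moreover have "sqrt (4 * (real (n + 1))\<^sup>2 * S) = 2 * \<kappa> ^ 16 * sqrt S"
  proof -
    have "4 * (real (n + 1))\<^sup>2 * S = (2 * \<kappa> ^ 16)\<^sup>2 * S"
      by (simp only: \<kappa>(2) power_mult_distrib) simp
    moreover have "sqrt ((2 * \<kappa> ^ 16)\<^sup>2) = 2 * \<kappa> ^ 16"
      using \<kappa>(1) by (intro real_sqrt_unique) auto
    ultimately show ?thesis by (simp only: real_sqrt_mult)
  qed
  ultimately have "sqrt (4 * (real (n + 1))\<^sup>2 * S) \<le> 2 * \<kappa> ^ 16 * \<kappa> ^ 5"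
    using \<kappa>(1) mult_left_mono[of "sqrt S" "\<kappa> ^ 5" "2 * \<kappa> ^ 16"] by simp
  also have "\<dots> = 2 * \<kappa> ^ 21"
    by (simp flip: power_add)
  finally show T: "T \<le> \<kappa> ^ 21 * (2 * z)"
    unfolding T_def using z(1) by (simp add: mult_ac)
  have "S\<^sup>2 = S * S" by (rule power2_eq_square)
  also have "\<dots> \<le> \<kappa> ^ 10 * (\<kappa> ^ 8 * (2 * z))"
    using S_bounds \<kappa>(1) by (intro mult_mono) auto
  also have "\<dots> = \<kappa> ^ 18 * (2 * z)"
    by (simp flip: power_add)
  also have "\<dots> \<le> \<kappa> ^ 21 * (2 * z)"
    using z(1) \<kappa>(1) by (intro mult_right_mono power_increasing) auto
  finally show "S\<^sup>2 \<le> \<kappa> ^ 21 * (2 * z)" .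
  have "S * T \<le> (\<kappa> ^ 8 * (2 * z)) * (\<kappa> ^ 21 * (2 * z))"
    using S_bounds T \<open>0 < T\<close> z(1) \<kappa>(1) by (intro mult_mono) auto
  also have "\<dots> = \<kappa> ^ 8 * \<kappa> ^ 21 * (2 * z)\<^sup>2"
    by (simp add: power2_eq_square mult_ac)
  also have "\<kappa> ^ 8 * \<kappa> ^ 21 = \<kappa> ^ 29"
    by (simp flip: power_add)
  finally show "S * T \<le> \<kappa> ^ 29 * (2 * z)\<^sup>2" .
qed

lemma K_pos: "0 < K"
proof -
  have "0 < 8 * z\<^sup>2 * \<kappa> ^ 30"
    using z(1) \<kappa>(1) by (intro mult_pos_pos) auto
  moreover have "0 \<le> real (w * (n + 1))"
    by (rule of_nat_0_le_iff)
  ultimately show ?thesis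
    using K by linarith
qed

section \<open>The good set and exponential moments of blocks\<close>

definition squares_bounded :: "'a \<Rightarrow> bool"
  where "squares_bounded x \<longleftrightarrow> (\<forall>t\<in>{..<q}. (\<Sum>m\<in>blk t. (layer m x)\<^sup>2) \<le> K)"

definition good :: "'a \<Rightarrow> bool"
  where "good x \<longleftrightarrow> riesz_bounds (F x) q n \<kappa> (2 * z) (\<kappa> ^ 21 * (2 * z)) \<rho> u \<and> squares_bounded x"

definition block_sum :: "nat \<Rightarrow> 'a \<Rightarrow> real"
  where "block_sum t x = (\<Sum>a\<le>n. \<Sum>b\<le>n. F x t a b)"

lemma block_sum_layers: "t < q \<Longrightarrow> block_sum t x = (\<Sum>m\<in>blk t. layer m x)"
  by (simp add: block_sum_def block_eq_layers)

lemma whp_good: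
  "whp ((2 * (2 * real (n + 1)) ^ q + 4 * (real q)\<^sup>2 * (real (n + 2)) ^ 4) * (2 * exp (- z\<^sup>2))) good"
proof -
  interpret sw: hyperbolic \<Omega> n q w "\<lambda>m a b. f m b a" \<tau>1 \<tau>3 \<tau>2
    by (rule swap)
  have swF: "sw.F x t a b = F x t b a" for x t a b
    by (simp add: sw.F_def F_def sw.blk_def blk_def add.commute[of b a] diff_commute[of n b a])
  have z0: "0 \<le> z" using z by simp
  let ?e = "2 * exp (- z\<^sup>2)"
  let ?n3 = "real ((n + 2) ^ 3)"
  have S1: "S = z * sqrt (2 * real (n + 1))" "1 \<le> S"
    by (rule S_def, rule S_bounds)
  have T1: "T = z * sqrt (4 * (real (n + 1))\<^sup>2 * S)" "0 < T"
    by (rule T_def, rule T_bounds)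
  define J where "J = {p \<in> {..<q} \<times> {..<q}. fst p \<noteq> snd p}"
  have J: "finite J" "card J \<le> q * q"
  proof -
    show "finite J" by (simp add: J_def)
    have "card J \<le> card ({..<q} \<times> {..<q})"
      by (intro card_mono) (auto simp: J_def)
    then show "card J \<le> q * q" by simp
  qed
  have 1: "whp ((2 * real (n + 1)) ^ q * ?e) (\<lambda>x. \<forall>U b. U \<subseteq> {..<q} \<longrightarrow> U \<noteq> {} \<longrightarrow> (\<forall>t\<in>U. b t \<le> n) \<longrightarrow>
      \<bar>\<Sum>a\<le>n. \<Prod>t\<in>U. F x t a (b t)\<bar> \<le> S)"
    unfolding S_def by (rule whp_lines1[OF z0])
  have 2: "whp ((2 * real (n + 1)) ^ q * ?e) (\<lambda>x. \<forall>U a. U \<subseteq> {..<q} \<longrightarrow> U \<noteq> {} \<longrightarrow> (\<forall>t\<in>U. a t \<le> n) \<longrightarrow>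
      \<bar>\<Sum>b\<le>n. \<Prod>t\<in>U. F x t (a t) b\<bar> \<le> S)"
    unfolding S_def using sw.whp_lines1[OF z0] by (simp only: swF)
  have 3: "whp (real (card (J \<times> {..n})) * (?n3 * ?e)) (\<lambda>x. \<forall>p\<in>J \<times> {..n}.
      \<bar>\<Sum>b\<le>n. \<Sum>a\<le>n. F x (snd (fst p)) a b * F x (fst (fst p)) (snd p) b\<bar> \<le> \<kappa> ^ 21 * (2 * z))"
    by (intro whp_ball whp_plane[OF z0 S1]) (use T_bounds J in \<open>auto simp: T_def J_def\<close>)
  have 4: "whp (real (card J) * (?n3 * ?e)) (\<lambda>x. \<forall>p\<in>J.
      \<bar>\<Sum>b\<le>n. \<Sum>a\<le>n. \<Sum>a'\<le>n. F x (fst p) a b * F x (snd p) a' b\<bar> \<le> S * T)"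
    by (intro whp_ball whp_beck2[OF z0 S1 T1] J) (auto simp: J_def)
  have 5: "whp (real (card J) * (?n3 * ?e)) (\<lambda>x. \<forall>p\<in>J.
      \<bar>\<Sum>a\<le>n. \<Sum>b\<le>n. \<Sum>b'\<le>n. F x (fst p) a b * F x (snd p) a b'\<bar> \<le> S * T)"
  proof -
    have "whp (real (card J) * (?n3 * ?e)) (\<lambda>x. \<forall>p\<in>J.
        \<bar>\<Sum>b\<le>n. \<Sum>a\<le>n. \<Sum>a'\<le>n. sw.F x (fst p) a b * sw.F x (snd p) a' b\<bar> \<le> S * T)"
      by (intro whp_ball sw.whp_beck2[OF z0 S1 T1] J) (auto simp: J_def)
    then show ?thesis by (simp only: swF)
  qed
  have KST: "real (w * (n + 1)) + 2 * S * T \<le> K"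
  proof -
    have "2 * (S * T) \<le> 2 * (\<kappa> ^ 29 * (2 * z)\<^sup>2)"
      using T_bounds(4) by (intro mult_left_mono) auto
    also have "\<dots> = 8 * z\<^sup>2 * \<kappa> ^ 29"
      by (simp add: power2_eq_square)
    also have "\<dots> \<le> 8 * z\<^sup>2 * \<kappa> ^ 30"
      using \<kappa>(1) by (intro mult_left_mono power_increasing) auto
    finally show ?thesis using K by simp
  qed
  have 6: "whp (real (card {..<q}) * (?n3 * ?e)) squares_bounded"
    unfolding squares_bounded_def
    by (intro whp_ball whp_layer_squares[OF z0 S1 T1 KST]) auto
  note all = whp_conj[OF 1 whp_conj[OF 2 whp_conj[OF 3 whp_conj[OF 4 whp_conj[OF 5 6]]]]]
  show ?thesis
  proof (rule whp_mono[OF all], elim conjE)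
    fix x assume x: "x \<in> \<Omega>"
      and 1: "\<forall>U b. U \<subseteq> {..<q} \<longrightarrow> U \<noteq> {} \<longrightarrow> (\<forall>t\<in>U. b t \<le> n) \<longrightarrow> \<bar>\<Sum>a\<le>n. \<Prod>t\<in>U. F x t a (b t)\<bar> \<le> S"
      and 2: "\<forall>U a. U \<subseteq> {..<q} \<longrightarrow> U \<noteq> {} \<longrightarrow> (\<forall>t\<in>U. a t \<le> n) \<longrightarrow> \<bar>\<Sum>b\<le>n. \<Prod>t\<in>U. F x t (a t) b\<bar> \<le> S"
      and 3: "\<forall>p\<in>J \<times> {..n}. \<bar>\<Sum>b\<le>n. \<Sum>a\<le>n. F x (snd (fst p)) a b * F x (fst (fst p)) (snd p) b\<bar> \<le> \<kappa> ^ 21 * (2 * z)"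
      and 4: "\<forall>p\<in>J. \<bar>\<Sum>b\<le>n. \<Sum>a\<le>n. \<Sum>a'\<le>n. F x (fst p) a b * F x (snd p) a' b\<bar> \<le> S * T"
      and 5: "\<forall>p\<in>J. \<bar>\<Sum>a\<le>n. \<Sum>b\<le>n. \<Sum>b'\<le>n. F x (fst p) a b * F x (snd p) a b'\<bar> \<le> S * T"
      and 6: "squares_bounded x"
    have ST: "S * T \<le> \<kappa> ^ 30 * (2 * z)\<^sup>2"
    proof -
      have "\<kappa> ^ 29 * (2 * z)\<^sup>2 \<le> \<kappa> ^ 30 * (2 * z)\<^sup>2"
        using \<kappa>(1) by (intro mult_right_mono power_increasing) auto
      then show ?thesis using T_bounds(4) by linarith
    qed
    have "riesz_bounds (F x) q n \<kappa> (2 * z) (\<kappa> ^ 21 * (2 * z)) \<rho> u"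
    proof unfold_locales
      show "\<bar>\<Sum>a\<le>n. \<Prod>t\<in>U. F x t a (b t)\<bar> \<le> \<kappa> ^ 8 * (2 * z)"
        if "U \<subseteq> {..<q}" "U \<noteq> {}" "\<And>t. t \<in> U \<Longrightarrow> b t \<le> n" for U b
        using that by (intro order_trans[OF 1[rule_format] S_bounds(2)]) auto
      show "\<bar>\<Sum>b\<le>n. \<Prod>t\<in>U. F x t (a t) b\<bar> \<le> \<kappa> ^ 8 * (2 * z)"
        if "U \<subseteq> {..<q}" "U \<noteq> {}" "\<And>t. t \<in> U \<Longrightarrow> a t \<le> n" for U a
        using that by (intro order_trans[OF 2[rule_format] S_bounds(2)]) auto
      show "\<bar>\<Sum>b\<le>n. \<Sum>a'\<le>n. F x t a' b * F x s a b\<bar> \<le> \<kappa> ^ 21 * (2 * z)"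
        if "s < q" "t < q" "s \<noteq> t" "a \<le> n" for s t a
        using bspec[OF 3, of "((s, t), a)"] that by (simp add: J_def)
      show "\<bar>\<Sum>a\<le>n. \<Sum>b\<le>n. \<Sum>b'\<le>n. F x s a b * F x t a b'\<bar> \<le> \<kappa> ^ 30 * (2 * z)\<^sup>2"
        if "s < q" "t < q" "s \<noteq> t" for s t
        using bspec[OF 5, of "(s, t)"] that ST by (simp add: J_def)
      show "\<bar>\<Sum>b\<le>n. \<Sum>a\<le>n. \<Sum>a'\<le>n. F x s a b * F x t a' b\<bar> \<le> \<kappa> ^ 30 * (2 * z)\<^sup>2"
        if "s < q" "t < q" "s \<noteq> t" for s t
        using bspec[OF 4, of "(s, t)"] that ST by (simp add: J_def)
      show "2 * \<rho> * (\<kappa> ^ 15 * (2 * z)) \<le> u\<^sup>2"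
        using u(4) by (simp add: mult_ac)
    qed (use \<kappa> z \<rho> u in auto)
    then show "good x"
      using 6 by (simp add: good_def)
  next
    define c where "c = real (card J)"
    have c: "c \<le> (real q)\<^sup>2" "0 \<le> c"
      using J(2) by (auto simp: c_def power2_eq_square simp flip: of_nat_mult)
    have "real q \<le> (real q)\<^sup>2"
      by (cases q) (auto simp: power2_eq_square)
    then have "c * real (n + 1) + c + c + real q \<le> (real q)\<^sup>2 * real (n + 1) + (real q)\<^sup>2 + (real q)\<^sup>2 + (real q)\<^sup>2"
      using c by (intro add_mono mult_right_mono) auto
    also have "\<dots> = (real q)\<^sup>2 * real (n + 4)"
      by (simp add: algebra_simps)
    also have "\<dots> \<le> (real q)\<^sup>2 * real (4 * (n + 2))"
      by (intro mult_left_mono) auto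
    finally have le: "c * real (n + 1) + c + c + real q \<le> 4 * (real q)\<^sup>2 * real (n + 2)"
      by (simp add: algebra_simps)
    have "(c * real (n + 1) + c + c + real q) * (?n3 * ?e) \<le> (4 * (real q)\<^sup>2 * real (n + 2)) * (?n3 * ?e)"
      by (intro mult_right_mono le) auto
    also have "\<dots> = 4 * (real q)\<^sup>2 * real (n + 2) ^ 4 * ?e"
      unfolding power4_eq_xxxx power3_eq_cube of_nat_mult by (simp only: mult_ac)
    finally have le: "(c * real (n + 1) + c + c + real q) * (?n3 * ?e) \<le> 4 * (real q)\<^sup>2 * real (n + 2) ^ 4 * ?e" .
    have "real (card (J \<times> {..n})) = c * real (n + 1)" "real (card {..<q}) = real q"
      by (simp_all add: c_def card_cartesian_product algebra_simps)
    then have "(2 * real (n + 1)) ^ q * ?e + ((2 * real (n + 1)) ^ q * ?e + (real (card (J \<times> {..n})) * (?n3 * ?e) +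
        (real (card J) * (?n3 * ?e) + (real (card J) * (?n3 * ?e) + real (card {..<q}) * (?n3 * ?e))))) =
        2 * (2 * real (n + 1)) ^ q * ?e + (c * real (n + 1) + c + c + real q) * (?n3 * ?e)"
      unfolding c_def[symmetric] by (simp add: distrib_right)
    then show "(2 * real (n + 1)) ^ q * ?e + ((2 * real (n + 1)) ^ q * ?e + (real (card (J \<times> {..n})) * (?n3 * ?e) +
        (real (card J) * (?n3 * ?e) + (real (card J) * (?n3 * ?e) + real (card {..<q}) * (?n3 * ?e))))) \<le>
        (2 * (2 * real (n + 1)) ^ q + 4 * (real q)\<^sup>2 * real (n + 2) ^ 4) * ?e"
      using le by (simp only: distrib_right)
  qed
qed

text \<open>For \<open>v < -1\<close> the term \<open>exp (2 * v)\<close> may be too small; the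
  second term takes over there and is otherwise damped by \<open>exp (- l)\<close>. The cheaper
  majorant \<open>exp (2 * \<bar>v\<bar>)\<close> would cost a factor 2 for each block, and
  \<open>2 ^ q\<close> exceeds what the rarity of large blocks can compensate.\<close>

lemma one_plus_square_le:
  fixes v l :: real
  assumes "2 \<le> l"
  shows "(1 + v)\<^sup>2 \<le> exp (2 * v) + exp (- l) * exp (- l * v)"
proof (cases "0 \<le> 1 + v")
  case True
  then have "(1 + v)\<^sup>2 \<le> (exp v)\<^sup>2"
    using exp_ge_add_one_self[of v] by (intro power_mono) auto
  then show ?thesis
    by (simp add: exp_double add_increasing2)
next
  case False
  define s where "s = - 1 - v"
  have s: "0 \<le> s" using False by (simp add: s_def)
  have "s \<le> exp s"
    using exp_ge_add_one_self[of s] by linarith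
  then have "s\<^sup>2 \<le> (exp s)\<^sup>2"
    using s by (intro power_mono) auto
  also have "\<dots> = exp (2 * s)"
    by (simp add: exp_double)
  also have "\<dots> \<le> exp (l * s)"
    using assms s by (simp add: mult_right_mono)
  also have "\<dots> = exp (- l) * exp (- l * v)"
    by (simp add: s_def algebra_simps flip: exp_add)
  also have "s\<^sup>2 = (1 + v)\<^sup>2"
    by (simp add: s_def power2_eq_square algebra_simps)
  finally show ?thesis
    by (simp add: add_increasing)
qed

text \<open>The layers of all blocks in \<open>W\<close>, with the coefficient of their block, form
  one sign martingale. On the good set its quadratic variation is bounded block by block, so the
  correction in the supermartingale can be paid back as a constant.\<close>

lemma avg_exp_block_sums:
  assumes W: "W \<subseteq> {..<q}"
  shows "avg (\<lambda>x. of_bool (good x) * exp (\<Sum>t\<in>W. c t * (\<rho> * block_sum t x))) \<le> exp (\<Sum>t\<in>W. (c t)\<^sup>2 * (\<rho>\<^sup>2 * K) / 2)"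
proof -
  have finW: "finite W" using W finite_subset by blast
  define I where "I = (\<Union>t\<in>W. blk t)"
  have I: "I \<subseteq> {..n}" using blk_le W by (force simp: I_def)
  have sum_I: "(\<Sum>m\<in>I. g m) = (\<Sum>t\<in>W. \<Sum>m\<in>blk t. g m)" for g :: "nat \<Rightarrow> real"
    unfolding I_def using finW blk_disjoint by (intro sum.UNION_disjoint) (auto simp: blk_def)
  define d where "d m = c (THE t. m \<in> blk t) * \<rho>" for m
  have d: "d m = c t * \<rho>" if "m \<in> blk t" for m t
  proof -
    have "(THE t. m \<in> blk t) = t"
      using that blk_disjoint by (intro the_equality) auto
    then show ?thesis by (simp add: d_def)
  qed
  define E where "E x = exp (\<Sum>m\<in>I. d m * layer m x - (d m * layer m x)\<^sup>2 / 2)" for x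
  have le: "of_bool (good x) * exp (\<Sum>t\<in>W. c t * (\<rho> * block_sum t x)) \<le> exp (\<Sum>t\<in>W. (c t)\<^sup>2 * (\<rho>\<^sup>2 * K) / 2) * E x" for x
  proof (cases "good x")
    case True
    have "(\<Sum>t\<in>W. c t * (\<rho> * block_sum t x)) = (\<Sum>m\<in>I. d m * layer m x)"
      unfolding sum_I using W
      by (intro sum.cong refl) (simp add: d block_sum_layers sum_distrib_left mult.assoc subset_eq)
    moreover have "(\<Sum>m\<in>I. (d m * layer m x)\<^sup>2 / 2) \<le> (\<Sum>t\<in>W. (c t)\<^sup>2 * (\<rho>\<^sup>2 * K) / 2)"
      unfolding sum_I
    proof (rule sum_mono)
      fix t assume t: "t \<in> W"
      have "(\<Sum>m\<in>blk t. (d m * layer m x)\<^sup>2 / 2) = (c t * \<rho>)\<^sup>2 / 2 * (\<Sum>m\<in>blk t. (layer m x)\<^sup>2)"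
        by (simp add: d sum_distrib_left power_mult_distrib)
      also have "\<dots> \<le> (c t * \<rho>)\<^sup>2 / 2 * K"
        using True t W by (intro mult_left_mono) (auto simp: good_def squares_bounded_def)
      finally show "(\<Sum>m\<in>blk t. (d m * layer m x)\<^sup>2 / 2) \<le> (c t)\<^sup>2 * (\<rho>\<^sup>2 * K) / 2"
        by (simp add: power_mult_distrib mult_ac)
    qed
    ultimately have "(\<Sum>t\<in>W. c t * (\<rho> * block_sum t x)) \<le> (\<Sum>t\<in>W. (c t)\<^sup>2 * (\<rho>\<^sup>2 * K) / 2) +
        (\<Sum>m\<in>I. d m * layer m x - (d m * layer m x)\<^sup>2 / 2)"
      by (simp add: sum_subtractf)
    then show ?thesis
      using True by (simp add: E_def flip: exp_add)
  qed (simp add: E_def)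
  have "avg (\<lambda>x. of_bool (good x) * exp (\<Sum>t\<in>W. c t * (\<rho> * block_sum t x))) \<le>
      avg (\<lambda>x. exp (\<Sum>t\<in>W. (c t)\<^sup>2 * (\<rho>\<^sup>2 * K) / 2) * E x)"
    by (intro avg_mono le)
  also have "\<dots> = exp (\<Sum>t\<in>W. (c t)\<^sup>2 * (\<rho>\<^sup>2 * K) / 2) * avg E"
    by (rule avg_cmult)
  also have "\<dots> \<le> exp (\<Sum>t\<in>W. (c t)\<^sup>2 * (\<rho>\<^sup>2 * K) / 2) * 1"
    unfolding E_def
    by (intro mult_left_mono sign_martingale_exp[OF sign_martingale_scale[OF layer_martingale[OF I]]]) auto
  finally show ?thesis by simp
qed

definition moment :: real
  where "moment = (exp (2 * (\<rho>\<^sup>2 * K)) + exp (1 / 2 - 1 / sqrt (\<rho>\<^sup>2 * K))) ^ q"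

text \<open>Each squared factor is majorised by two exponentials. Expanding over the set
  \<open>X\<close> where the first one is taken gives exponential moments, and their bounds
  recombine into a product close to \<open>exp (2 * v)\<close> per block.\<close>

lemma avg_square_block_prod:
  assumes W: "W \<subseteq> {..<q}"
  shows "avg (\<lambda>x. of_bool (good x) * (\<Prod>t\<in>W. 1 + \<rho> * block_sum t x)\<^sup>2) \<le> moment"
proof -
  have finW: "finite W" using W finite_subset by blast
  define v where "v = \<rho>\<^sup>2 * K"
  \<comment> \<open>With \<open>l\<^sup>2 * v = 1\<close> the exponential moment at
    \<open>- l\<close> costs only \<open>exp (1 / 2)\<close>, while the damping
    \<open>exp (- l)\<close> remains strong.\<close>
  define l where "l = 1 / sqrt v"
  have v: "0 < v" "v \<le> 1 / 4"
    using \<rho> K_pos rK by (auto simp: v_def)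
  have "sqrt v \<le> 1 / 2"
    using v by (intro real_le_lsqrt) (auto simp: power2_eq_square)
  then have l: "2 \<le> l" "l\<^sup>2 * v = 1"
    using v by (auto simp: l_def field_simps)
  define a where "a t x = exp (2 * (\<rho> * block_sum t x))" for t x
  define b where "b t x = exp (- l) * exp (- l * (\<rho> * block_sum t x))" for t x
  have pointwise: "of_bool (good x) * (\<Prod>t\<in>W. 1 + \<rho> * block_sum t x)\<^sup>2 \<le>
      (\<Sum>X\<in>Pow W. exp (- l) ^ card (W - X) * (of_bool (good x) * exp (\<Sum>t\<in>W. (if t \<in> X then 2 else - l) * (\<rho> * block_sum t x))))" for x
  proof -
    have "(\<Prod>t\<in>W. 1 + \<rho> * block_sum t x)\<^sup>2 = (\<Prod>t\<in>W. (1 + \<rho> * block_sum t x)\<^sup>2)"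
      by (simp add: prod_power_distrib)
    also have "\<dots> \<le> (\<Prod>t\<in>W. a t x + b t x)"
      unfolding a_def b_def by (intro prod_mono conjI one_plus_square_le l) auto
    also have "\<dots> = (\<Sum>X\<in>Pow W. (\<Prod>t\<in>X. a t x) * (\<Prod>t\<in>W - X. b t x))"
      by (rule prod_add[OF finW])
    also have "\<dots> = (\<Sum>X\<in>Pow W. exp (- l) ^ card (W - X) * exp (\<Sum>t\<in>W. (if t \<in> X then 2 else - l) * (\<rho> * block_sum t x)))"
    proof (rule sum.cong[OF refl])
      fix X assume X: "X \<in> Pow W"
      then have finX: "finite X" using finW finite_subset by blast
      have "(\<Sum>t\<in>W. (if t \<in> X then 2 else - l) * (\<rho> * block_sum t x)) =
          (\<Sum>t\<in>X. 2 * (\<rho> * block_sum t x)) + (\<Sum>t\<in>W - X. - l * (\<rho> * block_sum t x))"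
        using X sum.subset_diff[of X W "\<lambda>t. (if t \<in> X then 2 else - l) * (\<rho> * block_sum t x)"] finW by simp
      moreover have "(\<Prod>t\<in>X. a t x) = exp (\<Sum>t\<in>X. 2 * (\<rho> * block_sum t x))"
        unfolding a_def by (rule exp_sum[OF finX, symmetric])
      moreover have "(\<Prod>t\<in>W - X. b t x) = exp (- l) ^ card (W - X) * exp (\<Sum>t\<in>W - X. - l * (\<rho> * block_sum t x))"
        using exp_sum[of "W - X" "\<lambda>t. - l * (\<rho> * block_sum t x)"] finW by (simp add: b_def prod.distrib)
      ultimately show "(\<Prod>t\<in>X. a t x) * (\<Prod>t\<in>W - X. b t x) =
          exp (- l) ^ card (W - X) * exp (\<Sum>t\<in>W. (if t \<in> X then 2 else - l) * (\<rho> * block_sum t x))"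
        by (simp only: exp_add mult_ac)
    qed
    finally show ?thesis
      by (cases "good x") simp_all
  qed
  have "avg (\<lambda>x. of_bool (good x) * (\<Prod>t\<in>W. 1 + \<rho> * block_sum t x)\<^sup>2) \<le>
      avg (\<lambda>x. \<Sum>X\<in>Pow W. exp (- l) ^ card (W - X) * (of_bool (good x) * exp (\<Sum>t\<in>W. (if t \<in> X then 2 else - l) * (\<rho> * block_sum t x))))"
    by (intro avg_mono pointwise)
  also have "\<dots> = (\<Sum>X\<in>Pow W. exp (- l) ^ card (W - X) *
      avg (\<lambda>x. of_bool (good x) * exp (\<Sum>t\<in>W. (if t \<in> X then 2 else - l) * (\<rho> * block_sum t x))))"
    by (simp only: avg_sum avg_cmult)
  also have "\<dots> \<le> (\<Sum>X\<in>Pow W. exp (- l) ^ card (W - X) * exp (\<Sum>t\<in>W. (if t \<in> X then 2 else - l)\<^sup>2 * (\<rho>\<^sup>2 * K) / 2))"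
    by (intro sum_mono mult_left_mono avg_exp_block_sums W) auto
  also have "\<dots> = (\<Sum>X\<in>Pow W. (\<Prod>t\<in>X. exp (2 * v)) * (\<Prod>t\<in>W - X. exp (1 / 2 - l)))"
  proof (rule sum.cong[OF refl])
    fix X assume X: "X \<in> Pow W"
    have "(\<Sum>t\<in>W. (if t \<in> X then 2 else - l)\<^sup>2 * (\<rho>\<^sup>2 * K) / 2) = (\<Sum>t\<in>X. 2 * v) + (\<Sum>t\<in>W - X. 1 / 2)"
      using X l(2) sum.subset_diff[of X W "\<lambda>t. (if t \<in> X then 2 else - l)\<^sup>2 * v / 2"] finW by (simp add: v_def[symmetric])
    also have "\<dots> = card X * (2 * v) + card (W - X) * (1 / 2)"
      by simp
    finally show "exp (- l) ^ card (W - X) * exp (\<Sum>t\<in>W. (if t \<in> X then 2 else - l)\<^sup>2 * (\<rho>\<^sup>2 * K) / 2) =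
        (\<Prod>t\<in>X. exp (2 * v)) * (\<Prod>t\<in>W - X. exp (1 / 2 - l))"
      by (simp add: algebra_simps flip: exp_of_nat_mult exp_add)
  qed
  also have "\<dots> = (\<Prod>t\<in>W. exp (2 * v) + exp (1 / 2 - l))"
    by (rule prod_add[OF finW, symmetric])
  also have "\<dots> \<le> moment"
    unfolding moment_def v_def[symmetric] l_def[symmetric] prod_constant
    using card_mono[OF _ W] v(1) by (intro power_increasing) (auto intro: add_increasing2)
  finally show ?thesis .
qed

section \<open>Mean and mean absolute value of the Riesz product\<close>

definition moderate :: "'a \<Rightarrow> bool"
  where "moderate x \<longleftrightarrow> (\<forall>t<q. \<bar>\<rho> * block_sum t x\<bar> \<le> 1 / 2)"

lemma avg_immoderate:
  "avg (\<lambda>x. of_bool (good x \<and> \<not> moderate x)) \<le> 2 * q * exp (- (1 / (8 * \<rho>\<^sup>2 * K)))"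
proof -
  \<comment> \<open>Chosen so that \<open>s * sqrt (2 * K)\<close> is
    \<open>1 / (2 * \<rho>)\<close>, the size of a block sum at which \<open>moderate\<close> starts
    to fail.\<close>
  define s where "s = 1 / (2 * \<rho> * sqrt (2 * K))"
  have s: "0 \<le> s" "s\<^sup>2 = 1 / (8 * \<rho>\<^sup>2 * K)" "s * sqrt (2 * K) = 1 / (2 * \<rho>)"
    using \<rho> K_pos by (auto simp: s_def power_divide power_mult_distrib)
  have "whp (real (card {..<q}) * (2 * exp (- s\<^sup>2)))
    (\<lambda>x. \<forall>t\<in>{..<q}. (\<Sum>m\<in>blk t. (layer m x)\<^sup>2) \<le> K \<longrightarrow> \<bar>\<Sum>m\<in>blk t. layer m x\<bar> \<le> s * sqrt (2 * K))"
    using blk_le by (intro whp_ball sign_martingale_tail[OF layer_martingale K_pos s(1)]) force+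
  then have "avg (\<lambda>x. of_bool (\<not> (\<forall>t\<in>{..<q}. (\<Sum>m\<in>blk t. (layer m x)\<^sup>2) \<le> K \<longrightarrow>
      \<bar>\<Sum>m\<in>blk t. layer m x\<bar> \<le> s * sqrt (2 * K)))) \<le> real (card {..<q}) * (2 * exp (- s\<^sup>2))"
    by (rule avg_of_bool_le)
  also have "\<dots> = 2 * q * exp (- (1 / (8 * \<rho>\<^sup>2 * K)))"
    by (simp add: s(2))
  finally have *: "avg (\<lambda>x. of_bool (\<not> (\<forall>t\<in>{..<q}. (\<Sum>m\<in>blk t. (layer m x)\<^sup>2) \<le> K \<longrightarrow>
      \<bar>\<Sum>m\<in>blk t. layer m x\<bar> \<le> s * sqrt (2 * K)))) \<le> 2 * q * exp (- (1 / (8 * \<rho>\<^sup>2 * K)))" .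
  show ?thesis
  proof (rule order_trans[OF avg_mono *])
    fix x
    have "moderate x" if "good x"
      and tail: "\<forall>t\<in>{..<q}. (\<Sum>m\<in>blk t. (layer m x)\<^sup>2) \<le> K \<longrightarrow> \<bar>\<Sum>m\<in>blk t. layer m x\<bar> \<le> s * sqrt (2 * K)"
      unfolding moderate_def
    proof (intro allI impI)
      fix t assume "t < q"
      then have "\<bar>block_sum t x\<bar> \<le> 1 / (2 * \<rho>)"
        using that by (simp add: good_def squares_bounded_def block_sum_layers s(3))
      then have "\<rho> * \<bar>block_sum t x\<bar> \<le> \<rho> * (1 / (2 * \<rho>))"
        using \<rho> by (intro mult_left_mono) auto
      then show "\<bar>\<rho> * block_sum t x\<bar> \<le> 1 / 2"
        using \<rho> by (simp add: abs_mult)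
    qed
    then show "of_bool (good x \<and> \<not> moderate x) \<le> (of_bool (\<not> (\<forall>t\<in>{..<q}. (\<Sum>m\<in>blk t. (layer m x)\<^sup>2) \<le> K \<longrightarrow>
        \<bar>\<Sum>m\<in>blk t. layer m x\<bar> \<le> s * sqrt (2 * K))) :: real)"
      by (auto simp: of_bool_def)
  qed
qed

abbreviation \<Psi> :: "'a \<Rightarrow> real"
  where "\<Psi> x \<equiv> riesz \<rho> (F x) q n"

text \<open>The largest occupied index has the strictly largest first frequency, by the order of the
  blocks; flipping that digit of the first coordinate reverses the whole product.\<close>

lemma avg_term:
  assumes "t < q" "r t \<noteq> None"
  shows "avg (\<lambda>x. \<Prod>t<q. weight \<rho> (F x) t (r t)) = 0"
proof -
  define T where "T = Max {t. t < q \<and> r t \<noteq> None}"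
  have T: "T < q" "r T \<noteq> None" "\<And>t. t < q \<Longrightarrow> r t \<noteq> None \<Longrightarrow> t \<le> T"
  proof -
    have "T \<in> {t. t < q \<and> r t \<noteq> None}"
      unfolding T_def by (rule Max_in) (use assms in auto)
    then show "T < q" "r T \<noteq> None" by auto
    show "t \<le> T" if "t < q" "r t \<noteq> None" for t
      unfolding T_def by (rule Max_ge) (use that in auto)
  qed
  obtain a b where ab: "r T = Some (a, b)" using T(2) by auto
  have split: "(\<Prod>t<q. weight \<rho> (F x) t (r t)) = \<rho> * F x T a b * (\<Prod>t\<in>{..<q} - {T}. weight \<rho> (F x) t (r t))" for x
    using T(1) ab by (subst prod.remove[of _ T]) (auto simp: weight_def)
  show ?thesis
  proof (cases "a + b \<le> n \<and> n - a - b \<in> blk T")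
    case False
    then have "F x T a b = 0" for x by (auto simp: F_def)
    then show ?thesis by (simp add: split)
  next
    case True
    have inv: "weight \<rho> (F (\<tau>1 (n - a - b) x)) t (r t) = weight \<rho> (F x) t (r t)"
      if x: "x \<in> \<Omega>" and t: "t \<in> {..<q} - {T}" for x t
    proof (cases "r t")
      case (Some p)
      then have "t < T"
        using T(3)[of t] t by auto
      then have "F (\<tau>1 (n - a - b) x) t (fst p) (snd p) = F x t (fst p) (snd p)"
        using True x by (intro F_inv1) (auto intro: blk_less)
      then show ?thesis
        using Some by (cases p) (simp add: weight_def)
    qed (simp add: weight_def)
    show ?thesis
    proof (rule avg_odd[of "\<tau>1 (n - a - b)"])
      show "involution (\<tau>1 (n - a - b))" by (rule invol) auto
      fix x assume x: "x \<in> \<Omega>"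
      have "(\<Prod>t\<in>{..<q} - {T}. weight \<rho> (F (\<tau>1 (n - a - b) x)) t (r t)) = (\<Prod>t\<in>{..<q} - {T}. weight \<rho> (F x) t (r t))"
        by (intro prod.cong refl inv x)
      then show "(\<Prod>t<q. weight \<rho> (F (\<tau>1 (n - a - b) x)) t (r t)) = - (\<Prod>t<q. weight \<rho> (F x) t (r t))"
        unfolding split using F_flip1[OF x, of a b T] True by simp
    qed
  qed
qed

definition no_slots :: "nat \<Rightarrow> slot"
  where "no_slots = (\<lambda>t\<in>{..<q}. None)"

lemma no_slots: "no_slots \<in> PiE {..<q} (\<lambda>_. slots n)" "strongly_distinct q no_slots"
  "(\<Prod>t<q. weight \<rho> G t (no_slots t)) = 1"
  by (auto simp: no_slots_def slots_def strongly_distinct_def same_def weight_def)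

lemma some_slot:
  assumes "r \<in> PiE {..<q} (\<lambda>_. slots n) - {no_slots}"
  obtains t where "t < q" "r t \<noteq> None"
proof -
  have "\<exists>t<q. r t \<noteq> None"
  proof (rule ccontr)
    assume "\<not> (\<exists>t<q. r t \<noteq> None)"
    then have "r = no_slots"
      using assms by (intro ext) (auto simp: no_slots_def PiE_iff extensional_def)
    then show False using assms by simp
  qed
  then show ?thesis using that by blast
qed

lemma finite_choices: "finite (PiE {..<q} (\<lambda>_. slots n))"
  by (intro finite_PiE) auto

lemma avg_riesz: "avg \<Psi> = 1"
proof -
  have "avg \<Psi> = (\<Sum>r\<in>PiE {..<q} (\<lambda>_. slots n). of_bool (strongly_distinct q r) * avg (\<lambda>x. \<Prod>t<q. weight \<rho> (F x) t (r t)))"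
    unfolding riesz_def avg_sum avg_cmult ..
  also have "\<dots> = 1 + (\<Sum>r\<in>PiE {..<q} (\<lambda>_. slots n) - {no_slots}.
      of_bool (strongly_distinct q r) * avg (\<lambda>x. \<Prod>t<q. weight \<rho> (F x) t (r t)))"
    using no_slots by (subst sum.remove[OF finite_choices no_slots(1)]) simp
  also have "(\<Sum>r\<in>PiE {..<q} (\<lambda>_. slots n) - {no_slots}.
      of_bool (strongly_distinct q r) * avg (\<lambda>x. \<Prod>t<q. weight \<rho> (F x) t (r t))) = 0"
  proof (rule sum.neutral, rule ballI)
    fix r assume r: "r \<in> PiE {..<q} (\<lambda>_. slots n) - {no_slots}"
    obtain t where "t < q" "r t \<noteq> None" using some_slot[OF r] .
    then show "of_bool (strongly_distinct q r) * avg (\<lambda>x. \<Prod>t<q. weight \<rho> (F x) t (r t)) = 0"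
      by (simp add: avg_term)
  qed
  finally show ?thesis by simp
qed

text \<open>\<open>\<bar>\<Psi> x\<bar>\<close> exceeds \<open>\<Psi> x\<close> by twice the
  negative part, which lives off the good set or on good points that are not moderate. The mean
  contributes 1, the first exceptional set at most 1 and the second at most 4. On the second set
  nonnegativity is lost, but the pattern expansion still holds, so products of blocks have to be
  averaged over a rare event.\<close>

lemma avg_abs_riesz: "avg (\<lambda>x. \<bar>\<Psi> x\<bar>) \<le> 6"
proof -
  define B where "B x = (of_bool (good x \<and> \<not> moderate x) :: real)" for x
  define C where "C = (1 + \<rho> * (real (n + 1))\<^sup>2) ^ q"
  have pointwise: "\<bar>\<Psi> x\<bar> \<le> \<Psi> x + 2 * C * of_bool (\<not> good x) + 2 * (B x * \<bar>\<Psi> x\<bar>)" if x: "x \<in> \<Omega>" for x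
  proof (cases "good x")
    case True
    then interpret riesz_bounds "F x" q n \<kappa> "2 * z" "\<kappa> ^ 21 * (2 * z)" \<rho> u
      by (simp add: good_def)
    show ?thesis
    proof (cases "moderate x")
      case m: True
      then have "0 \<le> \<Psi> x"
        by (intro riesz_nonneg) (simp add: moderate_def block_sum_def)
      then show ?thesis using True m by (simp add: B_def)
    qed (use True in \<open>simp add: B_def\<close>)
  next
    case False
    have "\<bar>\<Psi> x\<bar> \<le> C"
      unfolding C_def by (rule abs_riesz_le_crude) (use F_abs[OF x] \<rho> in auto)
    then show ?thesis using False by (simp add: B_def)
  qed
  have "avg (\<lambda>x. B x * \<bar>\<Psi> x\<bar>) \<le> 2"
  proof -
    define P where "P \<phi> \<psi> x = (\<Prod>t\<in>{..<q} - linked q \<phi> \<psi>. \<bar>1 + \<rho> * block_sum t x\<bar>)" for \<phi> \<psi> x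
    define e where "e = moment"
    have e: "0 < e"
      by (simp add: e_def moment_def add_pos_pos)
    have BP: "avg (\<lambda>x. B x * P \<phi> \<psi> x) \<le> 1" for \<phi> \<psi>
    proof -
      \<comment> \<open>A substitute for the Cauchy-Schwarz inequality. With \<open>e\<close> equal
        to \<open>moment\<close>, the squared term averages to at most 1/2 by the second moment
        bound, and the term \<open>e / 2\<close> on the rare event to at most 1/2 by
        \<open>rare_large\<close>.\<close>
      have amgm: "v \<le> (1 / (2 * e)) * v\<^sup>2 + e / 2" for v :: real
      proof -
        have "0 \<le> (v - e)\<^sup>2 / (2 * e)" using e by simp
        also have "\<dots> = (1 / (2 * e)) * v\<^sup>2 + e / 2 - v"
          using e by (simp add: power2_eq_square field_simps)
        finally show ?thesis by simp
      qed
      have "avg (\<lambda>x. B x * P \<phi> \<psi> x) \<le> avg (\<lambda>x. (1 / (2 * e)) * (of_bool (good x) * (\<Prod>t\<in>{..<q} - linked q \<phi> \<psi>. 1 + \<rho> * block_sum t x)\<^sup>2) + (e / 2) * B x)"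
      proof (rule avg_mono)
        fix x
        have "(P \<phi> \<psi> x)\<^sup>2 = (\<Prod>t\<in>{..<q} - linked q \<phi> \<psi>. 1 + \<rho> * block_sum t x)\<^sup>2"
          by (simp add: P_def abs_prod[symmetric])
        then show "B x * P \<phi> \<psi> x \<le> (1 / (2 * e)) * (of_bool (good x) * (\<Prod>t\<in>{..<q} - linked q \<phi> \<psi>. 1 + \<rho> * block_sum t x)\<^sup>2) + (e / 2) * B x"
          using amgm[of "P \<phi> \<psi> x"] e by (cases "good x"; cases "moderate x") (simp_all add: B_def)
      qed
      also have "\<dots> = (1 / (2 * e)) * avg (\<lambda>x. of_bool (good x) * (\<Prod>t\<in>{..<q} - linked q \<phi> \<psi>. 1 + \<rho> * block_sum t x)\<^sup>2) + (e / 2) * avg B"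
        by (simp only: avg_add avg_cmult)
      also have "\<dots> \<le> (1 / (2 * e)) * e + (e / 2) * (2 * q * exp (- (1 / (8 * \<rho>\<^sup>2 * K))))"
        unfolding B_def using e by (intro add_mono mult_left_mono avg_immoderate avg_square_block_prod[folded e_def]) auto
      also have "\<dots> = 1 / 2 + (e * (2 * q * exp (- (1 / (8 * \<rho>\<^sup>2 * K))))) / 2"
        using e by simp
      also have "\<dots> \<le> 1 / 2 + 1 / 2"
        using rare_large unfolding e_def moment_def by (intro add_left_mono divide_right_mono) auto
      finally show ?thesis by simp
    qed
    have "avg (\<lambda>x. B x * \<bar>\<Psi> x\<bar>) \<le> avg (\<lambda>x. \<Sum>\<phi>\<in>parent_maps q. \<Sum>\<psi>\<in>parent_maps q. (u\<^sup>2) ^ card (linked q \<phi> \<psi>) * (B x * P \<phi> \<psi> x))"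
    proof (rule avg_mono)
      fix x
      show "B x * \<bar>\<Psi> x\<bar> \<le> (\<Sum>\<phi>\<in>parent_maps q. \<Sum>\<psi>\<in>parent_maps q. (u\<^sup>2) ^ card (linked q \<phi> \<psi>) * (B x * P \<phi> \<psi> x))"
      proof (cases "good x \<and> \<not> moderate x")
        case True
        then interpret riesz_bounds "F x" q n \<kappa> "2 * z" "\<kappa> ^ 21 * (2 * z)" \<rho> u
          by (simp add: good_def)
        show ?thesis
          using abs_riesz_le True by (simp add: B_def P_def block_sum_def)
      qed (auto simp: B_def)
    qed
    also have "\<dots> = (\<Sum>\<phi>\<in>parent_maps q. \<Sum>\<psi>\<in>parent_maps q. (u\<^sup>2) ^ card (linked q \<phi> \<psi>) * avg (\<lambda>x. B x * P \<phi> \<psi> x))"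
      by (simp only: avg_sum avg_cmult)
    also have "\<dots> \<le> (\<Sum>\<phi>\<in>parent_maps q. \<Sum>\<psi>\<in>parent_maps q. (u\<^sup>2) ^ card (linked q \<phi> \<psi>) * 1)"
      by (intro sum_mono mult_left_mono BP) auto
    also have "\<dots> \<le> 2"
      using order_trans[OF sum_linked_le[OF u(1,2)] u(3)] by simp
    finally show ?thesis .
  qed
  moreover have "C * avg (\<lambda>x. of_bool (\<not> good x)) \<le> 1 / 2"
  proof -
    have "C * avg (\<lambda>x. of_bool (\<not> good x)) \<le> C * ((2 * (2 * real (n + 1)) ^ q + 4 * (real q)\<^sup>2 * (real (n + 2)) ^ 4) * (2 * exp (- z\<^sup>2)))"
      using \<rho> by (intro mult_left_mono avg_of_bool_le whp_good) (auto simp: C_def)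
    then show ?thesis using rare_bad unfolding C_def by linarith
  qed
  moreover have "avg (\<lambda>x. \<bar>\<Psi> x\<bar>) \<le> avg (\<lambda>x. \<Psi> x + 2 * C * of_bool (\<not> good x) + 2 * (B x * \<bar>\<Psi> x\<bar>))"
    by (intro avg_mono pointwise)
  moreover have "\<dots> = 1 + 2 * C * avg (\<lambda>x. of_bool (\<not> good x)) + 2 * avg (\<lambda>x. B x * \<bar>\<Psi> x\<bar>)"
    by (simp only: avg_add avg_cmult avg_riesz)
  ultimately show ?thesis by linarith
qed

end

section \<open>The inner product with the discrepancy\<close>

text \<open>The mechanism by which distinct frequencies produce oscillation: the digit at the unique
  maximum reverses one factor and is too fine for all the others. A repeated maximum would cancel
  the sign.\<close>

lemma prod_flip_top:
  fixes h :: "'t \<Rightarrow> 'x \<Rightarrow> real" and key :: "'t \<Rightarrow> nat"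
  assumes P: "finite P" "P \<noteq> {}" "inj_on key P"
    and flip: "\<And>t. t \<in> P \<Longrightarrow> h t (\<tau> (key t) x) = - h t x"
    and inv: "\<And>t k. t \<in> P \<Longrightarrow> key t < k \<Longrightarrow> k \<le> Max (key ` P) \<Longrightarrow> h t (\<tau> k x) = h t x"
  shows "(\<Prod>t\<in>P. h t (\<tau> (Max (key ` P)) x)) = - (\<Prod>t\<in>P. h t x)"
proof -
  have "Max (key ` P) \<in> key ` P"
    using P by (intro Max_in) auto
  then obtain T where T: "T \<in> P" "Max (key ` P) = key T"
    by blast
  have "key t < key T" if "t \<in> P - {T}" for t
  proof -
    have "key t \<le> key T"
      unfolding T(2)[symmetric] using P that by (intro Max_ge) auto
    moreover have "key t \<noteq> key T"
      using P(3) T(1) that by (auto simp: inj_on_def)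
    ultimately show ?thesis by simp
  qed
  then have "(\<Prod>t\<in>P - {T}. h t (\<tau> (key T) x)) = (\<Prod>t\<in>P - {T}. h t x)"
    by (intro prod.cong refl inv) (auto simp: T(2))
  then show ?thesis
    unfolding T(2) by (simp add: prod.remove[OF P(1) T(1)] flip[OF T(1)])
qed

lemma sum_PiE_insert:
  assumes "i \<notin> A"
  shows "(\<Sum>r\<in>PiE (insert i A) S. f r) = (\<Sum>v\<in>S i. \<Sum>r\<in>PiE A S. f (r(i := v)))"
proof -
  have "(\<Sum>r\<in>PiE (insert i A) S. f r) = (\<Sum>p\<in>S i \<times> PiE A S. f ((snd p)(i := fst p)))"
    unfolding PiE_insert_eq
    by (subst sum.reindex) (use inj_combinator[OF assms] in \<open>auto simp: case_prod_beta\<close>)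
  then show ?thesis
    by (simp add: sum.cartesian_product case_prod_beta)
qed

section \<open>Choices of nearby frequencies\<close>

definition close :: "nat \<Rightarrow> nat \<times> nat \<Rightarrow> nat \<times> nat \<Rightarrow> bool"
  where "close L p p' \<longleftrightarrow> fst p \<le> fst p' + L \<and> fst p' \<le> fst p + L \<and> snd p \<le> snd p' + L \<and> snd p' \<le> snd p + L"

definition clustered :: "nat \<Rightarrow> nat \<Rightarrow> (nat \<Rightarrow> slot) \<Rightarrow> bool"
  where "clustered L q r \<longleftrightarrow> (\<forall>s<q. \<forall>t<q. \<forall>p p'. r s = Some p \<longrightarrow> r t = Some p' \<longrightarrow> close L p p')"

definition near_slots :: "nat \<Rightarrow> nat \<Rightarrow> nat \<times> nat \<Rightarrow> slot set"
  where "near_slots L n p = {v \<in> slots n. \<forall>p'. v = Some p' \<longrightarrow> close L p p'}"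

abbreviation unit_weight :: "real \<Rightarrow> nat \<Rightarrow> slot \<Rightarrow> real"
  where "unit_weight \<rho> \<equiv> weight \<rho> (\<lambda>_ _ _. 1)"

lemma unit_weight: "unit_weight \<rho> t None = 1" "unit_weight \<rho> t (Some p) = \<rho>"
  by (simp_all add: weight_def case_prod_beta)

lemma unit_weight_nonneg: "0 \<le> \<rho> \<Longrightarrow> 0 \<le> unit_weight \<rho> t v"
  by (cases v) (simp_all add: unit_weight)

lemma sum_near_slots:
  assumes "0 \<le> \<rho>"
  shows "(\<Sum>v\<in>near_slots L n p. unit_weight \<rho> t v) \<le> 1 + \<rho> * (real (2 * L + 1))\<^sup>2"
proof -
  define B where "B = {p' \<in> {..n} \<times> {..n}. close L p p'}"
  have B: "finite B" "card B \<le> (2 * L + 1) * (2 * L + 1)"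
  proof -
    show "finite B" by (simp add: B_def)
    have "B \<subseteq> {fst p - L..fst p + L} \<times> {snd p - L..snd p + L}"
      by (auto simp: B_def close_def)
    then have "card B \<le> card ({fst p - L..fst p + L} \<times> {snd p - L..snd p + L})"
      by (intro card_mono) auto
    also have "\<dots> \<le> (2 * L + 1) * (2 * L + 1)"
      unfolding card_cartesian_product by (intro mult_mono) auto
    finally show "card B \<le> (2 * L + 1) * (2 * L + 1)" .
  qed
  have "near_slots L n p = insert None (Some ` B)"
    by (auto simp: near_slots_def slots_def B_def)
  then have "(\<Sum>v\<in>near_slots L n p. unit_weight \<rho> t v) = 1 + (\<Sum>v\<in>Some ` B. unit_weight \<rho> t v)"
    using B by (simp add: unit_weight image_iff)
  also have "(\<Sum>v\<in>Some ` B. unit_weight \<rho> t v) = card B * \<rho>"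
    by (subst sum.reindex) (auto simp: unit_weight)
  also have "\<dots> \<le> real ((2 * L + 1) * (2 * L + 1)) * \<rho>"
    using B(2) assms by (intro mult_right_mono) (simp_all only: of_nat_le_iff)
  finally show ?thesis
    by (simp add: power2_eq_square algebra_simps)
qed

text \<open>A clustered choice with at least two occupied slots is determined by one occupied slot
  and by a nonempty choice of nearby values in the remaining ones.\<close>

lemma sum_clustered_le:
  assumes \<rho>: "0 \<le> \<rho>" and small: "real q * (\<rho> * (real (2 * L + 1))\<^sup>2) \<le> 1"
  shows "(\<Sum>r\<in>{r \<in> PiE {..<q} (\<lambda>_. slots n). clustered L q r \<and> (\<exists>s<q. \<exists>t<q. s \<noteq> t \<and> r s \<noteq> None \<and> r t \<noteq> None)}.
      \<Prod>t<q. unit_weight \<rho> t (r t)) \<le> 2 * (real q)\<^sup>2 * \<rho>\<^sup>2 * (real (n + 1))\<^sup>2 * (real (2 * L + 1))\<^sup>2"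
proof -
  define M where "M = {r \<in> PiE {..<q} (\<lambda>_. slots n). clustered L q r \<and> (\<exists>s<q. \<exists>t<q. s \<noteq> t \<and> r s \<noteq> None \<and> r t \<noteq> None)}"
  define c where "c = (real (2 * L + 1))\<^sup>2"
  define D where "D s r \<longleftrightarrow> (\<exists>p. r s = Some p \<and> (\<forall>t\<in>{..<q} - {s}. r t \<in> near_slots L n p) \<and> (\<exists>t\<in>{..<q} - {s}. r t \<noteq> None))" for s r
  have w: "0 \<le> unit_weight \<rho> t v" for t v by (rule unit_weight_nonneg[OF \<rho>])
  have fin: "finite (PiE {..<q} (\<lambda>_. slots n))" by (intro finite_PiE) auto
  have D_sum: "(\<Sum>r\<in>PiE {..<q} (\<lambda>_. slots n). of_bool (D s r) * (\<Prod>t<q. unit_weight \<rho> t (r t))) \<le>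
      (real (n + 1))\<^sup>2 * (\<rho> * (2 * (real q * (\<rho> * c))))" if s: "s < q" for s
  proof -
    let ?A = "{..<q} - {s}"
    have ins: "insert s ?A = {..<q}" using s by auto
    have inner: "(\<Sum>r\<in>PiE ?A (\<lambda>_. slots n). of_bool (D s (r(s := v))) * (\<Prod>t<q. unit_weight \<rho> t ((r(s := v)) t))) \<le>
        of_bool (v \<noteq> None) * (\<rho> * (2 * (real q * (\<rho> * c))))" for v
    proof (cases v)
      case None
      then show ?thesis by (simp add: D_def)
    next
      case (Some p)
      have pr: "(\<Prod>t<q. unit_weight \<rho> t ((r(s := v)) t)) = \<rho> * (\<Prod>t\<in>?A. unit_weight \<rho> t (r t))" for r
        using s Some by (subst prod.remove[of _ s]) (auto simp: unit_weight intro!: prod.cong)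
      define Q where "Q = PiE ?A (\<lambda>_. near_slots L n p)"
      \<comment> \<open>The choice leaving all other slots empty. It is excluded, because a second
        slot is occupied; removing its contribution 1 from a sum that is only slightly above 1
        produces the second factor \<open>\<rho>\<close>.\<close>
      define e where "e = (\<lambda>t\<in>?A. None :: slot)"
      have finQ: "finite Q"
        unfolding Q_def by (intro finite_PiE) (auto simp: near_slots_def)
      have e: "e \<in> Q" "(\<Prod>t\<in>?A. unit_weight \<rho> t (e t)) = 1"
        by (auto simp: e_def Q_def near_slots_def slots_def unit_weight)
      have "(\<Sum>r\<in>PiE ?A (\<lambda>_. slots n). of_bool (D s (r(s := v))) * (\<Prod>t<q. unit_weight \<rho> t ((r(s := v)) t))) =
          (\<Sum>r\<in>{r \<in> PiE ?A (\<lambda>_. slots n). D s (r(s := v))}. \<rho> * (\<Prod>t\<in>?A. unit_weight \<rho> t (r t)))"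
        unfolding pr by (intro sum.mono_neutral_cong_right finite_PiE) auto
      also have "\<dots> \<le> (\<Sum>r\<in>Q - {e}. \<rho> * (\<Prod>t\<in>?A. unit_weight \<rho> t (r t)))"
      proof (rule sum_mono2)
        show "{r \<in> PiE ?A (\<lambda>_. slots n). D s (r(s := v))} \<subseteq> Q - {e}"
        proof
          fix r assume "r \<in> {r \<in> PiE ?A (\<lambda>_. slots n). D s (r(s := v))}"
          then have r: "r \<in> PiE ?A (\<lambda>_. slots n)" "D s (r(s := v))" by auto
          then have near: "\<forall>t\<in>?A. r t \<in> near_slots L n p" and ex: "\<exists>t\<in>?A. r t \<noteq> None"
            using Some by (auto simp: D_def)
          have "r \<in> Q"
            using r(1) near by (simp add: Q_def PiE_iff)
          moreover have "r \<noteq> e"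
            using ex by (auto simp: e_def)
          ultimately show "r \<in> Q - {e}" by simp
        qed
      qed (use finQ \<rho> w in \<open>auto intro!: mult_nonneg_nonneg prod_nonneg\<close>)
      also have "\<dots> = \<rho> * ((\<Sum>r\<in>Q. \<Prod>t\<in>?A. unit_weight \<rho> t (r t)) - 1)"
        using sum.remove[OF finQ e(1), of "\<lambda>r. \<Prod>t\<in>?A. unit_weight \<rho> t (r t)"] e(2)
        by (simp add: sum_distrib_left[symmetric])
      also have "\<dots> \<le> \<rho> * (2 * (real q * (\<rho> * c)))"
      proof (rule mult_left_mono[OF _ \<rho>])
        have "(\<Sum>r\<in>Q. \<Prod>t\<in>?A. unit_weight \<rho> t (r t)) = (\<Prod>t\<in>?A. \<Sum>v\<in>near_slots L n p. unit_weight \<rho> t v)"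
          unfolding Q_def by (rule prod_sum_PiE[symmetric]) (auto simp: near_slots_def)
        also have "\<dots> \<le> (\<Prod>t\<in>?A. 1 + \<rho> * c)"
        proof (rule prod_mono)
          fix t
          have "(\<Sum>v\<in>near_slots L n p. unit_weight \<rho> t v) \<le> 1 + \<rho> * c"
            unfolding c_def by (rule sum_near_slots[OF \<rho>])
          then show "0 \<le> (\<Sum>v\<in>near_slots L n p. unit_weight \<rho> t v) \<and> (\<Sum>v\<in>near_slots L n p. unit_weight \<rho> t v) \<le> 1 + \<rho> * c"
            using w by (simp add: sum_nonneg)
        qed
        also have "\<dots> \<le> (\<Prod>t\<in>?A. exp (\<rho> * c))"
          using \<rho> by (intro prod_mono) (auto simp: c_def intro!: add_nonneg_nonneg exp_ge_add_one_self)
        also have "\<dots> = exp (real (card ?A) * (\<rho> * c))"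
          by (simp add: exp_of_nat_mult)
        also have "\<dots> \<le> exp (real q * (\<rho> * c))"
          using \<rho> s by (auto simp: c_def intro!: mult_right_mono)
        also have "\<dots> \<le> 1 + 2 * (real q * (\<rho> * c))"
        proof -
          define v where "v = real q * (\<rho> * c)"
          have v: "0 \<le> v" "v \<le> 1" using \<rho> small by (auto simp: v_def c_def)
          have "exp v \<le> 1 + v + v\<^sup>2" by (rule exp_bound[OF v])
          also have "\<dots> \<le> 1 + 2 * v"
            using v mult_left_le[of v v] by (simp add: power2_eq_square)
          finally show ?thesis by (simp add: v_def)
        qed
        finally show "(\<Sum>r\<in>Q. \<Prod>t\<in>?A. unit_weight \<rho> t (r t)) - 1 \<le> 2 * (real q * (\<rho> * c))" by simp
      qed
      finally show ?thesis using Some by simp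
    qed
    have "(\<Sum>r\<in>PiE {..<q} (\<lambda>_. slots n). of_bool (D s r) * (\<Prod>t<q. unit_weight \<rho> t (r t))) =
        (\<Sum>v\<in>slots n. \<Sum>r\<in>PiE ?A (\<lambda>_. slots n). of_bool (D s (r(s := v))) * (\<Prod>t<q. unit_weight \<rho> t ((r(s := v)) t)))"
      using sum_PiE_insert[of s ?A "\<lambda>r. of_bool (D s r) * (\<Prod>t<q. unit_weight \<rho> t (r t))" "\<lambda>_. slots n"] unfolding ins by simp
    also have "\<dots> \<le> (\<Sum>v\<in>slots n. of_bool (v \<noteq> None) * (\<rho> * (2 * (real q * (\<rho> * c)))))"
      by (intro sum_mono inner)
    also have "\<dots> = (\<Sum>v\<in>slots n. of_bool (v \<noteq> None)) * (\<rho> * (2 * (real q * (\<rho> * c))))"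
      by (simp add: sum_distrib_right)
    also have "(\<Sum>v\<in>slots n. of_bool (v \<noteq> None)) = (real (n + 1))\<^sup>2"
    proof -
      have "(\<Sum>v\<in>slots n. of_bool (v \<noteq> None)) = (\<Sum>v\<in>Some ` ({..n} \<times> {..n}). 1 :: real)"
        by (rule sum.mono_neutral_cong_right) (auto simp: slots_def)
      also have "\<dots> = (real (n + 1))\<^sup>2"
        by (simp add: card_image card_cartesian_product power2_eq_square algebra_simps)
      finally show ?thesis .
    qed
    finally show ?thesis .
  qed
  have "(\<Sum>r\<in>M. \<Prod>t<q. unit_weight \<rho> t (r t)) \<le> (\<Sum>r\<in>M. \<Sum>s<q. of_bool (D s r) * (\<Prod>t<q. unit_weight \<rho> t (r t)))"
  proof (rule sum_mono)
    fix r assume "r \<in> M"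
    then obtain s t where st: "s < q" "t < q" "s \<noteq> t" "r s \<noteq> None" "r t \<noteq> None"
      and r: "r \<in> PiE {..<q} (\<lambda>_. slots n)" "clustered L q r"
      by (auto simp: M_def)
    obtain p where p: "r s = Some p" using st by auto
    have "r t' \<in> near_slots L n p" if "t' \<in> {..<q} - {s}" for t'
    proof -
      have "close L p p'" if "r t' = Some p'" for p'
        using r(2) p st(1) \<open>t' \<in> {..<q} - {s}\<close> that unfolding clustered_def by blast
      moreover have "r t' \<in> slots n"
        using r(1) that by (auto simp: PiE_iff)
      ultimately show ?thesis
        by (simp add: near_slots_def)
    qed
    then have "D s r"
      using p st by (auto simp: D_def)
    then have "(\<Prod>t<q. unit_weight \<rho> t (r t)) = of_bool (D s r) * (\<Prod>t<q. unit_weight \<rho> t (r t))"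
      by simp
    also have "\<dots> \<le> (\<Sum>s<q. of_bool (D s r) * (\<Prod>t<q. unit_weight \<rho> t (r t)))"
      using st(1) w by (intro member_le_sum) (auto intro!: mult_nonneg_nonneg prod_nonneg)
    finally show "(\<Prod>t<q. unit_weight \<rho> t (r t)) \<le> (\<Sum>s<q. of_bool (D s r) * (\<Prod>t<q. unit_weight \<rho> t (r t)))" .
  qed
  also have "\<dots> \<le> (\<Sum>r\<in>PiE {..<q} (\<lambda>_. slots n). \<Sum>s<q. of_bool (D s r) * (\<Prod>t<q. unit_weight \<rho> t (r t)))"
    using w by (intro sum_mono2 fin) (auto simp: M_def intro!: sum_nonneg mult_nonneg_nonneg prod_nonneg)
  also have "\<dots> = (\<Sum>s<q. \<Sum>r\<in>PiE {..<q} (\<lambda>_. slots n). of_bool (D s r) * (\<Prod>t<q. unit_weight \<rho> t (r t)))"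
    by (rule sum.swap)
  also have "\<dots> \<le> (\<Sum>s<q. (real (n + 1))\<^sup>2 * (\<rho> * (2 * (real q * (\<rho> * c)))))"
    by (intro sum_mono D_sum) simp
  also have "\<dots> = 2 * (real q)\<^sup>2 * \<rho>\<^sup>2 * (real (n + 1))\<^sup>2 * c"
    by (simp add: power2_eq_square mult_ac)
  finally show ?thesis
    by (simp add: M_def c_def)
qed

context hyperbolic
begin

text \<open>Just enough to antisymmetrise \<open>D\<close> in each coordinate: the size of the inner
  product with \<open>D\<close> is then governed by \<open>s1 + s2 + s3\<close> alone.\<close>

definition adapted_at :: "nat \<Rightarrow> nat \<Rightarrow> nat \<Rightarrow> ('x \<Rightarrow> real) \<Rightarrow> bool"
  where "adapted_at s1 s2 s3 g \<longleftrightarrow> s1 \<le> n \<and> s2 \<le> n \<and> s3 \<le> n \<and> (\<forall>x\<in>\<Omega>. \<bar>g x\<bar> \<le> 1 \<and>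
    g (\<tau>1 s1 x) = - g x \<and> g (\<tau>2 s2 x) = - g x \<and> g (\<tau>3 s3 x) = - g x)"

lemma adapted_at_prod:
  assumes P: "finite P" "P \<noteq> {}" and A: "\<And>t. t \<in> P \<Longrightarrow> a t + b t \<le> n" "\<And>t. t \<in> P \<Longrightarrow> n - a t - b t \<in> blk t"
    and inj: "inj_on a P" "inj_on b P"
  shows "adapted_at (Max ((\<lambda>t. n - a t - b t) ` P)) (Max (a ` P)) (Max (b ` P)) (\<lambda>x. \<Prod>t\<in>P. F x t (a t) (b t))"
proof -
  have F: "F x t (a t) (b t) = f (n - a t - b t) (a t) (b t) x" if "t \<in> P" for x t
    using A[OF that] by (simp add: F_def)
  have eq: "(\<Prod>t\<in>P. F x t (a t) (b t)) = (\<Prod>t\<in>P. f (n - a t - b t) (a t) (b t) x)" for x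
    by (intro prod.cong refl F)
  have le: "Max (k ` P) \<le> n" if "\<And>t. t \<in> P \<Longrightarrow> k t \<le> n" for k
    using P that by (subst Max_le_iff) auto
  have an: "a t \<le> n" "b t \<le> n" if "t \<in> P" for t
    using A(1)[OF that] by simp_all
  have "inj_on (\<lambda>t. n - a t - b t) P"
  proof (rule inj_onI)
    fix s t assume "s \<in> P" "t \<in> P" "n - a s - b s = n - a t - b t"
    then show "s = t"
      using A(2)[of s] A(2)[of t] blk_disjoint[of s t] by auto
  qed
  note inj' = this inj
  have m: "Max ((\<lambda>t. n - a t - b t) ` P) \<le> n" "Max (a ` P) \<le> n" "Max (b ` P) \<le> n"
    by (rule le, use an in simp)+
  have "\<bar>\<Prod>t\<in>P. F x t (a t) (b t)\<bar> \<le> 1" if "x \<in> \<Omega>" for x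
    unfolding abs_prod using F_abs[OF that] by (intro prod_le_1) auto
  moreover have "(\<Prod>t\<in>P. f (n - a t - b t) (a t) (b t) (\<tau>1 (Max ((\<lambda>t. n - a t - b t) ` P)) x)) =
      - (\<Prod>t\<in>P. f (n - a t - b t) (a t) (b t) x)" if "x \<in> \<Omega>" for x
    by (rule prod_flip_top[OF P inj'(1), of "\<lambda>t. f (n - a t - b t) (a t) (b t)" \<tau>1])
      (use A m that an in \<open>auto intro!: f_flip f_inv\<close>)
  moreover have "(\<Prod>t\<in>P. f (n - a t - b t) (a t) (b t) (\<tau>2 (Max (a ` P)) x)) =
      - (\<Prod>t\<in>P. f (n - a t - b t) (a t) (b t) x)" if "x \<in> \<Omega>" for x
    by (rule prod_flip_top[OF P inj'(2), of "\<lambda>t. f (n - a t - b t) (a t) (b t)" \<tau>2])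
      (use A m that an in \<open>auto intro!: f_flip f_inv\<close>)
  moreover have "(\<Prod>t\<in>P. f (n - a t - b t) (a t) (b t) (\<tau>3 (Max (b ` P)) x)) =
      - (\<Prod>t\<in>P. f (n - a t - b t) (a t) (b t) x)" if "x \<in> \<Omega>" for x
    by (rule prod_flip_top[OF P inj'(3), of "\<lambda>t. f (n - a t - b t) (a t) (b t)" \<tau>3])
      (use A m that an in \<open>auto intro!: f_flip f_inv\<close>)
  ultimately show ?thesis
    using m by (simp add: adapted_at_def eq)
qed

end

context hyperbolic_riesz
begin

text \<open>Distinct coordinates make the product of the chosen factors oscillate at the coordinatewise
  maximal frequencies, whose sum exceeds \<open>n + L\<close> as soon as two choices are far apart.\<close>

lemma term_bound:
  assumes D: "\<And>s1 s2 s3 g. adapted_at s1 s2 s3 g \<Longrightarrow> \<bar>avg (\<lambda>x. D x * g x)\<bar> * 2 ^ (s1 + s2 + s3) \<le> 2 ^ n"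
    and r: "r \<in> PiE {..<q} (\<lambda>_. slots n)" "strongly_distinct q r" "r \<noteq> no_slots"
  shows "\<bar>avg (\<lambda>x. D x * (\<Prod>t<q. weight \<rho> (F x) t (r t)))\<bar> \<le>
    (\<Prod>t<q. unit_weight \<rho> t (r t)) * (if clustered L q r then 1 else 1 / 2 ^ L)"
proof -
  define P where "P = {t. t < q \<and> r t \<noteq> None}"
  define a where "a t = fst (the (r t))" for t
  define b where "b t = snd (the (r t))" for t
  have P: "finite P" "P \<noteq> {}"
  proof -
    have "r \<in> PiE {..<q} (\<lambda>_. slots n) - {no_slots}" using r by simp
    then obtain t where "t < q" "r t \<noteq> None" by (rule some_slot)
    then show "P \<noteq> {}" by (auto simp: P_def)
  qed (simp add: P_def)
  have rt: "r t = Some (a t, b t)" if "t \<in> P" for t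
    using that by (auto simp: P_def a_def b_def)
  have none: "r t = None" if "t < q" "t \<notin> P" for t
    using that unfolding P_def by blast
  have Psub: "P \<subseteq> {..<q}" by (auto simp: P_def)
  have w: "(\<Prod>t<q. weight \<rho> G t (r t)) = \<rho> ^ card P * (\<Prod>t\<in>P. G t (a t) (b t))" for G
  proof -
    have "(\<Prod>t<q. weight \<rho> G t (r t)) = (\<Prod>t\<in>P. \<rho> * G t (a t) (b t))"
      using Psub by (intro prod.mono_neutral_cong_right) (auto simp: weight_def none rt)
    then show ?thesis by (simp add: prod.distrib)
  qed
  have uw: "(\<Prod>t<q. unit_weight \<rho> t (r t)) = \<rho> ^ card P"
    unfolding w by simp
  have "\<bar>avg (\<lambda>x. D x * (\<Prod>t\<in>P. F x t (a t) (b t)))\<bar> \<le> (if clustered L q r then 1 else 1 / 2 ^ L)"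
  proof (cases "\<forall>t\<in>P. a t + b t \<le> n \<and> n - a t - b t \<in> blk t")
    case False
    then obtain t where t: "t \<in> P" "\<not> (a t + b t \<le> n \<and> n - a t - b t \<in> blk t)" by auto
    then have "F x t (a t) (b t) = 0" for x by (auto simp: F_def)
    then have "(\<Prod>t\<in>P. F x t (a t) (b t)) = 0" for x
      using t(1) P(1) by (intro prod_zero) auto
    then show ?thesis by simp
  next
    case True
    have inj: "inj_on a P" "inj_on b P"
    proof -
      have "\<not> same fst r s t" "\<not> same snd r s t" if "s \<in> P" "t \<in> P" "s < t" for s t
        using r(2) that by (auto simp: strongly_distinct_def P_def)
      then have "a s \<noteq> a t" "b s \<noteq> b t" if "s \<in> P" "t \<in> P" "s < t" for s t
        using that rt unfolding same_def by fastforce+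
      then show "inj_on a P" "inj_on b P"
        unfolding inj_on_def by (metis nat_neq_iff)+
    qed
    define s1 where "s1 = Max ((\<lambda>t. n - a t - b t) ` P)"
    define s2 where "s2 = Max (a ` P)"
    define s3 where "s3 = Max (b ` P)"
    have ge: "n - a t - b t \<le> s1" "a t \<le> s2" "b t \<le> s3" if "t \<in> P" for t
      using that P(1) by (auto simp: s1_def s2_def s3_def intro!: Max_ge)
    have "adapted_at s1 s2 s3 (\<lambda>x. \<Prod>t\<in>P. F x t (a t) (b t))"
      unfolding s1_def s2_def s3_def by (rule adapted_at_prod[OF P _ _ inj]) (use True in auto)
    from D[OF this] have main: "\<bar>avg (\<lambda>x. D x * (\<Prod>t\<in>P. F x t (a t) (b t)))\<bar> * 2 ^ (s1 + s2 + s3) \<le> 2 ^ n" .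
    define A where "A = \<bar>avg (\<lambda>x. D x * (\<Prod>t\<in>P. F x t (a t) (b t)))\<bar>"
    have A: "A \<le> 1 / 2 ^ k" if "n + k \<le> s1 + s2 + s3" for k
    proof -
      have "A * 2 ^ (n + k) \<le> A * 2 ^ (s1 + s2 + s3)"
        using that by (intro mult_left_mono power_increasing) (auto simp: A_def)
      also have "\<dots> \<le> 2 ^ n" using main by (simp add: A_def)
      finally show ?thesis
        by (simp add: power_add field_simps)
    qed
    have base: "n = (n - a t - b t) + a t + b t" if "t \<in> P" for t
      using True that by fastforce
    show ?thesis
    proof (cases "clustered L q r")
      case True
      obtain t where "t \<in> P" using P by auto
      then have "n + 0 \<le> s1 + s2 + s3"
        using ge[of t] base[of t] by linarith
      from A[OF this] show ?thesis using True by (simp add: A_def)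
    next
      case False
      then obtain s t p p' where st: "s < q" "t < q" "r s = Some p" "r t = Some p'" "\<not> close L p p'"
        by (auto simp: clustered_def)
      then have sP: "s \<in> P" "t \<in> P" by (auto simp: P_def)
      then have "p = (a s, b s)" "p' = (a t, b t)"
        using rt st by auto
      then have "a t + L < a s \<or> a s + L < a t \<or> b t + L < b s \<or> b s + L < b t"
        using st(5) by (auto simp: close_def)
      then have "n + L \<le> s1 + s2 + s3"
        using ge[OF sP(1)] ge[OF sP(2)] base[OF sP(1)] base[OF sP(2)] by linarith
      from A[OF this] show ?thesis using False by (simp add: A_def)
    qed
  qed
  then have "\<rho> ^ card P * \<bar>avg (\<lambda>x. D x * (\<Prod>t\<in>P. F x t (a t) (b t)))\<bar> \<le> \<rho> ^ card P * (if clustered L q r then 1 else 1 / 2 ^ L)"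
    using \<rho> by (intro mult_left_mono) auto
  moreover have "avg (\<lambda>x. D x * (\<Prod>t<q. weight \<rho> (F x) t (r t))) = \<rho> ^ card P * avg (\<lambda>x. D x * (\<Prod>t\<in>P. F x t (a t) (b t)))"
    unfolding w avg_cmult[symmetric] by (simp add: mult_ac)
  ultimately show ?thesis
    using \<rho> by (simp add: uw abs_mult)
qed

text \<open>A first frequency \<open>m\<close> in a block is below \<open>q * w\<close>, so at least
  \<open>n - q * w\<close> second frequencies are compatible with it.\<close>

lemma card_blocks:
  "(\<Sum>t<q. \<Sum>a\<le>n. \<Sum>b\<le>n. of_bool (a + b \<le> n \<and> n - a - b \<in> blk t)) \<ge> real q * real w * real (n - q * w)"
proof -
  have "real w * real (n - q * w) \<le> (\<Sum>a\<le>n. \<Sum>b\<le>n. of_bool (a + b \<le> n \<and> n - a - b \<in> blk t))" if t: "t < q" for t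
  proof -
    have tq: "t * w + w \<le> q * w"
      using mult_right_mono[of "t + 1" q w] t by simp
    define B where "B = {p \<in> {..n} \<times> {..n}. fst p + snd p \<le> n \<and> n - fst p - snd p \<in> blk t}"
    have "(\<lambda>(m, a). (a, n - m - a)) ` (blk t \<times> {..<n - q * w}) \<subseteq> B"
      using tq by (auto simp: B_def blk_def)
    moreover have "inj_on (\<lambda>(m, a). (a, n - m - a)) (blk t \<times> {..<n - q * w})"
      using tq by (auto simp: inj_on_def blk_def)
    ultimately have "card (blk t \<times> {..<n - q * w}) \<le> card B"
      by (intro card_inj_on_le) (auto simp: B_def)
    then have "real w * real (n - q * w) \<le> real (card B)"
      by (simp add: card_cartesian_product blk_def flip: of_nat_mult)
    also have "\<dots> = (\<Sum>p\<in>{..n} \<times> {..n}. of_bool (fst p + snd p \<le> n \<and> n - fst p - snd p \<in> blk t))"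
      by (simp add: B_def Int_def)
    also have "\<dots> = (\<Sum>a\<le>n. \<Sum>b\<le>n. of_bool (a + b \<le> n \<and> n - a - b \<in> blk t))"
      unfolding sum.cartesian_product case_prod_unfold by (rule refl)
    finally show ?thesis .
  qed
  then have "(\<Sum>t<q. real w * real (n - q * w)) \<le> (\<Sum>t<q. \<Sum>a\<le>n. \<Sum>b\<le>n. of_bool (a + b \<le> n \<and> n - a - b \<in> blk t))"
    by (intro sum_mono) auto
  then show ?thesis by (simp add: mult.assoc)
qed

text \<open>\<open>D\<close> is tested against \<open>\<Psi> x - 1\<close>, which removes the choice
  without occupied slots. Single occupied slots give the main term through \<open>Df\<close>.
  Clustered choices with at least two slots are few and carry \<open>\<rho>\<^sup>2\<close>; all
  others gain \<open>2 ^ L\<close>, which absorbs their number. The 7 is the bound 6 for the mean of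
  \<open>\<bar>\<Psi> x\<bar>\<close> plus 1.\<close>

theorem sup_lower_bound:
  assumes DM: "\<And>x. x \<in> \<Omega> \<Longrightarrow> \<bar>D x\<bar> \<le> M"
    and D: "\<And>s1 s2 s3 g. adapted_at s1 s2 s3 g \<Longrightarrow> \<bar>avg (\<lambda>x. D x * g x)\<bar> * 2 ^ (s1 + s2 + s3) \<le> 2 ^ n"
    and Df: "\<And>m a b. m + a + b = n \<Longrightarrow> c0 \<le> avg (\<lambda>x. D x * f m a b x)" and c0: "0 \<le> c0"
    and L: "real q * (\<rho> * (real (2 * L + 1))\<^sup>2) \<le> 1"
  shows "\<rho> * c0 * (real q * real w * real (n - q * w)) - 2 * (real q)\<^sup>2 * \<rho>\<^sup>2 * (real (n + 1))\<^sup>2 * (real (2 * L + 1))\<^sup>2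
    - (1 + \<rho> * (real (n + 1))\<^sup>2) ^ q / 2 ^ L \<le> 7 * M"
proof -
  define X where "X = PiE {..<q} (\<lambda>_. slots n)"
  define e where "e r = avg (\<lambda>x. D x * (\<Prod>t<q. weight \<rho> (F x) t (r t)))" for r
  define W where "W r = (\<Prod>t<q. unit_weight \<rho> t (r t))" for r
  define single where "single t p = no_slots(t := Some p)" for t and p :: "nat \<times> nat"
  define S1 where "S1 = (\<lambda>(t, p). single t p) ` ({..<q} \<times> ({..n} \<times> {..n}))"
  have finX: "finite X" unfolding X_def by (rule finite_choices)
  have W0: "0 \<le> W r" for r
    unfolding W_def using \<rho> by (intro prod_nonneg) (simp add: unit_weight_nonneg)
  have inj_single: "inj_on (\<lambda>(t, p). single t p) ({..<q} \<times> ({..n} \<times> {..n}))"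
  proof (rule inj_onI, clarify)
    fix t a b t' a' b' assume t: "t < q" "t' < q" and eq: "single t (a, b) = single t' (a', b')"
    have "Some (a, b) = single t' (a', b') t"
      unfolding eq[symmetric] by (simp add: single_def)
    also have "\<dots> = (if t = t' then Some (a', b') else None)"
      using t by (simp add: single_def no_slots_def)
    finally show "t = t' \<and> (a, b) = (a', b')"
      by (simp split: if_splits)
  qed
  have S1: "S1 \<subseteq> X" "no_slots \<notin> S1" "\<And>r. r \<in> S1 \<Longrightarrow> strongly_distinct q r"
  proof -
    have "single t p \<in> X" if "t < q" "p \<in> {..n} \<times> {..n}" for t p
    proof -
      have "Some p \<in> slots n" using that(2) unfolding slots_def by blast
      then have "no_slots(t := Some p) \<in> PiE (insert t {..<q}) (\<lambda>_. slots n)"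
        using no_slots(1) by (rule PiE_fun_upd)
      then show ?thesis
        using that(1) by (simp add: single_def X_def insert_absorb)
    qed
    then show "S1 \<subseteq> X"
      unfolding S1_def by (simp only: image_subset_iff split_paired_Ball_Sigma) auto
    show "no_slots \<notin> S1"
    proof
      assume "no_slots \<in> S1"
      then obtain t p where "t < q" "no_slots = single t p" by (auto simp: S1_def)
      then have "no_slots t = Some p" by (metis fun_upd_same single_def)
      then show False using \<open>t < q\<close> by (simp add: no_slots_def)
    qed
    show "strongly_distinct q r" if "r \<in> S1" for r
      using that by (auto simp: S1_def strongly_distinct_def same_def single_def no_slots_def restrict_def
          split: if_splits)
  qed
  have riesz: "avg (\<lambda>x. D x * \<Psi> x) = (\<Sum>r\<in>X. of_bool (strongly_distinct q r) * e r)"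
  proof -
    have "D x * \<Psi> x = (\<Sum>r\<in>X. of_bool (strongly_distinct q r) * (D x * (\<Prod>t<q. weight \<rho> (F x) t (r t))))" for x
      by (simp add: riesz_def X_def sum_distrib_left mult.left_commute)
    then show ?thesis
      by (simp only: avg_sum avg_cmult e_def)
  qed
  have main: "\<rho> * c0 * (real q * real w * real (n - q * w)) \<le> (\<Sum>r\<in>S1. of_bool (strongly_distinct q r) * e r)"
  proof -
    have es: "e (single t (a, b)) = \<rho> * avg (\<lambda>x. D x * F x t a b)" if "t < q" for t a b
    proof -
      have "(\<Prod>t'<q. weight \<rho> G t' (single t (a, b) t')) = \<rho> * G t a b" for G
      proof -
        have "(\<Prod>t'<q. weight \<rho> G t' (single t (a, b) t')) = (\<Prod>t'\<in>{t}. \<rho> * G t a b)"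
          using that by (intro prod.mono_neutral_cong_right) (auto simp: single_def no_slots_def weight_def)
        then show ?thesis by simp
      qed
      then show ?thesis
        by (simp add: e_def mult.left_commute flip: avg_cmult)
    qed
    have low: "c0 * of_bool (a + b \<le> n \<and> n - a - b \<in> blk t) \<le> avg (\<lambda>x. D x * F x t a b)" for t a b
    proof (cases "a + b \<le> n \<and> n - a - b \<in> blk t")
      case True
      then have "c0 \<le> avg (\<lambda>x. D x * f (n - a - b) a b x)"
        by (intro Df) auto
      then show ?thesis using True by (simp add: F_def)
    next
      case False
      then have "F x t a b = 0" for x by (auto simp: F_def)
      then show ?thesis using False by auto
    qed
    have "\<rho> * c0 * (real q * real w * real (n - q * w)) \<le>
        \<rho> * c0 * (\<Sum>t<q. \<Sum>a\<le>n. \<Sum>b\<le>n. of_bool (a + b \<le> n \<and> n - a - b \<in> blk t))"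
      using card_blocks \<rho> c0 by (intro mult_left_mono) auto
    also have "\<dots> = (\<Sum>t<q. \<Sum>a\<le>n. \<Sum>b\<le>n. \<rho> * (c0 * of_bool (a + b \<le> n \<and> n - a - b \<in> blk t)))"
      by (simp only: sum_distrib_left mult.assoc)
    also have "\<dots> \<le> (\<Sum>t<q. \<Sum>a\<le>n. \<Sum>b\<le>n. e (single t (a, b)))"
      using \<rho> low by (intro sum_mono) (simp add: es mult_left_mono)
    also have "\<dots> = (\<Sum>y\<in>{..<q} \<times> ({..n} \<times> {..n}). e (single (fst y) (snd y)))"
      by (simp add: sum.cartesian_product case_prod_beta)
    also have "\<dots> = (\<Sum>r\<in>S1. e r)"
      unfolding S1_def by (subst sum.reindex[OF inj_single]) (auto simp: case_prod_beta)
    also have "\<dots> = (\<Sum>r\<in>S1. of_bool (strongly_distinct q r) * e r)"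
      using S1(3) by (intro sum.cong) auto
    finally show ?thesis .
  qed
  have rest: "- (\<Sum>r\<in>X - {no_slots} - S1. of_bool (strongly_distinct q r) * e r) \<le>
      2 * (real q)\<^sup>2 * \<rho>\<^sup>2 * (real (n + 1))\<^sup>2 * (real (2 * L + 1))\<^sup>2 + (1 + \<rho> * (real (n + 1))\<^sup>2) ^ q / 2 ^ L"
  proof -
    define C where "C = {r \<in> X. clustered L q r \<and> (\<exists>s<q. \<exists>t<q. s \<noteq> t \<and> r s \<noteq> None \<and> r t \<noteq> None)}"
    have "- (of_bool (strongly_distinct q r) * e r) \<le> of_bool (r \<in> C) * W r + W r / 2 ^ L"
      if r: "r \<in> X - {no_slots} - S1" for r
    proof (cases "strongly_distinct q r")
      case True
      have "\<bar>e r\<bar> \<le> W r * (if clustered L q r then 1 else 1 / 2 ^ L)"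
        unfolding e_def W_def using r by (intro term_bound[OF D _ True]) (auto simp: X_def)
      moreover have "r \<in> C" if "clustered L q r"
      proof -
        have "r \<in> PiE {..<q} (\<lambda>_. slots n) - {no_slots}" using r by (simp add: X_def)
        then obtain s where s: "s < q" "r s \<noteq> None" by (rule some_slot)
        then obtain p where p: "r s = Some p" by auto
        have "\<exists>t<q. t \<noteq> s \<and> r t \<noteq> None"
        proof (rule ccontr)
          assume no: "\<not> (\<exists>t<q. t \<noteq> s \<and> r t \<noteq> None)"
          then have none: "r t = None" if "t < q" "t \<noteq> s" for t
            using that by blast
          have "r t = undefined" if "\<not> t < q" for t
            using r that by (auto simp: X_def PiE_iff extensional_def)
          then have "r t = single s p t" for t
            using none[of t] s p by (cases "t < q") (auto simp: single_def no_slots_def)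
          then have "r = single s p" by auto
          moreover have "p \<in> {..n} \<times> {..n}"
            using r s p by (force simp: X_def slots_def PiE_iff)
          ultimately have "r \<in> S1"
            using s by (auto simp: S1_def image_iff)
          then show False using r by simp
        qed
        then show ?thesis
          using that r s by (auto simp: C_def)
      qed
      ultimately have "\<bar>e r\<bar> \<le> of_bool (r \<in> C) * W r + W r / 2 ^ L"
        using W0[of r] by (cases "clustered L q r") (auto simp: add_increasing add_increasing2)
      then show ?thesis using True by simp
    qed (use W0 in simp)
    then have "- (\<Sum>r\<in>X - {no_slots} - S1. of_bool (strongly_distinct q r) * e r) \<le>
        (\<Sum>r\<in>X - {no_slots} - S1. of_bool (r \<in> C) * W r + W r / 2 ^ L)"
      unfolding sum_negf[symmetric] by (rule sum_mono)
    also have "\<dots> \<le> (\<Sum>r\<in>X. of_bool (r \<in> C) * W r + W r / 2 ^ L)"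
      using finX W0 by (intro sum_mono2) auto
    also have "\<dots> = (\<Sum>r\<in>X. of_bool (r \<in> C) * W r) + (\<Sum>r\<in>X. W r) / 2 ^ L"
      by (simp add: sum.distrib sum_divide_distrib)
    also have "(\<Sum>r\<in>X. of_bool (r \<in> C) * W r) = (\<Sum>r\<in>C. W r)"
      using finX by (intro sum.mono_neutral_cong_right) (auto simp: C_def)
    also have "\<dots> \<le> 2 * (real q)\<^sup>2 * \<rho>\<^sup>2 * (real (n + 1))\<^sup>2 * (real (2 * L + 1))\<^sup>2"
      unfolding C_def X_def W_def using \<rho> by (intro sum_clustered_le L) auto
    also have "(\<Sum>r\<in>X. W r) = (\<Prod>t<q. \<Sum>v\<in>slots n. unit_weight \<rho> t v)"
      unfolding X_def W_def by (rule prod_sum_PiE[symmetric]) auto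
    also have "\<dots> = (1 + \<rho> * (real (n + 1))\<^sup>2) ^ q"
      by (simp add: sum_weight power2_eq_square)
    finally show ?thesis by simp
  qed
  have no: "no_slots \<in> X" "e no_slots = avg D"
    using no_slots by (auto simp: X_def e_def)
  have "avg (\<lambda>x. D x * \<Psi> x) = e no_slots + (\<Sum>r\<in>X - {no_slots}. of_bool (strongly_distinct q r) * e r)"
    unfolding riesz using no_slots(2)
    by (subst sum.remove[OF finX no(1)]) simp
  also have "(\<Sum>r\<in>X - {no_slots}. of_bool (strongly_distinct q r) * e r) =
      (\<Sum>r\<in>X - {no_slots} - S1. of_bool (strongly_distinct q r) * e r) + (\<Sum>r\<in>S1. of_bool (strongly_distinct q r) * e r)"
    using S1 finX by (intro sum.subset_diff) auto
  finally have "\<rho> * c0 * (real q * real w * real (n - q * w)) - (2 * (real q)\<^sup>2 * \<rho>\<^sup>2 * (real (n + 1))\<^sup>2 * (real (2 * L + 1))\<^sup>2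
      + (1 + \<rho> * (real (n + 1))\<^sup>2) ^ q / 2 ^ L) \<le> avg (\<lambda>x. D x * \<Psi> x) - avg D"
    using main rest no by linarith
  also have "\<dots> = avg (\<lambda>x. D x * (\<Psi> x - 1))"
    by (simp add: right_diff_distrib avg_diff)
  also have "\<dots> \<le> avg (\<lambda>x. M * (\<bar>\<Psi> x\<bar> + 1))"
  proof (rule avg_mono)
    fix x assume x: "x \<in> \<Omega>"
    have "D x * (\<Psi> x - 1) \<le> \<bar>D x\<bar> * \<bar>\<Psi> x - 1\<bar>"
      by (simp only: abs_mult[symmetric] abs_ge_self)
    also have "\<dots> \<le> M * (\<bar>\<Psi> x\<bar> + 1)"
      using DM[OF x] by (intro mult_mono) auto
    finally show "D x * (\<Psi> x - 1) \<le> M * (\<bar>\<Psi> x\<bar> + 1)" .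
  qed
  also have "\<dots> = M * (avg (\<lambda>x. \<bar>\<Psi> x\<bar>) + 1)"
    by (simp only: avg_cmult avg_add avg_const)
  also have "\<dots> \<le> M * (6 + 1)"
  proof -
    obtain x where "x \<in> \<Omega>" using nonempty_space by auto
    then have "0 \<le> M" using DM[of x] by linarith
    then show ?thesis using avg_abs_riesz by (intro mult_left_mono) auto
  qed
  finally show ?thesis by simp
qed

end

section \<open>The dyadic grid\<close>

text \<open>A grid index has \<open>n + 1\<close> binary digits. The leading \<open>k\<close> of
  them name a dyadic interval of length \<open>1 / 2 ^ k\<close> (\<open>cell n k\<close>); the next
  one, bit \<open>n - k\<close>, tells its two halves apart, gives the Haar sign
  (\<open>rademacher n k\<close>) and is toggled by \<open>flip n k\<close>. One digit more than
  \<open>n\<close> is needed to make room for \<open>k = n\<close>.\<close>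

definition flip :: "nat \<Rightarrow> nat \<Rightarrow> nat \<Rightarrow> nat"
  where "flip n k i = flip_bit (n - k) i"

definition rademacher :: "nat \<Rightarrow> nat \<Rightarrow> nat \<Rightarrow> real"
  where "rademacher n k i = (if bit i (n - k) then 1 else - 1)"

definition cell :: "nat \<Rightarrow> nat \<Rightarrow> nat \<Rightarrow> nat"
  where "cell n k i = i div 2 ^ (n + 1 - k)"

lemma flip_flip: "flip n k (flip n k i) = i"
  by (rule bit_eqI) (auto simp: flip_def bit_flip_bit_iff)

lemma cell_flip: "k' \<le> k \<Longrightarrow> k \<le> n \<Longrightarrow> cell n k' (flip n k i) = cell n k' i"
  unfolding cell_def drop_bit_eq_div[symmetric]
  by (rule bit_eqI) (auto simp: flip_def bit_flip_bit_iff bit_drop_bit_eq)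

lemma flip_less: "k \<le> n \<Longrightarrow> i < 2 ^ (n + 1) \<Longrightarrow> flip n k i < 2 ^ (n + 1)"
  using cell_flip[of 0 k n i] by (auto simp: cell_def div_eq_0_iff)

lemma rademacher_flip: "rademacher n k (flip n k i) = - rademacher n k i"
  by (simp add: rademacher_def flip_def bit_flip_bit_iff)

lemma rademacher_flip_less: "k' < k \<Longrightarrow> k \<le> n \<Longrightarrow> rademacher n k' (flip n k i) = rademacher n k' i"
  by (auto simp: rademacher_def flip_def bit_flip_bit_iff)

lemma rademacher_square: "rademacher n k i * rademacher n k i = 1"
  by (simp add: rademacher_def)

lemma rademacher_abs: "\<bar>rademacher n k i\<bar> = 1"
  by (simp add: rademacher_def)

lemma diff_flip: "real i - real (flip n k i) = rademacher n k i * 2 ^ (n - k)"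
proof -
  have set: "flip n k j = j + 2 ^ (n - k)" if "\<not> bit j (n - k)" for j
    using that by (simp add: flip_def flip_bit_eq_if set_bit_eq)
  show ?thesis
  proof (cases "bit i (n - k)")
    case True
    then have "\<not> bit (flip n k i) (n - k)"
      by (simp add: flip_def bit_flip_bit_iff)
    from set[OF this] have "i = flip n k i + 2 ^ (n - k)"
      by (simp add: flip_flip)
    then have "real i = real (flip n k i) + 2 ^ (n - k)"
      by (metis of_nat_add of_nat_numeral of_nat_power)
    then show ?thesis
      using True by (simp add: rademacher_def)
  next
    case False
    then show ?thesis
      by (simp add: set rademacher_def)
  qed
qed

lemma le_iff_cell: "cell n k c \<noteq> cell n k i \<Longrightarrow> c \<le> i \<longleftrightarrow> cell n k c < cell n k i"
proof -
  assume ne: "cell n k c \<noteq> cell n k i"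
  have "cell n k c \<le> cell n k i" if "c \<le> i"
    using that by (simp add: cell_def div_le_mono)
  moreover have "cell n k i \<le> cell n k c" if "i \<le> c"
    using that by (simp add: cell_def div_le_mono)
  ultimately show ?thesis
    using ne by (cases "c \<le> i") auto
qed

text \<open>A threshold can separate an index from its flip only if it lies in the cell that both
  share.\<close>

lemma diff_threshold_flip:
  assumes "k \<le> n"
  shows "\<bar>of_bool (c \<le> i) - of_bool (c \<le> flip n k i) :: real\<bar> \<le> of_bool (cell n k c = cell n k i)"
proof (cases "cell n k c = cell n k i")
  case False
  moreover have "cell n k (flip n k i) = cell n k i"
    using assms by (rule cell_flip[OF order_refl])
  ultimately have "c \<le> i \<longleftrightarrow> c \<le> flip n k i"
    using le_iff_cell[of n k c i] le_iff_cell[of n k c "flip n k i"] by simp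
  then show ?thesis by simp
qed auto

lemma card_cell: "k \<le> n \<Longrightarrow> card {i \<in> {..<2 ^ (n + 1)}. cell n k c = cell n k i} \<le> 2 ^ (n + 1 - k)"
proof -
  define d :: nat where "d = 2 ^ (n + 1 - k)"
  have "{i \<in> {..<2 ^ (n + 1)}. cell n k c = cell n k i} \<subseteq> {c div d * d..<c div d * d + d}"
  proof clarsimp
    fix i assume "cell n k c = cell n k i"
    then have "c div d = i div d" by (simp add: cell_def d_def)
    moreover have "0 < d" by (simp add: d_def)
    ultimately show "c div d * d \<le> i \<and> i < c div d * d + d"
      using dividend_less_div_times[of d i] by (simp add: div_times_less_eq_dividend)
  qed
  then have "card {i \<in> {..<2 ^ (n + 1)}. cell n k c = cell n k i} \<le> card {c div d * d..<c div d * d + d}"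
    by (intro card_mono) auto
  then show ?thesis by (simp add: d_def)
qed

type_synonym point3 = "nat \<times> nat \<times> nat"

definition grid :: "nat \<Rightarrow> point3 set"
  where "grid n = {..<2 ^ (n + 1)} \<times> {..<2 ^ (n + 1)} \<times> {..<2 ^ (n + 1)}"

definition flip1 where "flip1 n k x = (case x of (i, j, l) \<Rightarrow> (flip n k i, j, l))" for x :: point3
definition flip2 where "flip2 n k x = (case x of (i, j, l) \<Rightarrow> (i, flip n k j, l))" for x :: point3
definition flip3 where "flip3 n k x = (case x of (i, j, l) \<Rightarrow> (i, j, flip n k l))" for x :: point3

definition same_box :: "nat \<Rightarrow> nat \<Rightarrow> nat \<Rightarrow> nat \<Rightarrow> point3 \<Rightarrow> point3 \<Rightarrow> bool"
  where "same_box n m a b p x \<longleftrightarrow> cell n m (fst p) = cell n m (fst x) \<and>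
    cell n a (fst (snd p)) = cell n a (fst (snd x)) \<and> cell n b (snd (snd p)) = cell n b (snd (snd x))"

text \<open>A sum of Haar functions over the dyadic boxes of one shape that contain no point of
  \<open>B\<close>. On such a box only the negative volume term of the discrepancy is seen; the
  minus sign makes the inner product positive.\<close>

definition haar_function :: "nat \<Rightarrow> point3 set \<Rightarrow> nat \<Rightarrow> nat \<Rightarrow> nat \<Rightarrow> point3 \<Rightarrow> real"
  where "haar_function n B m a b x =
    - (rademacher n m (fst x) * rademacher n a (fst (snd x)) * rademacher n b (snd (snd x))) *
      of_bool (\<forall>p\<in>B. \<not> same_box n m a b p x)"

lemma finite_space_grid: "finite_space (grid n)"
  by unfold_locales (auto simp: grid_def lessThan_empty_iff)

lemma card_grid: "real (card (grid n)) = 2 ^ (3 * (n + 1))"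
proof -
  have "3 * (n + 1) = (n + 1) + ((n + 1) + (n + 1))" by simp
  then show ?thesis
    by (simp only: grid_def card_cartesian_product card_lessThan power_add of_nat_mult of_nat_power of_nat_numeral)
qed

lemma hyperbolic_grid:
  assumes "q * w \<le> n"
  shows "hyperbolic (grid n) n q w (haar_function n B) (flip1 n) (flip2 n) (flip3 n)"
proof -
  interpret finite_space "grid n" by (rule finite_space_grid)
  show ?thesis
  proof
    fix k assume "k \<le> n"
    then show "involution (flip1 n k)" "involution (flip2 n k)" "involution (flip3 n k)"
      unfolding involution_def by (auto simp: grid_def flip1_def flip2_def flip3_def flip_flip flip_less[simplified])
  next
    fix x m a b assume "x \<in> grid n"
    show "\<bar>haar_function n B m a b x\<bar> \<le> 1"
      by (simp add: haar_function_def abs_mult rademacher_abs)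
  next
    fix x :: point3 and m a b k assume "m + a + b = n"
    then have le: "m \<le> n" "a \<le> n" "b \<le> n" by auto
    show "haar_function n B m a b (flip1 n m x) = - haar_function n B m a b x"
      "haar_function n B m a b (flip2 n a x) = - haar_function n B m a b x"
      "haar_function n B m a b (flip3 n b x) = - haar_function n B m a b x"
      using le by (auto simp: haar_function_def same_box_def flip1_def flip2_def flip3_def rademacher_flip cell_flip
          split: prod.splits)
    assume "k \<le> n"
    show "m < k \<Longrightarrow> haar_function n B m a b (flip1 n k x) = haar_function n B m a b x"
      "a < k \<Longrightarrow> haar_function n B m a b (flip2 n k x) = haar_function n B m a b x"
      "b < k \<Longrightarrow> haar_function n B m a b (flip3 n k x) = haar_function n B m a b x"
      using le \<open>k \<le> n\<close>
      by (auto simp: haar_function_def same_box_def flip1_def flip2_def flip3_def rademacher_flip_less cell_flip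
          split: prod.splits)
  qed (use assms in auto)
qed

context finite_space
begin

text \<open>Against an odd \<open>g\<close> only the odd part of \<open>h\<close>
  contributes.\<close>

lemma avg_odd_factor:
  assumes \<tau>: "involution \<tau>" and g: "\<And>x. x \<in> \<Omega> \<Longrightarrow> g (\<tau> x) = - g x"
  shows "avg (\<lambda>x. h x * g x) = avg (\<lambda>x. (h x - h (\<tau> x)) * g x) / 2"
proof -
  have "avg (\<lambda>x. h x * g x) = avg (\<lambda>x. h (\<tau> x) * g (\<tau> x))"
    by (rule avg_involution[OF \<tau>, symmetric])
  also have "\<dots> = avg (\<lambda>x. - (h (\<tau> x) * g x))"
    by (simp add: avg_def g)
  also have "\<dots> = - avg (\<lambda>x. h (\<tau> x) * g x)"
    using avg_cmult[of "-1"] by simp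
  finally have "avg (\<lambda>x. h (\<tau> x) * g x) = - avg (\<lambda>x. h x * g x)" by simp
  then show ?thesis
    by (simp add: left_diff_distrib avg_diff)
qed

end

text \<open>\<open>B\<close> is an index set with a map into the grid, not a set of grid points,
  because several points may round to the same grid point and must be counted separately. The two
  inequalities leave at least half of the boxes of volume \<open>1 / 2 ^ n\<close> empty while
  keeping the expected number of points per box bounded below.\<close>

locale grid_points =
  fixes n q w :: nat and B :: "'p set" and \<kappa> :: "'p \<Rightarrow> point3"
  assumes B: "finite B" "2 * card B \<le> 2 ^ n" "2 ^ n \<le> 4 * card B" and qw: "q * w \<le> n"
begin

sublocale hyperbolic "grid n" n q w "haar_function n (\<kappa> ` B)" "flip1 n" "flip2 n" "flip3 n"
  by (rule hyperbolic_grid[OF qw])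

lemma avg_adapted_product:
  assumes g: "adapted_at s1 s2 s3 g"
  shows "avg (\<lambda>x. U (fst x) * V (fst (snd x)) * W (snd (snd x)) * g x) =
    avg (\<lambda>x. (U (fst x) - U (flip n s1 (fst x))) * (V (fst (snd x)) - V (flip n s2 (fst (snd x)))) *
      (W (snd (snd x)) - W (flip n s3 (snd (snd x)))) * g x) / 8"
proof -
  have le: "s1 \<le> n" "s2 \<le> n" "s3 \<le> n"
    and odd: "\<And>x. x \<in> grid n \<Longrightarrow> g (flip1 n s1 x) = - g x" "\<And>x. x \<in> grid n \<Longrightarrow> g (flip2 n s2 x) = - g x"
      "\<And>x. x \<in> grid n \<Longrightarrow> g (flip3 n s3 x) = - g x"
    using g by (auto simp: adapted_at_def)
  have "avg (\<lambda>x. U (fst x) * V (fst (snd x)) * W (snd (snd x)) * g x) =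
      avg (\<lambda>x. (U (fst x) - U (flip n s1 (fst x))) * V (fst (snd x)) * W (snd (snd x)) * g x) / 2"
    by (subst avg_odd_factor[where g = g, OF invol(1)[OF le(1)] odd(1)]) (simp_all add: flip1_def case_prod_beta algebra_simps)
  also have "avg (\<lambda>x. (U (fst x) - U (flip n s1 (fst x))) * V (fst (snd x)) * W (snd (snd x)) * g x) =
      avg (\<lambda>x. (U (fst x) - U (flip n s1 (fst x))) * (V (fst (snd x)) - V (flip n s2 (fst (snd x)))) * W (snd (snd x)) * g x) / 2"
    by (subst avg_odd_factor[where g = g, OF invol(2)[OF le(2)] odd(2)]) (simp_all add: flip2_def case_prod_beta algebra_simps)
  also have "avg (\<lambda>x. (U (fst x) - U (flip n s1 (fst x))) * (V (fst (snd x)) - V (flip n s2 (fst (snd x)))) * W (snd (snd x)) * g x) =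
      avg (\<lambda>x. (U (fst x) - U (flip n s1 (fst x))) * (V (fst (snd x)) - V (flip n s2 (fst (snd x)))) *
      (W (snd (snd x)) - W (flip n s3 (snd (snd x)))) * g x) / 2"
    by (subst avg_odd_factor[where g = g, OF invol(3)[OF le(3)] odd(3)]) (simp_all add: flip3_def case_prod_beta algebra_simps)
  finally show ?thesis by simp
qed

definition jump :: "nat \<Rightarrow> nat \<Rightarrow> nat \<Rightarrow> real"
  where "jump k c i = of_bool (c \<le> i) - of_bool (c \<le> flip n k i)"

definition D :: "point3 \<Rightarrow> real"
  where "D x = (\<Sum>p\<in>B. of_bool (fst (\<kappa> p) \<le> fst x) * of_bool (fst (snd (\<kappa> p)) \<le> fst (snd x)) *
      of_bool (snd (snd (\<kappa> p)) \<le> snd (snd x))) -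
    card B * ((real (fst x) + 1) * (real (fst (snd x)) + 1) * (real (snd (snd x)) + 1) / 2 ^ (3 * (n + 1)))"

text \<open>Antisymmetrising in the three coordinates gives the factor 1/8. The indicator of a point
  becomes a product of jumps supported in the box of that point; the volume, a product of affine
  functions, becomes a multiple of the product of the Haar signs.\<close>

lemma avg_D:
  assumes g: "adapted_at s1 s2 s3 g"
  shows "avg (\<lambda>x. D x * g x) = (avg (\<lambda>x. (\<Sum>p\<in>B. jump s1 (fst (\<kappa> p)) (fst x) *
        jump s2 (fst (snd (\<kappa> p))) (fst (snd x)) * jump s3 (snd (snd (\<kappa> p))) (snd (snd x))) * g x) -
      card B / 2 ^ (s1 + s2 + s3 + 3) * avg (\<lambda>x. rademacher n s1 (fst x) * rademacher n s2 (fst (snd x)) * rademacher n s3 (snd (snd x)) * g x)) / 8"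
proof -
  have le: "s1 \<le> n" "s2 \<le> n" "s3 \<le> n"
    using g by (auto simp: adapted_at_def)
  define h where "h p x = of_bool (fst (\<kappa> p) \<le> fst x) * of_bool (fst (snd (\<kappa> p)) \<le> fst (snd x)) *
      (of_bool (snd (snd (\<kappa> p)) \<le> snd (snd x)) :: real)" for p x
  define v where "v x = (real (fst x) + 1) * (real (fst (snd x)) + 1) * (real (snd (snd x)) + 1)" for x :: point3
  define R where "R x = rademacher n s1 (fst x) * rademacher n s2 (fst (snd x)) * rademacher n s3 (snd (snd x))" for x :: point3
  have count: "avg (\<lambda>x. h p x * g x) = avg (\<lambda>x. jump s1 (fst (\<kappa> p)) (fst x) *
        jump s2 (fst (snd (\<kappa> p))) (fst (snd x)) * jump s3 (snd (snd (\<kappa> p))) (snd (snd x)) * g x) / 8" for p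
    unfolding h_def jump_def by (rule avg_adapted_product[OF g])
  have d: "(real i + 1) - (real (flip n k i) + 1) = rademacher n k i * 2 ^ (n - k)" for i k
    using diff_flip[of i n k] by simp
  have "avg (\<lambda>x. v x * g x) = avg (\<lambda>x. (rademacher n s1 (fst x) * 2 ^ (n - s1)) * (rademacher n s2 (fst (snd x)) * 2 ^ (n - s2)) *
      (rademacher n s3 (snd (snd x)) * 2 ^ (n - s3)) * g x) / 8"
    unfolding v_def d[symmetric] by (rule avg_adapted_product[OF g])
  also have "\<dots> = avg (\<lambda>x. (2 ^ (n - s1) * 2 ^ (n - s2) * 2 ^ (n - s3)) * (R x * g x)) / 8"
    by (simp add: R_def mult_ac)
  also have "\<dots> = 2 ^ (n - s1) * 2 ^ (n - s2) * 2 ^ (n - s3) * avg (\<lambda>x. R x * g x) / 8"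
    by (simp only: avg_cmult)
  finally have vol: "avg (\<lambda>x. v x * g x) = 2 ^ (n - s1) * 2 ^ (n - s2) * 2 ^ (n - s3) * avg (\<lambda>x. R x * g x) / 8" .
  have pow: "2 ^ (n - s1) * 2 ^ (n - s2) * 2 ^ (n - s3) / 2 ^ (3 * (n + 1)) = (1 / 2 ^ (s1 + s2 + s3 + 3) :: real)"
  proof -
    have "3 * (n + 1) = (n - s1) + (n - s2) + (n - s3) + (s1 + s2 + s3 + 3)"
      using le by simp
    then have "(2 :: real) ^ (3 * (n + 1)) = 2 ^ (n - s1) * 2 ^ (n - s2) * 2 ^ (n - s3) * 2 ^ (s1 + s2 + s3 + 3)"
      by (simp only: power_add)
    then show ?thesis by simp
  qed
  have "D x * g x = (\<Sum>p\<in>B. h p x * g x) - (card B / 2 ^ (3 * (n + 1))) * (v x * g x)" for x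
    by (simp add: D_def h_def v_def left_diff_distrib sum_distrib_right)
  then have "avg (\<lambda>x. D x * g x) = (\<Sum>p\<in>B. avg (\<lambda>x. h p x * g x)) - (card B / 2 ^ (3 * (n + 1))) * avg (\<lambda>x. v x * g x)"
    by (simp only: avg_diff avg_sum avg_cmult)
  also have "(card B / 2 ^ (3 * (n + 1))) * avg (\<lambda>x. v x * g x) =
      card B * (2 ^ (n - s1) * 2 ^ (n - s2) * 2 ^ (n - s3) / 2 ^ (3 * (n + 1))) * avg (\<lambda>x. R x * g x) / 8"
    by (simp add: vol)
  also have "\<dots> = card B / 2 ^ (s1 + s2 + s3 + 3) * avg (\<lambda>x. R x * g x) / 8"
    by (simp only: pow) simp
  also have "(\<Sum>p\<in>B. avg (\<lambda>x. h p x * g x)) = avg (\<lambda>x. (\<Sum>p\<in>B. jump s1 (fst (\<kappa> p)) (fst x) *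
        jump s2 (fst (snd (\<kappa> p))) (fst (snd x)) * jump s3 (snd (snd (\<kappa> p))) (snd (snd x))) * g x) / 8"
    by (simp add: count sum_distrib_right avg_sum sum_divide_distrib)
  finally show ?thesis
    by (simp add: R_def diff_divide_distrib)
qed

lemma abs_jumps_le:
  assumes "s1 \<le> n" "s2 \<le> n" "s3 \<le> n"
  shows "\<bar>jump s1 (fst p) (fst x) * jump s2 (fst (snd p)) (fst (snd x)) * jump s3 (snd (snd p)) (snd (snd x))\<bar>
    \<le> of_bool (same_box n s1 s2 s3 p x)"
proof -
  have "\<bar>jump s1 (fst p) (fst x)\<bar> * \<bar>jump s2 (fst (snd p)) (fst (snd x))\<bar> * \<bar>jump s3 (snd (snd p)) (snd (snd x))\<bar> \<le>
      of_bool (cell n s1 (fst p) = cell n s1 (fst x)) * of_bool (cell n s2 (fst (snd p)) = cell n s2 (fst (snd x))) *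
      of_bool (cell n s3 (snd (snd p)) = cell n s3 (snd (snd x)))"
    unfolding jump_def by (intro mult_mono diff_threshold_flip assms) auto
  then show ?thesis
    by (simp add: abs_mult same_box_def flip: of_bool_conj)
qed

lemma avg_same_box:
  assumes "s1 \<le> n" "s2 \<le> n" "s3 \<le> n"
  shows "avg (\<lambda>x. of_bool (same_box n s1 s2 s3 p x)) \<le> 1 / 2 ^ (s1 + s2 + s3)"
proof -
  define C where "C k c = {i \<in> {..<2 ^ (n + 1)}. cell n k c = cell n k i}" for k c
  have "{x \<in> grid n. same_box n s1 s2 s3 p x} = C s1 (fst p) \<times> C s2 (fst (snd p)) \<times> C s3 (snd (snd p))"
    by (auto simp: grid_def same_box_def C_def)
  then have "card {x \<in> grid n. same_box n s1 s2 s3 p x} = card (C s1 (fst p)) * card (C s2 (fst (snd p))) * card (C s3 (snd (snd p)))"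
    by (simp add: card_cartesian_product)
  also have "\<dots> \<le> 2 ^ (n + 1 - s1) * 2 ^ (n + 1 - s2) * 2 ^ (n + 1 - s3)"
    unfolding C_def by (intro mult_mono card_cell assms) auto
  finally have "real (card {x \<in> grid n. same_box n s1 s2 s3 p x}) \<le> real (2 ^ (n + 1 - s1) * 2 ^ (n + 1 - s2) * 2 ^ (n + 1 - s3))"
    by (simp only: of_nat_le_iff)
  also have "\<dots> = 2 ^ (n + 1 - s1) * 2 ^ (n + 1 - s2) * 2 ^ (n + 1 - s3)"
    by (simp only: of_nat_mult of_nat_power of_nat_numeral)
  finally have "2 ^ (s1 + s2 + s3) * real (card {x \<in> grid n. same_box n s1 s2 s3 p x}) \<le>
      2 ^ (s1 + s2 + s3) * (2 ^ (n + 1 - s1) * 2 ^ (n + 1 - s2) * 2 ^ (n + 1 - s3))"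
    by (intro mult_left_mono) auto
  also have "\<dots> = 2 ^ ((s1 + s2 + s3) + (n + 1 - s1) + (n + 1 - s2) + (n + 1 - s3))"
    by (simp only: power_add mult_ac)
  also have "(s1 + s2 + s3) + (n + 1 - s1) + (n + 1 - s2) + (n + 1 - s3) = 3 * (n + 1)"
    using assms by simp
  finally have "real (card {x \<in> grid n. same_box n s1 s2 s3 p x}) / 2 ^ (3 * (n + 1)) \<le> 1 / 2 ^ (s1 + s2 + s3)"
    by (simp add: field_simps)
  moreover have "avg (\<lambda>x. of_bool (same_box n s1 s2 s3 p x)) = real (card {x \<in> grid n. same_box n s1 s2 s3 p x}) / 2 ^ (3 * (n + 1))"
    using finite_space by (simp add: avg_def card_grid Int_def del: mult_Suc_right)
  ultimately show ?thesis by simp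
qed

text \<open>The counting part is bounded by the total volume of the boxes that contain points, the
  volume part by its coefficient. Each is at most \<open>card B / 2 ^ (s1 + s2 + s3)\<close>, and
  \<open>2 * card B \<le> 2 ^ n\<close>.\<close>

lemma avg_D_le:
  assumes g: "adapted_at s1 s2 s3 g"
  shows "\<bar>avg (\<lambda>x. D x * g x)\<bar> * 2 ^ (s1 + s2 + s3) \<le> 2 ^ n"
proof -
  have le: "s1 \<le> n" "s2 \<le> n" "s3 \<le> n" and g1: "\<And>x. x \<in> grid n \<Longrightarrow> \<bar>g x\<bar> \<le> 1"
    using g by (auto simp: adapted_at_def)
  let ?J = "\<lambda>x. (\<Sum>p\<in>B. jump s1 (fst (\<kappa> p)) (fst x) * jump s2 (fst (snd (\<kappa> p))) (fst (snd x)) * jump s3 (snd (snd (\<kappa> p))) (snd (snd x)))"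
  let ?R = "\<lambda>x. rademacher n s1 (fst x) * rademacher n s2 (fst (snd x)) * rademacher n s3 (snd (snd x))"
  have "\<bar>avg (\<lambda>x. ?J x * g x)\<bar> \<le> avg (\<lambda>x. \<Sum>p\<in>B. of_bool (same_box n s1 s2 s3 (\<kappa> p) x))"
  proof (rule order_trans[OF avg_abs_le avg_mono])
    fix x assume x: "x \<in> grid n"
    have "\<bar>?J x\<bar> \<le> (\<Sum>p\<in>B. of_bool (same_box n s1 s2 s3 (\<kappa> p) x))"
      by (intro order_trans[OF sum_abs] sum_mono abs_jumps_le le)
    then have "\<bar>?J x\<bar> * \<bar>g x\<bar> \<le> (\<Sum>p\<in>B. of_bool (same_box n s1 s2 s3 (\<kappa> p) x)) * 1"
      using g1[OF x] by (intro mult_mono) (auto intro: sum_nonneg)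
    then show "\<bar>?J x * g x\<bar> \<le> (\<Sum>p\<in>B. of_bool (same_box n s1 s2 s3 (\<kappa> p) x))"
      by (simp add: abs_mult)
  qed
  also have "\<dots> = (\<Sum>p\<in>B. avg (\<lambda>x. of_bool (same_box n s1 s2 s3 (\<kappa> p) x)))"
    by (rule avg_sum)
  also have "\<dots> \<le> (\<Sum>p\<in>B. 1 / 2 ^ (s1 + s2 + s3))"
    by (intro sum_mono avg_same_box le)
  also have "\<dots> = card B / 2 ^ (s1 + s2 + s3)"
    by simp
  finally have J: "\<bar>avg (\<lambda>x. ?J x * g x)\<bar> \<le> card B / 2 ^ (s1 + s2 + s3)" .
  have "\<bar>avg (\<lambda>x. ?R x * g x)\<bar> \<le> avg (\<lambda>x. 1)"
    by (intro order_trans[OF avg_abs_le] avg_mono) (simp add: abs_mult rademacher_abs g1)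
  then have "\<bar>avg (\<lambda>x. ?R x * g x)\<bar> \<le> 1" by simp
  then have "\<bar>card B / 2 ^ (s1 + s2 + s3 + 3) * avg (\<lambda>x. ?R x * g x)\<bar> \<le> card B / 2 ^ (s1 + s2 + s3 + 3) * 1"
    unfolding abs_mult by (intro mult_mono) auto
  also have "\<dots> \<le> card B / 2 ^ (s1 + s2 + s3)"
    by (simp add: power_add field_simps)
  finally have R: "\<bar>card B / 2 ^ (s1 + s2 + s3 + 3) * avg (\<lambda>x. ?R x * g x)\<bar> \<le> card B / 2 ^ (s1 + s2 + s3)" .
  have gen: "\<bar>v\<bar> \<le> c \<Longrightarrow> \<bar>v'\<bar> \<le> c \<Longrightarrow> \<bar>v - v'\<bar> \<le> 2 * c" for v v' c :: real
    by linarith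
  have eighth: "\<bar>v\<bar> \<le> c \<Longrightarrow> \<bar>v / 8\<bar> \<le> c" for v c :: real
    by linarith
  have "\<bar>avg (\<lambda>x. ?J x * g x) - card B / 2 ^ (s1 + s2 + s3 + 3) * avg (\<lambda>x. ?R x * g x)\<bar> \<le>
      2 * (card B / 2 ^ (s1 + s2 + s3))"
    by (rule gen[OF J R])
  then have "\<bar>avg (\<lambda>x. D x * g x)\<bar> \<le> 2 * (card B / 2 ^ (s1 + s2 + s3))"
    unfolding avg_D[OF g] by (rule eighth)
  then have "\<bar>avg (\<lambda>x. D x * g x)\<bar> * 2 ^ (s1 + s2 + s3) \<le> 2 * real (card B)"
    by (simp add: field_simps)
  also have "\<dots> \<le> 2 ^ n"
    using of_nat_mono[OF B(2), where 'a = real] by simp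
  finally show ?thesis .
qed

text \<open>On the support of the function all jumps vanish, so only the volume term survives. The
  constant is the product of 1/8 from antisymmetrising, 1/32 from
  \<open>2 ^ n \<le> 4 * card B\<close> and the denominator \<open>2 ^ (n + 3)\<close>, and 1/2 for
  the proportion of empty boxes.\<close>

lemma avg_D_haar:
  assumes "m + a + b = n"
  shows "1 / 512 \<le> avg (\<lambda>x. D x * haar_function n (\<kappa> ` B) m a b x)"
proof -
  let ?f = "haar_function n (\<kappa> ` B) m a b"
  let ?R = "\<lambda>x. rademacher n m (fst x) * rademacher n a (fst (snd x)) * rademacher n b (snd (snd x))"
  have le: "m \<le> n" "a \<le> n" "b \<le> n" using assms by auto
  have "adapted_at m a b ?f"
    unfolding adapted_at_def using le f_abs f_flip[OF _ assms] by auto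
  note main = avg_D[OF this]
  have jumps: "(\<Sum>p\<in>B. jump m (fst (\<kappa> p)) (fst x) * jump a (fst (snd (\<kappa> p))) (fst (snd x)) * jump b (snd (snd (\<kappa> p))) (snd (snd x))) * ?f x = 0" for x
  proof (cases "\<forall>p\<in>B. \<not> same_box n m a b (\<kappa> p) x")
    case True
    have "jump m (fst (\<kappa> p)) (fst x) * jump a (fst (snd (\<kappa> p))) (fst (snd x)) * jump b (snd (snd (\<kappa> p))) (snd (snd x)) = 0" if "p \<in> B" for p
      using abs_jumps_le[OF le, of "\<kappa> p" x] True that by simp
    then have "(\<Sum>p\<in>B. jump m (fst (\<kappa> p)) (fst x) * jump a (fst (snd (\<kappa> p))) (fst (snd x)) * jump b (snd (snd (\<kappa> p))) (snd (snd x))) = 0"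
      by (intro sum.neutral ballI)
    then show ?thesis by simp
  next
    case False
    then have "?f x = 0" by (auto simp: haar_function_def)
    then show ?thesis by simp
  qed
  have half: "1 / 2 \<le> - avg (\<lambda>x. ?R x * ?f x)"
  proof -
    have R: "?R x * ?R x = 1" for x
      using rademacher_square[of n m "fst x"] rademacher_square[of n a "fst (snd x)"] rademacher_square[of n b "snd (snd x)"]
      by (simp add: mult_ac)
    have "- avg (\<lambda>x. ?R x * ?f x) = avg (\<lambda>x. of_bool (\<forall>p\<in>\<kappa> ` B. \<not> same_box n m a b p x))"
    proof -
      have "?R x * ?f x = (-1) * of_bool (\<forall>p\<in>\<kappa> ` B. \<not> same_box n m a b p x)" for x
        unfolding haar_function_def mult_minus_left mult_minus_right mult.assoc[of "?R x" "?R x" for x, symmetric]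
        using R[of x] by (simp add: mult.assoc[symmetric])
      then show ?thesis by (simp only: avg_cmult)
    qed
    also have "\<dots> \<ge> avg (\<lambda>x. 1 - (\<Sum>p\<in>B. of_bool (same_box n m a b (\<kappa> p) x)))"
    proof (rule avg_mono)
      fix x
      have nn: "0 \<le> (\<Sum>p\<in>B. of_bool (same_box n m a b (\<kappa> p) x) :: real)"
        by (intro sum_nonneg) auto
      show "1 - (\<Sum>p\<in>B. of_bool (same_box n m a b (\<kappa> p) x)) \<le> (of_bool (\<forall>p\<in>\<kappa> ` B. \<not> same_box n m a b p x) :: real)"
      proof (cases "\<forall>p\<in>B. \<not> same_box n m a b (\<kappa> p) x")
        case False
        then obtain p where p: "p \<in> B" "same_box n m a b (\<kappa> p) x" by auto
        have "of_bool (same_box n m a b (\<kappa> p) x) \<le> (\<Sum>p\<in>B. of_bool (same_box n m a b (\<kappa> p) x) :: real)"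
          by (rule member_le_sum) (use p B in auto)
        then show ?thesis using p by simp
      qed (use nn in simp)
    qed
    moreover have "avg (\<lambda>x. 1 - (\<Sum>p\<in>B. of_bool (same_box n m a b (\<kappa> p) x))) = 1 - (\<Sum>p\<in>B. avg (\<lambda>x. of_bool (same_box n m a b (\<kappa> p) x)))"
      by (simp only: avg_diff avg_const avg_sum)
    moreover have "(\<Sum>p\<in>B. avg (\<lambda>x. of_bool (same_box n m a b (\<kappa> p) x))) \<le> (\<Sum>p\<in>B. 1 / 2 ^ (m + a + b))"
      by (intro sum_mono avg_same_box le)
    moreover have "(\<Sum>p\<in>B. 1 / 2 ^ (m + a + b)) \<le> (1 / 2 :: real)"
    proof -
      have "2 * real (card B) \<le> 2 ^ n"
        using of_nat_mono[OF B(2), where 'a = real] by simp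
      then show ?thesis unfolding assms by (simp add: field_simps)
    qed
    ultimately show ?thesis by linarith
  qed
  have "1 / 32 \<le> card B / 2 ^ (m + a + b + 3)"
  proof -
    have "2 ^ n \<le> 4 * real (card B)"
      using of_nat_mono[OF B(3), where 'a = real] by simp
    then show ?thesis unfolding assms by (simp add: power_add field_simps)
  qed
  then have "1 / 32 * (1 / 2) \<le> card B / 2 ^ (m + a + b + 3) * - avg (\<lambda>x. ?R x * ?f x)"
    using half by (rule mult_mono) simp_all
  moreover have "avg (\<lambda>x. D x * ?f x) = (0 - card B / 2 ^ (m + a + b + 3) * avg (\<lambda>x. ?R x * ?f x)) / 8"
    unfolding main jumps by simp
  ultimately show ?thesis by (simp only:) simp
qed

end

section \<open>From the grid to the cube\<close>

text \<open>For \<open>t = 1\<close> this is \<open>2 ^ (n + 1)\<close>, outside the grid. Such a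
  point lies below no corner, in agreement with the half-open boxes.\<close>

definition digit :: "nat \<Rightarrow> real \<Rightarrow> nat"
  where "digit n t = nat \<lfloor>t * 2 ^ (n + 1)\<rfloor>"

definition grid_point :: "nat \<Rightarrow> real ^ 3 \<Rightarrow> point3"
  where "grid_point n p = (digit n (p $ 1), digit n (p $ 2), digit n (p $ 3))"

definition corner :: "nat \<Rightarrow> point3 \<Rightarrow> real ^ 3"
  where "corner n x = vector [(real (fst x) + 1) / 2 ^ (n + 1), (real (fst (snd x)) + 1) / 2 ^ (n + 1),
    (real (snd (snd x)) + 1) / 2 ^ (n + 1)]"

lemma prod_3: "prod f (UNIV :: 3 set) = f 1 * f 2 * f 3" for f :: "3 \<Rightarrow> real"
  unfolding UNIV_3 by (simp add: mult.assoc)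

lemma digit_le_iff: "0 \<le> t \<Longrightarrow> digit n t \<le> i \<longleftrightarrow> t < (real i + 1) / 2 ^ (n + 1)"
proof -
  assume t: "0 \<le> t"
  have "digit n t \<le> i \<longleftrightarrow> \<lfloor>t * 2 ^ (n + 1)\<rfloor> \<le> int i"
    by (simp add: digit_def nat_le_iff)
  also have "\<dots> \<longleftrightarrow> t * 2 ^ (n + 1) < real i + 1"
    by (simp add: floor_le_iff)
  also have "\<dots> \<longleftrightarrow> t < (real i + 1) / 2 ^ (n + 1)"
    by (simp add: pos_less_divide_eq)
  finally show ?thesis .
qed

lemma discrepancy_at_corner:
  assumes A: "finite A" "A \<subseteq> unit_cube" and gp: "grid_points n q w A"
  shows "real (card (A \<inter> anchored_box (corner n x))) - card A * (\<Prod>j\<in>UNIV. corner n x $ j) =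
    grid_points.D n A (grid_point n) x"
proof -
  let ?h = "\<lambda>p. of_bool (fst (grid_point n p) \<le> fst x) * of_bool (fst (snd (grid_point n p)) \<le> fst (snd x)) *
    (of_bool (snd (snd (grid_point n p)) \<le> snd (snd x)) :: real)"
  have "real (card (A \<inter> anchored_box (corner n x))) = (\<Sum>p\<in>A. of_bool (p \<in> anchored_box (corner n x)))"
    using A(1) by (simp add: Int_def)
  also have "\<dots> = (\<Sum>p\<in>A. ?h p)"
  proof (rule sum.cong[OF refl])
    fix p assume "p \<in> A"
    then have "0 \<le> p $ j" for j
      using A(2) by (auto simp: mem_box_cart)
    then show "of_bool (p \<in> anchored_box (corner n x)) = ?h p"
      by (simp add: anchored_box_def forall_3 corner_def grid_point_def digit_le_iff flip: of_bool_conj)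
  qed
  finally have count: "real (card (A \<inter> anchored_box (corner n x))) = (\<Sum>p\<in>A. ?h p)" .
  have "(\<Prod>j\<in>UNIV. corner n x $ j) = (real (fst x) + 1) * (real (fst (snd x)) + 1) * (real (snd (snd x)) + 1) / 2 ^ (3 * (n + 1))"
  proof -
    have "3 * (n + 1) = (n + 1) + (n + 1) + (n + 1)" by simp
    then have "(2 :: real) ^ (3 * (n + 1)) = 2 ^ (n + 1) * 2 ^ (n + 1) * 2 ^ (n + 1)"
      by (simp only: power_add)
    moreover have "(\<Prod>j\<in>UNIV. corner n x $ j) = corner n x $ 1 * corner n x $ 2 * corner n x $ 3"
      by (rule prod_3)
    ultimately show ?thesis
      by (simp only: corner_def vector_3 times_divide_times_eq)
  qed
  then show ?thesis
    unfolding count by (simp add: grid_points.D_def[OF gp])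
qed

text \<open>Anchored boxes are open at the top, so moving \<open>x\<close> slightly downwards in all
  coordinates loses no point and gains none, while the volume changes continuously. A violation at
  \<open>x\<close> would thus persist on a nonempty open box next to \<open>x\<close>, which is not
  a null set.\<close>

lemma AE_discrepancy_bound:
  fixes A :: "(real ^ 3) set"
  assumes A: "finite A" and x: "\<And>j. 0 < x $ j" "\<And>j. x $ j \<le> 1"
    and AE: "AE y in lebesgue_on unit_cube. \<bar>discrepancy A y\<bar> \<le> M"
  shows "\<bar>real (card (A \<inter> anchored_box x)) - card A * (\<Prod>j\<in>UNIV. x $ j)\<bar> \<le> M"
proof (rule ccontr)
  define g where "g y = real (card (A \<inter> anchored_box x)) - card A * (\<Prod>j\<in>UNIV. y $ j)" for y :: "real ^ 3"
  assume "\<not> ?thesis"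
  then have gx: "M < \<bar>g x\<bar>" by (simp add: g_def)
  have "continuous_on UNIV (\<lambda>y. \<bar>g y\<bar>)"
    unfolding g_def by (intro continuous_intros)
  then have "open {y. M < \<bar>g y\<bar>}"
    by (rule open_Collect_less[OF continuous_on_const])
  then obtain e where e: "0 < e" "ball x e \<subseteq> {y. M < \<bar>g y\<bar>}"
    using gx by (auto simp: open_contains_ball)
  \<comment> \<open>All gaps that the displacement must respect: to the coordinates of points below
    \<open>x\<close>, to 0, and to the boundary of the ball, where \<open>e / 4\<close> leaves room
    for three coordinates.\<close>
  define V where "V = (\<lambda>(p, j). x $ j - p $ j) ` {(p, j). p \<in> A \<and> p $ j < x $ j} \<union> range (\<lambda>j. x $ j) \<union> {e / 4}"
  have V: "finite V" "V \<noteq> {}" "\<And>v. v \<in> V \<Longrightarrow> 0 < v"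
  proof -
    have "{(p, j). p \<in> A \<and> p $ j < x $ j} \<subseteq> A \<times> UNIV" by auto
    then have "finite {(p, j). p \<in> A \<and> p $ j < x $ j}"
      by (rule finite_subset) (use A in simp)
    then show "finite V" by (simp add: V_def)
  qed (use x e in \<open>auto simp: V_def\<close>)
  define d where "d = Min V"
  have d: "0 < d" "\<And>v. v \<in> V \<Longrightarrow> d \<le> v"
    using V by (auto simp: d_def)
  define U where "U = box (x - vec d) x"
  have yU: "x $ j - d < y $ j" "y $ j < x $ j" if "y \<in> U" for y j
    using that by (auto simp: U_def mem_box_cart)
  have bad: "\<not> \<bar>discrepancy A y\<bar> \<le> M \<and> y \<in> unit_cube" if y: "y \<in> U" for y
  proof -
    have pos: "0 < y $ j" for j
      using yU(1)[OF y, of j] d(2)[of "x $ j"] by (auto simp: V_def)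
    have "y $ j \<le> 1" for j
      using yU(2)[OF y, of j] x(2)[of j] by linarith
    then have cube: "y \<in> unit_cube"
      using pos by (simp add: mem_box_cart less_imp_le)
    have "p $ j < x $ j \<longleftrightarrow> p $ j < y $ j" if "p \<in> A" for p j
    proof
      assume "p $ j < x $ j"
      then have "d \<le> x $ j - p $ j"
        using that by (intro d(2)) (auto simp: V_def)
      then show "p $ j < y $ j" using yU(1)[OF y, of j] by linarith
    qed (use yU(2)[OF y, of j] in linarith)
    then have "A \<inter> anchored_box x = A \<inter> anchored_box y"
      by (auto simp: anchored_box_def)
    then have "discrepancy A y = g y"
      by (simp add: discrepancy_def g_def anchored_box_measure[OF cube])
    moreover have "y \<in> ball x e"
    proof -
      have "norm (y - x) \<le> (\<Sum>j\<in>UNIV. \<bar>(y - x) $ j\<bar>)"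
        by (rule norm_le_l1_cart)
      also have "\<dots> \<le> (\<Sum>j\<in>(UNIV :: 3 set). d)"
        using yU[OF y] by (intro sum_mono) (simp add: abs_if, smt (verit))
      also have "\<dots> = 3 * d" by simp
      also have "\<dots> < e"
        using d(2)[of "e / 4"] e(1) by (simp add: V_def)
      finally show ?thesis by (simp add: dist_norm norm_minus_commute)
    qed
    ultimately show ?thesis using e(2) cube by auto
  qed
  have "AE y in lebesgue. y \<in> unit_cube \<longrightarrow> \<bar>discrepancy A y\<bar> \<le> M"
    using AE by (subst (asm) AE_restrict_space_iff) auto
  then obtain Z where Z: "Z \<in> null_sets lebesgue" "{y. \<not> (y \<in> unit_cube \<longrightarrow> \<bar>discrepancy A y\<bar> \<le> M)} \<subseteq> Z"
    unfolding eventually_ae_filter by auto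
  have "U \<subseteq> Z" using bad Z(2) by blast
  moreover have "negligible Z" using Z(1) by (simp add: negligible_iff_null_sets)
  ultimately have "negligible U" by (rule negligible_subset[rotated])
  then have "U = {}" by (simp add: U_def negligible_interval)
  moreover have "x - vec (d / 2) \<in> U"
    using d(1) by (simp add: U_def mem_box_cart)
  ultimately show False by simp
qed

lemma exists_level:
  assumes "1 \<le> N"
  shows "\<exists>n. 2 * N \<le> 2 ^ n \<and> 2 ^ n \<le> 4 * (N :: nat)"
proof -
  define n where "n = (LEAST n. 2 * N \<le> 2 ^ n)"
  have "2 * N \<le> 2 ^ (2 * N)" by (simp add: less_imp_le)
  then have 1: "2 * N \<le> 2 ^ n" unfolding n_def by (rule LeastI)
  have "n \<noteq> 0" using 1 assms by (cases n) auto
  then obtain k where k: "n = Suc k" by (cases n) auto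
  then have "\<not> 2 * N \<le> 2 ^ k" unfolding n_def by (metis not_less_Least lessI)
  then show ?thesis using 1 k by (intro exI[of _ n]) simp
qed

text \<open>The conditions for \<open>q\<close> about \<open>y ^ 6\<close>, \<open>z = y ^ 4\<close>
  and \<open>L\<close> about \<open>y ^ 7\<close>, where \<open>n + 1 = y ^ 496\<close>. The main
  contests are \<open>exp (- (y ^ 8))\<close> and \<open>2 powr (y ^ 7)\<close> against powers of
  \<open>n\<close> with exponent of order \<open>y ^ 6\<close>, and
  \<open>exp (- (y ^ 4 / 16))\<close> against a moment of size about
  \<open>exp (4 * y\<^sup>2)\<close>.\<close>

lemma eventually_parameters:
  "\<forall>\<^sub>F y :: real in at_top. 2 \<le> y \<and> exp (4 / y) \<le> 2 \<and> 8 \<le> y ^ 48 \<and> 2 / y ^ 4 \<le> 1 / 4 \<and>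
    (exp (4 / y ^ 4) + exp (1 / 2 - y\<^sup>2 / sqrt 2)) powr (y ^ 6) * (2 * y ^ 6 * exp (- (y ^ 4 / 16))) \<le> 1 \<and>
    (1 + y ^ 497) powr (y ^ 6) * ((2 * (2 * y ^ 496) powr (y ^ 6) + 4 * y ^ 12 * (y ^ 496 + 1) ^ 4) * (2 * exp (- (y ^ 8)))) \<le> 1 / 2 \<and>
    y ^ 6 * (y / y ^ 496 * (2 * (y ^ 7 + 1) + 1)\<^sup>2) \<le> 1 \<and>
    (1 + y ^ 497) powr (y ^ 6) / 2 powr (y ^ 7) \<le> 1 \<and>
    2 * y ^ 12 * y\<^sup>2 * (2 * (y ^ 7 + 1) + 1)\<^sup>2 + 1 \<le> y ^ 497 / 16384 \<and>
    y ^ 496 / 4 \<le> (y ^ 496 - 1) / 2 - y ^ 6"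
  by (intro eventually_conj; real_asymp)

lemma corner_bounds:
  assumes "x \<in> grid n"
  shows "0 < corner n x $ j" "corner n x $ j \<le> 1"
proof -
  have le: "(real i + 1) / 2 ^ (n + 1) \<le> 1" if "i < 2 ^ (n + 1)" for i
  proof -
    have "real (i + 1) \<le> real (2 ^ (n + 1))"
      using that by (simp only: of_nat_le_iff)
    then show ?thesis by simp
  qed
  have "\<forall>j. 0 < corner n x $ j \<and> corner n x $ j \<le> 1"
    using assms le unfolding forall_3 grid_def by (auto simp: corner_def simp del: power_Suc)
  then show "0 < corner n x $ j" "corner n x $ j \<le> 1" by auto
qed

lemma AE_grid_bound:
  assumes A: "finite A" "A \<subseteq> unit_cube" and gp: "grid_points n q w A"
    and AE: "AE y in lebesgue_on unit_cube. \<bar>discrepancy A y\<bar> \<le> M" and x: "x \<in> grid n"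
  shows "\<bar>grid_points.D n A (grid_point n) x\<bar> \<le> M"
  unfolding discrepancy_at_corner[OF A gp, symmetric]
  by (rule AE_discrepancy_bound[OF A(1) corner_bounds[OF x] AE])

lemma large_level_bound:
  fixes A :: "(real ^ 3) set" and y :: real
  assumes A: "finite A" "A \<subseteq> unit_cube" "2 * card A \<le> 2 ^ n" "2 ^ n \<le> 4 * card A"
    and AE: "AE x in lebesgue_on unit_cube. \<bar>discrepancy A x\<bar> \<le> M"
    and n: "real (n + 1) = y ^ 496"
    and y: "2 \<le> y" "exp (4 / y) \<le> 2" "8 \<le> y ^ 48" "2 / y ^ 4 \<le> 1 / 4"
      "(exp (4 / y ^ 4) + exp (1 / 2 - y\<^sup>2 / sqrt 2)) powr (y ^ 6) * (2 * y ^ 6 * exp (- (y ^ 4 / 16))) \<le> 1"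
      "(1 + y ^ 497) powr (y ^ 6) * ((2 * (2 * y ^ 496) powr (y ^ 6) + 4 * y ^ 12 * (y ^ 496 + 1) ^ 4) * (2 * exp (- (y ^ 8)))) \<le> 1 / 2"
      "y ^ 6 * (y / y ^ 496 * (2 * (y ^ 7 + 1) + 1)\<^sup>2) \<le> 1"
      "(1 + y ^ 497) powr (y ^ 6) / 2 powr (y ^ 7) \<le> 1"
      "2 * y ^ 12 * y\<^sup>2 * (2 * (y ^ 7 + 1) + 1)\<^sup>2 + 1 \<le> y ^ 497 / 16384"
      "y ^ 496 / 4 \<le> (y ^ 496 - 1) / 2 - y ^ 6"
  shows "y ^ 497 / 114688 \<le> M"
proof -
  \<comment> \<open>For \<open>\<kappa> = y ^ 31\<close> and \<open>z = y ^ 4\<close>, the value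
    \<open>u\<close> solves \<open>u\<^sup>2 = 4 * \<rho> * \<kappa> ^ 15 * z\<close>, since 1 + 465
    + 4 - 496 = -26. The factor 2 in \<open>K\<close> leaves equal room for the diagonal and the
    off-diagonal part of the layer squares, and \<open>\<rho>\<^sup>2 * K\<close> becomes
    \<open>2 / y ^ 4\<close>. With \<open>w = n div (2 * q)\<close> the blocks occupy about half of
    the first frequencies, so that both \<open>q * w\<close> and \<open>n - q * w\<close> stay of
    order \<open>n\<close>.\<close>
  define q where "q = nat \<lfloor>y ^ 6\<rfloor>"
  define w where "w = n div (2 * q)"
  define L where "L = nat \<lceil>y ^ 7\<rceil>"
  define \<rho> where "\<rho> = y / y ^ 496"
  define u where "u = 2 / y ^ 13"
  define K where "K = 2 * (y ^ 496)\<^sup>2 / y ^ 6"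
  have y0: "0 < y" using y(1) by simp
  have y6: "1 \<le> y ^ 6" using y(1) by simp
  have q: "real q \<le> y ^ 6" "y ^ 6 / 2 \<le> real q" "1 \<le> q"
  proof -
    show "real q \<le> y ^ 6" using y6 by (simp add: q_def)
    have "y ^ 6 < real q + 1" using y6 by (simp add: q_def)
    moreover show "1 \<le> q" using y6 by (simp add: q_def le_nat_iff)
    ultimately show "y ^ 6 / 2 \<le> real q" by linarith
  qed
  have L: "y ^ 7 \<le> real L" "real L \<le> y ^ 7 + 1"
  proof -
    have "0 \<le> y ^ 7" using y0 by simp
    then show "y ^ 7 \<le> real L" "real L \<le> y ^ 7 + 1" by (simp_all add: L_def)
  qed
  have half: "2 * (q * w) \<le> n" "real n / 2 - real q \<le> real (q * w)"
  proof -
    have "2 * q * w \<le> n" unfolding w_def by (rule times_div_less_eq_dividend)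
    then show "2 * (q * w) \<le> n" by simp
    have "n < 2 * q * (w + 1)"
      unfolding w_def using q(3) dividend_less_times_div[of "2 * q" n] by simp
    then have "n < 2 * (q * w) + 2 * q" by (simp add: algebra_simps)
    then have "real n < real (2 * (q * w) + 2 * q)"
      by (simp only: of_nat_less_iff)
    then show "real n / 2 - real q \<le> real (q * w)"
      unfolding of_nat_add of_nat_mult of_nat_numeral by linarith
  qed
  have gp: "grid_points n q w A"
    using A half(1) by unfold_locales auto
  then interpret grid_points n q w A "grid_point n" .
  have pow_q: "a ^ q \<le> a powr (y ^ 6)" if "1 \<le> a" for a :: real
  proof -
    have "a ^ q = a powr real q" using that by (simp add: powr_realpow)
    also have "\<dots> \<le> a powr (y ^ 6)" using that q(1) by (intro powr_mono)
    finally show ?thesis .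
  qed
  have v: "\<rho>\<^sup>2 * K = 2 / y ^ 4"
    using y0 by (simp add: \<rho>_def K_def power2_eq_square field_simps flip: power_add power_Suc)
  have \<rho>N: "\<rho> * (real (n + 1))\<^sup>2 = y ^ 497"
    unfolding n using y0 by (simp add: \<rho>_def power2_eq_square field_simps flip: power_add power_Suc)
  interpret hyperbolic_riesz "grid n" n q w "haar_function n (grid_point n ` A)" "flip1 n" "flip2 n" "flip3 n"
    "y ^ 31" "y ^ 4" \<rho> u K
  proof
    show "1 \<le> y ^ 31" "1 \<le> y ^ 4" using y(1) by simp_all
    show "real (n + 1) = (y ^ 31) ^ 16" unfolding n by (simp flip: power_mult)
    have "2 * y ^ 4 \<le> y ^ 58 * y ^ 4"
    proof (rule mult_right_mono)
      have "y ^ 1 \<le> y ^ 58" using y(1) by (intro power_increasing) auto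
      then show "2 \<le> y ^ 58" using y(1) by simp
    qed (use y0 in simp)
    then show "2 * y ^ 4 \<le> (y ^ 31)\<^sup>2" by (simp flip: power_mult power_add)
    show "0 < \<rho>" using y0 by (simp add: \<rho>_def)
    show "0 \<le> u" using y0 by (simp add: u_def)
    have "y ^ 1 \<le> y ^ 13" using y(1) by (intro power_increasing) auto
    then have "2 \<le> y ^ 13" using y(1) by simp
    then show "u \<le> 1" using y0 by (simp add: u_def)
    have "2 * (real q)\<^sup>2 * u \<le> 2 * (y ^ 6)\<^sup>2 * u"
      using q(1) \<open>0 \<le> u\<close> by (intro mult_right_mono mult_left_mono power_mono) auto
    also have "\<dots> = 4 / y"
      using y0 by (simp add: u_def field_simps flip: power_mult power_Suc)
    finally show "exp (2 * (real q)\<^sup>2 * u) \<le> 2"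
      using y(2) by (meson exp_le_cancel_iff order_trans)
    have "4 * \<rho> * ((y ^ 31) ^ 15 * y ^ 4) = u\<^sup>2"
      using y0 by (simp add: u_def \<rho>_def power_divide field_simps flip: power_mult power_add power_Suc)
    then show "4 * \<rho> * ((y ^ 31) ^ 15 * y ^ 4) \<le> u\<^sup>2" by simp
    show "real (w * (n + 1)) + 8 * (y ^ 4)\<^sup>2 * (y ^ 31) ^ 30 \<le> K"
    proof -
      have "real w * y ^ 6 \<le> real w * (2 * real q)"
        using q(2) by (intro mult_left_mono) auto
      also have "\<dots> = real (2 * (q * w))" by simp
      also have "\<dots> \<le> real (n + 1)" using of_nat_mono[OF half(1), where 'a = real] by simp
      finally have "real w \<le> y ^ 496 / y ^ 6"
        unfolding n using y0 by (simp add: pos_le_divide_eq)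
      then have "real w * y ^ 496 \<le> y ^ 496 / y ^ 6 * y ^ 496"
        using y0 by (intro mult_right_mono) auto
      then have 1: "real (w * (n + 1)) \<le> (y ^ 496)\<^sup>2 / y ^ 6"
        unfolding of_nat_mult n by (simp add: power2_eq_square)
      have "8 * y ^ 938 \<le> y ^ 48 * y ^ 938"
        using y(3) y0 by (intro mult_right_mono) auto
      also have "\<dots> = (y ^ 496)\<^sup>2 / y ^ 6"
        using y0 by (simp add: power2_eq_square field_simps flip: power_add)
      also have "8 * y ^ 938 = 8 * (y ^ 4)\<^sup>2 * (y ^ 31) ^ 30"
        by (simp add: mult.assoc flip: power_mult power_add)
      finally have "8 * (y ^ 4)\<^sup>2 * (y ^ 31) ^ 30 \<le> (y ^ 496)\<^sup>2 / y ^ 6" .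
      then show ?thesis using 1 by (simp add: K_def)
    qed
    show "\<rho>\<^sup>2 * K \<le> 1 / 4" unfolding v by (rule y(4))
    show "(exp (2 * (\<rho>\<^sup>2 * K)) + exp (1 / 2 - 1 / sqrt (\<rho>\<^sup>2 * K))) ^ q * (2 * real q * exp (- (1 / (8 * \<rho>\<^sup>2 * K)))) \<le> 1"
    proof -
      have s: "1 / sqrt (2 / y ^ 4) = y\<^sup>2 / sqrt 2"
      proof -
        have "sqrt (y ^ 4) = y\<^sup>2" using y0 by (intro real_sqrt_unique) (auto simp flip: power_mult)
        then show ?thesis by (simp add: real_sqrt_divide)
      qed
      have e: "8 * \<rho>\<^sup>2 * K = 16 / y ^ 4" using v by simp
      have b: "1 \<le> exp (4 / y ^ 4) + exp (1 / 2 - y\<^sup>2 / sqrt 2)"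
        using y0 by (intro add_increasing2) auto
      have "(exp (4 / y ^ 4) + exp (1 / 2 - y\<^sup>2 / sqrt 2)) ^ q * (2 * real q * exp (- (y ^ 4 / 16))) \<le>
          (exp (4 / y ^ 4) + exp (1 / 2 - y\<^sup>2 / sqrt 2)) powr (y ^ 6) * (2 * y ^ 6 * exp (- (y ^ 4 / 16)))"
        using q(1) y0 by (intro mult_mono pow_q[OF b] mult_nonneg_nonneg) auto
      then have bound: "(exp (4 / y ^ 4) + exp (1 / 2 - y\<^sup>2 / sqrt 2)) ^ q * (2 * real q * exp (- (y ^ 4 / 16))) \<le> 1"
        using y(5) by linarith
      have "2 * (\<rho>\<^sup>2 * K) = 4 / y ^ 4" "1 / sqrt (\<rho>\<^sup>2 * K) = y\<^sup>2 / sqrt 2"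
        using v s by simp_all
      moreover have "1 / (8 * \<rho>\<^sup>2 * K) = y ^ 4 / 16"
        unfolding e by simp
      ultimately show ?thesis
        by (simp only: bound)
    qed
    show "(1 + \<rho> * (real (n + 1))\<^sup>2) ^ q *
      ((2 * (2 * real (n + 1)) ^ q + 4 * (real q)\<^sup>2 * (real (n + 2)) ^ 4) * (2 * exp (- (y ^ 4)\<^sup>2))) \<le> 1 / 2"
    proof -
      have n2: "real (n + 2) = y ^ 496 + 1" using n by simp
      have y8: "(y ^ 4)\<^sup>2 = y ^ 8" by (simp flip: power_mult)
      have big: "1 \<le> y ^ 497" "1 \<le> y ^ 496" using y(1) by simp_all
      have "(real q)\<^sup>2 \<le> (y ^ 6)\<^sup>2" using q(1) by (intro power_mono) auto
      then have q2: "(real q)\<^sup>2 \<le> y ^ 12" by (simp flip: power_mult)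
      have "(1 + y ^ 497) ^ q * ((2 * (2 * y ^ 496) ^ q + 4 * (real q)\<^sup>2 * (y ^ 496 + 1) ^ 4) * (2 * exp (- (y ^ 8)))) \<le>
          (1 + y ^ 497) powr (y ^ 6) * ((2 * (2 * y ^ 496) powr (y ^ 6) + 4 * y ^ 12 * (y ^ 496 + 1) ^ 4) * (2 * exp (- (y ^ 8))))"
        using big q2 y0
        by (intro mult_mono pow_q add_mono mult_nonneg_nonneg add_nonneg_nonneg order_refl) auto
      then show ?thesis
        unfolding \<rho>N unfolding n2 n y8 using y(6) by linarith
    qed
  qed
  have L2: "(real (2 * L + 1))\<^sup>2 \<le> (2 * (y ^ 7 + 1) + 1)\<^sup>2"
    using L(2) by (intro power_mono) auto
  have smallL: "real q * (\<rho> * (real (2 * L + 1))\<^sup>2) \<le> 1"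
  proof -
    have "real q * (\<rho> * (real (2 * L + 1))\<^sup>2) \<le> y ^ 6 * (\<rho> * (2 * (y ^ 7 + 1) + 1)\<^sup>2)"
      using q(1) L2 \<rho> by (intro mult_mono) auto
    then show ?thesis using y(7) by (simp add: \<rho>_def)
  qed
  have main: "\<rho> * (1 / 512) * (real q * real w * real (n - q * w)) -
      2 * (real q)\<^sup>2 * \<rho>\<^sup>2 * (real (n + 1))\<^sup>2 * (real (2 * L + 1))\<^sup>2 - (1 + \<rho> * (real (n + 1))\<^sup>2) ^ q / 2 ^ L \<le> 7 * M"
    by (rule sup_lower_bound[OF AE_grid_bound[OF A(1,2) gp AE] avg_D_le avg_D_haar _ smallL]) auto
  have 1: "y ^ 497 / 8192 \<le> \<rho> * (1 / 512) * (real q * real w * real (n - q * w))"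
  proof -
    have n1: "real n = y ^ 496 - 1" using n by simp
    have big: "y ^ 496 / 4 \<le> real (q * w)"
    proof -
      have "y ^ 496 / 4 \<le> real n / 2 - y ^ 6" using y(10) by (simp only: n1)
      then show ?thesis using half(2) q(1) by linarith
    qed
    have "n \<le> 2 * (n - q * w)"
      using half(1) by linarith
    then have "real n \<le> real (2 * (n - q * w))"
      by (simp only: of_nat_le_iff)
    then have "real n / 2 \<le> real (n - q * w)"
      unfolding of_nat_mult of_nat_numeral by linarith
    then have "y ^ 496 / 4 \<le> real (n - q * w)"
    proof -
      have "y ^ 496 / 4 \<le> real n / 2 - y ^ 6" using y(10) by (simp only: n1)
      then show ?thesis using \<open>real n / 2 \<le> real (n - q * w)\<close> y6 by linarith
    qed
    then have "(y ^ 496 / 4) * (y ^ 496 / 4) \<le> real (q * w) * real (n - q * w)"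
      using big y0 by (intro mult_mono) auto
    then have "\<rho> * (1 / 512) * ((y ^ 496 / 4) * (y ^ 496 / 4)) \<le> \<rho> * (1 / 512) * (real (q * w) * real (n - q * w))"
      using \<rho> by (intro mult_left_mono) auto
    moreover have "\<rho> * (1 / 512) * ((y ^ 496 / 4) * (y ^ 496 / 4)) = y ^ 497 / 8192"
      using y0 by (simp add: \<rho>_def field_simps flip: power_add power_Suc)
    ultimately show ?thesis by simp
  qed
  have 2: "2 * (real q)\<^sup>2 * \<rho>\<^sup>2 * (real (n + 1))\<^sup>2 * (real (2 * L + 1))\<^sup>2 \<le> 2 * y ^ 12 * y\<^sup>2 * (2 * (y ^ 7 + 1) + 1)\<^sup>2"
  proof -
    have "\<rho> * real (n + 1) = y"
      unfolding n \<rho>_def using y0 by simp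
    then have "\<rho>\<^sup>2 * (real (n + 1))\<^sup>2 = y\<^sup>2"
      by (simp only: power_mult_distrib[symmetric])
    then have "2 * (real q)\<^sup>2 * \<rho>\<^sup>2 * (real (n + 1))\<^sup>2 * (real (2 * L + 1))\<^sup>2 = 2 * (real q)\<^sup>2 * y\<^sup>2 * (real (2 * L + 1))\<^sup>2"
      by (simp only: mult.assoc)
    also have "\<dots> \<le> 2 * (y ^ 6)\<^sup>2 * y\<^sup>2 * (2 * (y ^ 7 + 1) + 1)\<^sup>2"
      using q(1) L(2) y0 by (intro mult_mono power_mono) auto
    finally show ?thesis by (simp flip: power_mult)
  qed
  have 3: "(1 + \<rho> * (real (n + 1))\<^sup>2) ^ q / 2 ^ L \<le> 1"
  proof -
    have "2 powr (y ^ 7) \<le> 2 powr real L" using L(1) by (intro powr_mono) auto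
    then have "2 powr (y ^ 7) \<le> 2 ^ L" by (simp add: powr_realpow)
    moreover have "(1 + y ^ 497) ^ q \<le> (1 + y ^ 497) powr (y ^ 6)"
      using y0 by (intro pow_q) auto
    ultimately have "(1 + y ^ 497) ^ q / 2 ^ L \<le> (1 + y ^ 497) powr (y ^ 6) / 2 powr (y ^ 7)"
      by (intro frac_le) auto
    then show ?thesis unfolding \<rho>N using y(8) by linarith
  qed
  \<comment> \<open>The errors take at most half of the main term, which leaves
    \<open>Y / 16384\<close>; dividing by 7 gives 114688.\<close>
  have comb: "Y / 8192 \<le> a \<Longrightarrow> b \<le> b' \<Longrightarrow> c \<le> 1 \<Longrightarrow> b' + 1 \<le> Y / 16384 \<Longrightarrow> a - b - c \<le> 7 * M \<Longrightarrow> Y / 114688 \<le> M"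
    for Y a b b' c :: real
    by linarith
  show ?thesis
    by (rule comb[OF 1 2 3 y(9) main])
qed

text \<open>For the finitely many levels below the asymptotic range a positive constant suffices,
  and a single Haar sum with frequencies \<open>n\<close>, 0, 0 provides one.\<close>

lemma small_level_bound:
  fixes A :: "(real ^ 3) set"
  assumes A: "finite A" "A \<subseteq> unit_cube" "2 * card A \<le> 2 ^ n" "2 ^ n \<le> 4 * card A"
    and AE: "AE x in lebesgue_on unit_cube. \<bar>discrepancy A x\<bar> \<le> M"
  shows "1 / 512 \<le> M"
proof -
  have gp: "grid_points n 0 0 A" using A by unfold_locales auto
  then interpret grid_points n 0 0 A "grid_point n" .
  have "1 / 512 \<le> avg (\<lambda>x. D x * haar_function n (grid_point n ` A) n 0 0 x)"
    by (rule avg_D_haar) simp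
  also have "\<dots> \<le> avg (\<lambda>x. M)"
  proof (rule avg_mono)
    fix x assume x: "x \<in> grid n"
    have "D x * haar_function n (grid_point n ` A) n 0 0 x \<le> \<bar>D x\<bar> * \<bar>haar_function n (grid_point n ` A) n 0 0 x\<bar>"
      by (simp only: abs_mult[symmetric] abs_ge_self)
    also have "\<dots> \<le> \<bar>D x\<bar> * 1"
      by (intro mult_left_mono f_abs x) auto
    also have "\<dots> \<le> M"
      using AE_grid_bound[OF A(1,2) gp AE x] by simp
    finally show "D x * haar_function n (grid_point n ` A) n 0 0 x \<le> M" .
  qed
  finally show ?thesis by simp
qed

lemma level_bound:
  "\<exists>c>0. \<forall>n M. \<forall>A :: (real ^ 3) set. finite A \<and> A \<subseteq> unit_cube \<and> 2 * card A \<le> 2 ^ n \<and> 2 ^ n \<le> 4 * card A \<and>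
    (AE x in lebesgue_on unit_cube. \<bar>discrepancy A x\<bar> \<le> M) \<longrightarrow> c * real (n + 1) powr (1 + 1 / 496) \<le> M"
proof -
  have "filterlim (\<lambda>n. real (n + 1) powr (1 / 496)) at_top sequentially"
    by real_asymp
  from eventually_compose_filterlim[OF eventually_parameters this]
  obtain n0 where n0: "\<And>n. n0 \<le> n \<Longrightarrow>
    (let y = real (n + 1) powr (1 / 496) in 2 \<le> y \<and> exp (4 / y) \<le> 2 \<and> 8 \<le> y ^ 48 \<and> 2 / y ^ 4 \<le> 1 / 4 \<and>
    (exp (4 / y ^ 4) + exp (1 / 2 - y\<^sup>2 / sqrt 2)) powr (y ^ 6) * (2 * y ^ 6 * exp (- (y ^ 4 / 16))) \<le> 1 \<and>
    (1 + y ^ 497) powr (y ^ 6) * ((2 * (2 * y ^ 496) powr (y ^ 6) + 4 * y ^ 12 * (y ^ 496 + 1) ^ 4) * (2 * exp (- (y ^ 8)))) \<le> 1 / 2 \<and>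
    y ^ 6 * (y / y ^ 496 * (2 * (y ^ 7 + 1) + 1)\<^sup>2) \<le> 1 \<and>
    (1 + y ^ 497) powr (y ^ 6) / 2 powr (y ^ 7) \<le> 1 \<and>
    2 * y ^ 12 * y\<^sup>2 * (2 * (y ^ 7 + 1) + 1)\<^sup>2 + 1 \<le> y ^ 497 / 16384 \<and>
    y ^ 496 / 4 \<le> (y ^ 496 - 1) / 2 - y ^ 6)"
    unfolding eventually_sequentially Let_def by blast
  define C where "C = real (n0 + 1) powr (1 + 1 / 496)"
  have C: "0 < C" by (simp add: C_def)
  define c where "c = min (1 / 114688) (1 / 512 / C)"
  have c: "0 < c" "c \<le> 1 / 114688" "c * C \<le> 1 / 512"
  proof -
    show "0 < c" "c \<le> 1 / 114688" using C by (auto simp: c_def)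
    have "c * C \<le> 1 / 512 / C * C" using C by (intro mult_right_mono) (auto simp: c_def)
    then show "c * C \<le> 1 / 512" using C by simp
  qed
  have "c * real (n + 1) powr (1 + 1 / 496) \<le> M"
    if A: "finite A" "A \<subseteq> unit_cube" "2 * card A \<le> 2 ^ n" "2 ^ n \<le> 4 * card A"
      and AE: "AE x in lebesgue_on unit_cube. \<bar>discrepancy A x\<bar> \<le> M"
    for n M and A :: "(real ^ 3) set"
  proof (cases "n0 \<le> n")
    case True
    define y where "y = real (n + 1) powr (1 / 496)"
    have y496: "real (n + 1) = y ^ 496"
      unfolding y_def by (subst powr_power) auto
    have "y ^ 497 / 114688 \<le> M"
      by (rule large_level_bound[OF A AE y496]) (use n0[OF True, folded y_def] in \<open>simp_all add: Let_def\<close>)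
    moreover have "y ^ 497 = real (n + 1) powr (1 + 1 / 496)"
      unfolding y_def by (subst powr_power) auto
    moreover have "c * real (n + 1) powr (1 + 1 / 496) \<le> 1 / 114688 * real (n + 1) powr (1 + 1 / 496)"
      using c(2) by (intro mult_right_mono) auto
    ultimately show ?thesis by linarith
  next
    case False
    then have "real (n + 1) powr (1 + 1 / 496) \<le> C"
      unfolding C_def by (intro powr_mono2) auto
    then have "c * real (n + 1) powr (1 + 1 / 496) \<le> c * C"
      using c(1) by (intro mult_left_mono) auto
    then show ?thesis
      using c(3) small_level_bound[OF A AE] by linarith
  qed
  then show ?thesis using c(1) by blast
qed

theorem theorem2p1p9:
  shows "\<exists>\<eta>::real. 0 < \<eta> \<and> \<eta> < 1 / 2 \<and>
    (\<exists>c::real. c > 0 \<and>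
      (\<forall>N\<ge>1. \<forall>A :: (real ^ 3) set. A \<subseteq> unit_cube \<and> finite A \<and> card A = N \<longrightarrow>
        Linf_norm (lebesgue_on unit_cube) (discrepancy A) \<ge> ereal (c * ln (real N) powr (1 + \<eta>))))"
proof -
  obtain c where c: "0 < c" and bound: "\<forall>n M. \<forall>A :: (real ^ 3) set. finite A \<and> A \<subseteq> unit_cube \<and>
      2 * card A \<le> 2 ^ n \<and> 2 ^ n \<le> 4 * card A \<and> (AE x in lebesgue_on unit_cube. \<bar>discrepancy A x\<bar> \<le> M) \<longrightarrow>
      c * real (n + 1) powr (1 + 1 / 496) \<le> M"
    using level_bound by (elim exE conjE)
  have "ereal (c * ln (real N) powr (1 + 1 / 496)) \<le> Linf_norm (lebesgue_on unit_cube) (discrepancy A)"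
    if N: "1 \<le> N" and A: "A \<subseteq> unit_cube" "finite A" "card A = N" for N and A :: "(real ^ 3) set"
  proof (rule ccontr)
    define X where "X = Linf_norm (lebesgue_on unit_cube) (discrepancy A)"
    define v where "v = c * ln (real N) powr (1 + 1 / 496)"
    assume "\<not> ereal (c * ln (real N) powr (1 + 1 / 496)) \<le> Linf_norm (lebesgue_on unit_cube) (discrepancy A)"
    then have "X < ereal v" by (simp add: X_def v_def)
    \<comment> \<open>A real number strictly between turns the extended-real essential supremum into
      a bound almost everywhere that is still below \<open>v\<close>.\<close>
    then obtain M where M: "X < ereal M" "M < v"
      using ereal_dense2[of X "ereal v"] by auto
    obtain n where n: "2 * N \<le> 2 ^ n" "2 ^ n \<le> 4 * N"
      using exists_level[OF N] by blast
    have "AE x in lebesgue_on unit_cube. ereal \<bar>discrepancy A x\<bar> \<le> X"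
      unfolding X_def Linf_norm_def by (rule esssup_AE)
    then have "AE x in lebesgue_on unit_cube. \<bar>discrepancy A x\<bar> \<le> M"
    proof (rule AE_mp, intro AE_I2 impI)
      fix x assume "ereal \<bar>discrepancy A x\<bar> \<le> X"
      then have "ereal \<bar>discrepancy A x\<bar> \<le> ereal M" using M(1) by (meson less_imp_le order_trans)
      then show "\<bar>discrepancy A x\<bar> \<le> M" by simp
    qed
    then have le: "c * real (n + 1) powr (1 + 1 / 496) \<le> M"
      using A n by (intro bound[rule_format, where A = A]) simp
    have "ln (real N) \<le> real (n + 1)"
    proof -
      have "N \<le> 2 ^ n" using n(1) by simp
      then have "real N \<le> 2 ^ n" using of_nat_mono[of N "2 ^ n", where 'a = real] by simp
      then have "ln (real N) \<le> ln (2 ^ n)" using N by simp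
      also have "\<dots> = real n * ln 2" by (simp add: ln_realpow)
      also have "\<dots> \<le> real n * 1" using ln_2_less_1 by (intro mult_left_mono) auto
      finally show ?thesis by simp
    qed
    then have "ln (real N) powr (1 + 1 / 496) \<le> real (n + 1) powr (1 + 1 / 496)"
      using N by (intro powr_mono2) auto
    then have "v \<le> c * real (n + 1) powr (1 + 1 / 496)"
      unfolding v_def using c by (intro mult_left_mono) auto
    then show False using le M(2) by linarith
  qed
  then show ?thesis
    using c by (intro exI[of _ "1 / 496"] conjI exI[of _ c]) auto
qed

end
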